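(* Let $n\ge 1$ and $d,e,m\ge 0$ be integers. Let $r$ be the rank of the reduced Padé matrix $\hat P_T$ at a generic point $T$ of the Taylor variety $\mathcal{T}^n_{d,e,m}$ (that is, the constant value of $\operatorname{rank}\hat P_T$ on a suitable nonempty Zariski open subset of $\mathcal{T}^n_{d,e,m}$). If $\binom{d+n}{n}-1+r<\binom{n+m}{n}$, then $$\dim \mathcal{T}^n_{d,e,m}=\binom{d+n}{n}-1+r.$$
   Context: Work over $\mathbb{C}$ with variables $x=(x_1,\dots,x_n)$; for $\gamma\in\mathbb{N}^n$ write $x^\gamma=x_1^{\gamma_1}\cdots x_n^{\gamma_n}$ and $|\gamma|=\gamma_1+\cdots+\gamma_n$. Let $\mathbb{P}^{\binom{n+m}{n}-1}$ be the projective space with coordinates $c_\gamma$, $|\gamma|\le m$, whose points are nonzero polynomials $T=\sum_{|\gamma|\le m}c_\gamma x^\gamma$ up to scaling. The Taylor variety $\mathcal{T}^n_{d,e,m}\subseteq\mathbb{P}^{\binom{n+m}{n}-1}$ is the Zariski closure of the set of all order-$m$ Taylor polynomials at the origin (Taylor series truncated after total degree $m$) of rational functions $P/Q$ with $P,Q\in\mathbb{C}[x]$, $\deg P\le d$, $\deg Q\le e$, $P(0)=Q(0)=1$. It is an irreducible projective variety. $M_{a,b}$ denotes the set of monomials in $x$ (identified with exponent vectors) of total degree at least $a$ and at most $b$. The Padé matrix $P_T$ has rows indexed by $M_{d+1,m}$ and columns indexed by $M_{0,e}$; its entry in row $x^\alpha$ and column $x^\beta$ is $c_{\alpha-\beta}$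 if $\beta\le\alpha$ componentwise and $0$ otherwise. The reduced Padé matrix $\hat P_T$ is obtained from $P_T$ by deleting the column indexed by the monomial $1$. Thus $\hat P_T$ has $\binom{m+n}{n}-\binom{d+n}{n}$ rows (when $m\ge d$) and $\binom{e+n}{n}-1$ columns, and it represents the linear map sending a polynomial $Q$ with $\deg Q\le e$ and $Q(0)=0$ to the part of $QT$ supported on the monomials in $M_{d+1,m}$. *)

theory Defs
  imports
    "HOL-Analysis.Analysis"
    "HOL-Library.Poly_Mapping"
    "HOL-Library.Extended_Nat"
    "Jordan_Normal_Form.DL_Rank"
begin

hide_const (open) Poly_Mapping.range Poly_Mapping.degree

abbreviation lookup :: "('a \<Rightarrow>\<^sub>0 'b::zero) \<Rightarrow> 'a \<Rightarrow> 'b"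
  where "lookup \<equiv> Poly_Mapping.lookup"

abbreviation keys :: "('a \<Rightarrow>\<^sub>0 'b::zero) \<Rightarrow> 'a set"
  where "keys \<equiv> Poly_Mapping.keys"

section \<open>Monomials and polynomials\<close>

text \<open>
  A monomial is identified with its exponent vector, of type \<open>'v \<Rightarrow>\<^sub>0 nat\<close>, and a polynomial is
  the finitely supported family of its coefficients. The library multiplication on
  \<open>('v \<Rightarrow>\<^sub>0 nat) \<Rightarrow>\<^sub>0 'a\<close> is the convolution product, i.e. multiplication of polynomials.
  Polynomials in \<open>x\<^sub>1, \<dots>, x\<^sub>n\<close> use the variable indices \<open>{..<n}\<close>. The library order on
  \<open>nat \<Rightarrow>\<^sub>0 nat\<close> is a lexicographic linear order, not divisibility of monomials.
\<close>

type_synonym expo = "nat \<Rightarrow>\<^sub>0 nat"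

definition mdeg :: "('v \<Rightarrow>\<^sub>0 nat) \<Rightarrow> nat"
  where "mdeg \<gamma> = (\<Sum>i\<in>keys \<gamma>. lookup \<gamma> i)"

definition mon_eval :: "('v \<Rightarrow> 'a::comm_ring_1) \<Rightarrow> ('v \<Rightarrow>\<^sub>0 nat) \<Rightarrow> 'a"
  where "mon_eval x \<gamma> = (\<Prod>i\<in>keys \<gamma>. x i ^ lookup \<gamma> i)"

definition poly_eval :: "('v \<Rightarrow> 'a::comm_ring_1) \<Rightarrow> (('v \<Rightarrow>\<^sub>0 nat) \<Rightarrow>\<^sub>0 'a) \<Rightarrow> 'a"
  where "poly_eval x F = (\<Sum>\<gamma>\<in>keys F. lookup F \<gamma> * mon_eval x \<gamma>)"

definition monoms :: "nat \<Rightarrow> nat \<Rightarrow> nat \<Rightarrow> expo set"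
  where "monoms n a b = {\<gamma>. keys \<gamma> \<subseteq> {..<n} \<and> a \<le> mdeg \<gamma> \<and> mdeg \<gamma> \<le> b}"

definition polys :: "nat \<Rightarrow> nat \<Rightarrow> (expo \<Rightarrow>\<^sub>0 complex) set"
  where "polys n d = {P. keys P \<subseteq> monoms n 0 d}"

lemma mdeg_superset:
  assumes "finite A" "keys \<gamma> \<subseteq> A"
  shows "mdeg \<gamma> = (\<Sum>i\<in>A. lookup \<gamma> i)"
  unfolding mdeg_def
  by (rule sum.mono_neutral_left) (use assms in \<open>auto simp: in_keys_iff\<close>)

lemma mdeg_add: "mdeg (\<gamma> + \<delta>) = mdeg \<gamma> + mdeg \<delta>"
proof -
  let ?A = "keys \<gamma> \<union> keys \<delta>"
  have "mdeg (\<gamma> + \<delta>) = (\<Sum>i\<in>?A. lookup (\<gamma> + \<delta>) i)"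
    by (rule mdeg_superset) (simp_all add: Poly_Mapping.keys_add)
  moreover have "mdeg \<gamma> = (\<Sum>i\<in>?A. lookup \<gamma> i)" "mdeg \<delta> = (\<Sum>i\<in>?A. lookup \<delta> i)"
    by (rule mdeg_superset; simp)+
  ultimately show ?thesis
    by (simp add: lookup_add sum.distrib)
qed

lemma mon_eval_superset:
  assumes "finite A" "keys \<gamma> \<subseteq> A"
  shows "mon_eval x \<gamma> = (\<Prod>i\<in>A. x i ^ lookup \<gamma> i)"
  unfolding mon_eval_def
  by (rule prod.mono_neutral_left) (use assms in \<open>auto simp: in_keys_iff\<close>)

lemma mon_eval_add: "mon_eval x (\<gamma> + \<delta>) = mon_eval x \<gamma> * mon_eval x \<delta>"
proof -
  let ?A = "keys \<gamma> \<union> keys \<delta>"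
  have "mon_eval x (\<gamma> + \<delta>) = (\<Prod>i\<in>?A. x i ^ lookup (\<gamma> + \<delta>) i)"
    by (rule mon_eval_superset) (simp_all add: Poly_Mapping.keys_add)
  moreover have "mon_eval x \<gamma> = (\<Prod>i\<in>?A. x i ^ lookup \<gamma> i)"
    "mon_eval x \<delta> = (\<Prod>i\<in>?A. x i ^ lookup \<delta> i)"
    by (rule mon_eval_superset; simp)+
  ultimately show ?thesis
    by (simp add: lookup_add power_add prod.distrib)
qed

lemma mon_eval_scale: "mon_eval (\<lambda>i. a * x i) \<gamma> = a ^ mdeg \<gamma> * mon_eval x \<gamma>"
  by (simp add: mon_eval_def mdeg_def power_mult_distrib prod.distrib power_sum)

lemma poly_eval_superset:
  assumes "finite A" "keys F \<subseteq> A"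
  shows "poly_eval x F = (\<Sum>\<gamma>\<in>A. lookup F \<gamma> * mon_eval x \<gamma>)"
  unfolding poly_eval_def
  by (rule sum.mono_neutral_left) (use assms in \<open>auto simp: in_keys_iff\<close>)

lemma poly_eval_zero [simp]: "poly_eval x 0 = 0"
  by (simp add: poly_eval_def)

lemma poly_eval_add: "poly_eval x (F + G) = poly_eval x F + poly_eval x G"
proof -
  let ?A = "keys F \<union> keys G"
  have "poly_eval x (F + G) = (\<Sum>\<gamma>\<in>?A. lookup (F + G) \<gamma> * mon_eval x \<gamma>)"
    by (rule poly_eval_superset) (simp_all add: Poly_Mapping.keys_add)
  moreover have "poly_eval x F = (\<Sum>\<gamma>\<in>?A. lookup F \<gamma> * mon_eval x \<gamma>)"
    "poly_eval x G = (\<Sum>\<gamma>\<in>?A. lookup G \<gamma> * mon_eval x \<gamma>)"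
    by (rule poly_eval_superset; simp)+
  ultimately show ?thesis
    by (simp add: lookup_add distrib_right sum.distrib)
qed

lemma poly_eval_sum: "poly_eval x (\<Sum>i\<in>I. F i) = (\<Sum>i\<in>I. poly_eval x (F i))"
  by (induction I rule: infinite_finite_induct) (simp_all add: poly_eval_add)

lemma poly_eval_single: "poly_eval x (Poly_Mapping.single \<gamma> c) = c * mon_eval x \<gamma>"
  by (simp add: poly_eval_def)

lemma poly_mapping_eq_sum_single: "F = (\<Sum>\<gamma>\<in>keys F. Poly_Mapping.single \<gamma> (lookup F \<gamma>))"
proof (rule poly_mapping_eqI)
  fix k
  show "lookup F k = lookup (\<Sum>\<gamma>\<in>keys F. Poly_Mapping.single \<gamma> (lookup F \<gamma>)) k"
    by (simp add: lookup_sum lookup_single when_def in_keys_iff)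
qed

lemma poly_eval_mult: "poly_eval x (F * G) = poly_eval x F * poly_eval x G"
proof -
  have "F * G = (\<Sum>\<gamma>\<in>keys F. Poly_Mapping.single \<gamma> (lookup F \<gamma>))
                 * (\<Sum>\<delta>\<in>keys G. Poly_Mapping.single \<delta> (lookup G \<delta>))"
    using poly_mapping_eq_sum_single[of F] poly_mapping_eq_sum_single[of G] by simp
  also have "\<dots> = (\<Sum>\<gamma>\<in>keys F. \<Sum>\<delta>\<in>keys G.
      Poly_Mapping.single (\<gamma> + \<delta>) (lookup F \<gamma> * lookup G \<delta>))"
    by (simp add: sum_product mult_single)
  finally have "poly_eval x (F * G) = (\<Sum>\<gamma>\<in>keys F. \<Sum>\<delta>\<in>keys G.
      (lookup F \<gamma> * lookup G \<delta>) * mon_eval x (\<gamma> + \<delta>))"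
    by (simp add: poly_eval_sum poly_eval_single)
  also have "\<dots> = poly_eval x F * poly_eval x G"
    by (simp add: poly_eval_def sum_product mon_eval_add algebra_simps)
  finally show ?thesis .
qed

lemma finite_monoms [simp]: "finite (monoms n a b)"
proof -
  have "inj_on lookup (monoms n a b)"
    by (auto intro!: inj_onI poly_mapping_eqI)
  moreover have "lookup ` monoms n a b \<subseteq> {f. \<forall>i. (i \<in> {..<n} \<longrightarrow> f i \<in> {..b}) \<and> (i \<notin> {..<n} \<longrightarrow> f i = 0)}"
  proof -
    have "lookup \<gamma> i \<le> b" if "\<gamma> \<in> monoms n a b" for \<gamma> i
    proof (cases "i \<in> keys \<gamma>")
      case True
      then have "lookup \<gamma> i \<le> mdeg \<gamma>"
        unfolding mdeg_def by (intro member_le_sum) simp_all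
      with that show ?thesis by (simp add: monoms_def)
    qed (simp add: in_keys_iff)
    moreover have "lookup \<gamma> i = 0" if "\<gamma> \<in> monoms n a b" "i \<notin> {..<n}" for \<gamma> i
      using that by (auto simp: monoms_def in_keys_iff)
    ultimately show ?thesis by auto
  qed
  moreover have "finite {f::nat \<Rightarrow> nat. \<forall>i. (i \<in> {..<n} \<longrightarrow> f i \<in> {..b}) \<and> (i \<notin> {..<n} \<longrightarrow> f i = 0)}"
    by (rule finite_set_of_finite_funs) simp_all
  ultimately show ?thesis
    by (meson finite_imageD finite_subset)
qed


section \<open>Projective space and its Zariski topology\<close>

text \<open>
  A point of the projective space with coordinates \<open>c\<^sub>\<gamma>\<close> (\<open>\<gamma> \<in> M\<^sub>0\<^sub>,\<^sub>m\<close>) is the set of all nonzero scalar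
  multiples of a nonzero polynomial of degree at most \<open>m\<close>.
\<close>

type_synonym ppoint = "(expo \<Rightarrow>\<^sub>0 complex) set"

definition proj_point :: "(expo \<Rightarrow>\<^sub>0 complex) \<Rightarrow> ppoint"
  where "proj_point T = {Poly_Mapping.map ((*) a) T | a. a \<noteq> 0}"

definition proj_space :: "nat \<Rightarrow> nat \<Rightarrow> ppoint set"
  where "proj_space n m = proj_point ` (polys n m - {0})"

text \<open>
  Homogeneous polynomials in the coordinates \<open>c\<^sub>\<gamma>\<close>: here the index set of the variables is itself
  the set of exponent vectors. Such a form is evaluated at \<open>T\<close> by substituting \<open>lookup T \<gamma>\<close> for
  \<open>c\<^sub>\<gamma>\<close>.
\<close>

definition forms :: "nat \<Rightarrow> nat \<Rightarrow> ((expo \<Rightarrow>\<^sub>0 nat) \<Rightarrow>\<^sub>0 complex) set"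
  where "forms n m = {F. (\<forall>\<mu>\<in>keys F. keys \<mu> \<subseteq> monoms n 0 m) \<and> (\<exists>k. \<forall>\<mu>\<in>keys F. mdeg \<mu> = k)}"

definition zero_locus :: "nat \<Rightarrow> nat \<Rightarrow> ((expo \<Rightarrow>\<^sub>0 nat) \<Rightarrow>\<^sub>0 complex) set \<Rightarrow> ppoint set"
  where "zero_locus n m S =
    {p \<in> proj_space n m. \<forall>T\<in>p. \<forall>F\<in>S. poly_eval (lookup T) F = 0}"

definition zariski :: "nat \<Rightarrow> nat \<Rightarrow> ppoint topology"
  where "zariski n m =
    topology (\<lambda>U. \<exists>S\<subseteq>forms n m. U = proj_space n m - zero_locus n m S)"

lemma lookup_map_times: "lookup (Poly_Mapping.map ((*) a) T) \<gamma> = a * lookup T \<gamma>"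
  for a :: complex
  by (simp add: map.rep_eq when_def)

lemma form_eval_scale:
  assumes "F \<in> forms n m"
  obtains k where "\<And>a T. poly_eval (lookup (Poly_Mapping.map ((*) a) T)) F = a ^ k * poly_eval (lookup T) F"
proof -
  obtain k where k: "\<forall>\<mu>\<in>keys F. mdeg \<mu> = k"
    using assms by (auto simp: forms_def)
  have "poly_eval (lookup (Poly_Mapping.map ((*) a) T)) F = a ^ k * poly_eval (lookup T) F" for a T
  proof -
    have "lookup (Poly_Mapping.map ((*) a) T) = (\<lambda>\<gamma>. a * lookup T \<gamma>)"
      by (rule ext) (rule lookup_map_times)
    then have "poly_eval (lookup (Poly_Mapping.map ((*) a) T)) F =
        (\<Sum>\<mu>\<in>keys F. lookup F \<mu> * (a ^ mdeg \<mu> * mon_eval (lookup T) \<mu>))"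
      by (simp only: poly_eval_def mon_eval_scale)
    also have "\<dots> = (\<Sum>\<mu>\<in>keys F. a ^ k * (lookup F \<mu> * mon_eval (lookup T) \<mu>))"
      by (rule sum.cong) (use k in auto)
    finally show ?thesis by (simp only: poly_eval_def sum_distrib_left)
  qed
  then show thesis by (rule that)
qed

lemma mem_zero_locus_iff:
  assumes "S \<subseteq> forms n m"
  shows "proj_point T \<in> zero_locus n m S \<longleftrightarrow>
    proj_point T \<in> proj_space n m \<and> (\<forall>F\<in>S. poly_eval (lookup T) F = 0)"
proof -
  have "poly_eval (lookup (Poly_Mapping.map ((*) a) T)) F = 0 \<longleftrightarrow> poly_eval (lookup T) F = 0"
    if "F \<in> S" "a \<noteq> 0" for F a
  proof -
    from that assms have "F \<in> forms n m" by blast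
    then obtain k where
      "\<And>a T. poly_eval (lookup (Poly_Mapping.map ((*) a) T)) F = a ^ k * poly_eval (lookup T) F"
      using form_eval_scale by blast
    with that show ?thesis by simp
  qed
  moreover have "\<exists>a::complex. a \<noteq> 0" by (rule exI[of _ 1]) simp
  ultimately show ?thesis
    unfolding zero_locus_def proj_point_def by blast
qed

lemma forms_mult:
  assumes "F \<in> forms n m" "G \<in> forms n m"
  shows "F * G \<in> forms n m"
proof -
  obtain k l where k: "\<forall>\<mu>\<in>keys F. mdeg \<mu> = k" and l: "\<forall>\<mu>\<in>keys G. mdeg \<mu> = l"
    using assms by (auto simp: forms_def)
  have "keys \<mu> \<subseteq> monoms n 0 m \<and> mdeg \<mu> = k + l" if "\<mu> \<in> keys (F * G)" for \<mu>
  proof -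
    obtain a b where ab: "\<mu> = a + b" "a \<in> keys F" "b \<in> keys G"
      using \<open>\<mu> \<in> keys (F * G)\<close> keys_mult[of F G] by blast
    moreover have "keys a \<subseteq> monoms n 0 m" "keys b \<subseteq> monoms n 0 m"
      using ab assms by (auto simp: forms_def)
    ultimately show ?thesis
      using k l Poly_Mapping.keys_add[of a b] by (auto simp: mdeg_add)
  qed
  then show ?thesis by (auto simp: forms_def)
qed

lemma zero_locus_Un:
  assumes "S \<subseteq> forms n m" "S' \<subseteq> forms n m"
  shows "zero_locus n m S \<union> zero_locus n m S' = zero_locus n m {F * G | F G. F \<in> S \<and> G \<in> S'}"
    (is "_ = zero_locus n m ?P")
proof -
  have P: "?P \<subseteq> forms n m" using assms forms_mult by blast
  have eq: "(\<forall>H\<in>?P. poly_eval (lookup T) H = 0) \<longleftrightarrow>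
      (\<forall>F\<in>S. poly_eval (lookup T) F = 0) \<or> (\<forall>G\<in>S'. poly_eval (lookup T) G = 0)" for T
  proof -
    have "(\<forall>H\<in>?P. poly_eval (lookup T) H = 0) \<longleftrightarrow>
        (\<forall>F\<in>S. \<forall>G\<in>S'. poly_eval (lookup T) (F * G) = 0)" by blast
    then show ?thesis unfolding poly_eval_mult mult_eq_0_iff by blast
  qed
  have "proj_point T \<in> zero_locus n m S \<union> zero_locus n m S' \<longleftrightarrow> proj_point T \<in> zero_locus n m ?P" for T
    unfolding Un_iff mem_zero_locus_iff[OF P] mem_zero_locus_iff[OF assms(1)]
      mem_zero_locus_iff[OF assms(2)] eq
    by blast
  moreover have "zero_locus n m A \<subseteq> proj_point ` UNIV" for A
    by (auto simp: zero_locus_def proj_space_def)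
  ultimately show ?thesis by blast
qed

lemma openin_zariski:
  "openin (zariski n m) U \<longleftrightarrow> (\<exists>S\<subseteq>forms n m. U = proj_space n m - zero_locus n m S)"
proof -
  let ?L = "\<lambda>U. \<exists>S\<subseteq>forms n m. U = proj_space n m - zero_locus n m S"
  have "istopology ?L"
    unfolding istopology_def
  proof (intro conjI allI impI)
    fix U V assume "?L U" "?L V"
    then obtain S S' where S: "S \<subseteq> forms n m" "U = proj_space n m - zero_locus n m S"
      and S': "S' \<subseteq> forms n m" "V = proj_space n m - zero_locus n m S'" by blast
    have "{F * G | F G. F \<in> S \<and> G \<in> S'} \<subseteq> forms n m"
      using S(1) S'(1) forms_mult by blast
    moreover have "U \<inter> V = proj_space n m - zero_locus n m {F * G | F G. F \<in> S \<and> G \<in> S'}"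
      unfolding S(2) S'(2) zero_locus_Un[OF S(1) S'(1), symmetric] by blast
    ultimately show "?L (U \<inter> V)" by blast
  next
    fix K assume "\<forall>U\<in>K. ?L U"
    then obtain S where S: "\<forall>U\<in>K. S U \<subseteq> forms n m \<and> U = proj_space n m - zero_locus n m (S U)"
      by metis
    have "(\<Union>U\<in>K. S U) \<subseteq> forms n m" using S by blast
    moreover have "\<Union>K = proj_space n m - zero_locus n m (\<Union>U\<in>K. S U)"
    proof -
      have "\<Union>K = (\<Union>U\<in>K. proj_space n m - zero_locus n m (S U))"
      proof -
        have "(\<Union>U\<in>K. U) = (\<Union>U\<in>K. proj_space n m - zero_locus n m (S U))"
          by (rule SUP_cong[OF refl]) (use S in blast)
        then show ?thesis by simp
      qed
      also have "\<dots> = proj_space n m - zero_locus n m (\<Union>U\<in>K. S U)"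
        unfolding zero_locus_def by auto
      finally show ?thesis .
    qed
    ultimately show "?L (\<Union>K)" by blast
  qed
  then show ?thesis
    by (simp add: zariski_def topology_inverse')
qed

lemma topspace_zariski [simp]: "topspace (zariski n m) = proj_space n m"
proof -
  have "zero_locus n m {1} = {}"
  proof -
    have "poly_eval x 1 = (1::complex)" for x :: "expo \<Rightarrow> complex"
      by (simp add: poly_eval_def mon_eval_def)
    moreover have "proj_point T \<noteq> {}" for T
      unfolding proj_point_def by (auto intro: exI[of _ 1])
    ultimately show ?thesis
      by (auto simp: zero_locus_def proj_space_def)
  qed
  moreover have "{1} \<subseteq> forms n m" by (auto simp: forms_def)
  ultimately have "openin (zariski n m) (proj_space n m)"
    unfolding openin_zariski by (metis Diff_empty)
  moreover have "U \<subseteq> proj_space n m" if "openin (zariski n m) U" for U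
    using that unfolding openin_zariski by blast
  ultimately show ?thesis
    by (simp add: openin_subset subset_antisym)
qed

lemma closedin_zariski:
  "closedin (zariski n m) C \<longleftrightarrow> (\<exists>S\<subseteq>forms n m. C = zero_locus n m S)"
proof -
  have "zero_locus n m S \<subseteq> proj_space n m" for S
    by (auto simp: zero_locus_def)
  then show ?thesis
    unfolding closedin_def topspace_zariski openin_zariski
    by (metis double_diff order_refl)
qed


section \<open>Dimension of a topological space\<close>

definition irreducible_in :: "'a topology \<Rightarrow> 'a set \<Rightarrow> bool"
  where "irreducible_in X Z \<longleftrightarrow> Z \<subseteq> topspace X \<and> Z \<noteq> {} \<and>
    (\<forall>A B. closedin X A \<and> closedin X B \<and> Z \<subseteq> A \<union> B \<longrightarrow> Z \<subseteq> A \<or> Z \<subseteq> B)"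

text \<open>
  The Krull dimension: the supremum of the lengths \<open>k\<close> of chains \<open>Z\<^sub>0 \<subset> \<dots> \<subset> Z\<^sub>k\<close> of irreducible
  closed subsets. For the empty space this gives \<open>0\<close>.
\<close>

definition krull_dim :: "'a topology \<Rightarrow> enat"
  where "krull_dim X = Sup {enat k | k. \<exists>Z :: nat \<Rightarrow> 'a set.
    (\<forall>i\<le>k. closedin X (Z i) \<and> irreducible_in X (Z i)) \<and> (\<forall>i<k. Z i \<subset> Z (Suc i))}"


section \<open>Taylor varieties\<close>

text \<open>
  Points of affine space are functions \<open>x :: nat \<Rightarrow> complex\<close>; a polynomial in \<open>polys n d\<close> only reads
  \<open>x i\<close> for \<open>i < n\<close>. The iterated partial derivatives are taken in increasing order of the
  variables; at the origin of a rational function regular there the order is immaterial.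
\<close>

definition partial_deriv :: "nat \<Rightarrow> ((nat \<Rightarrow> complex) \<Rightarrow> complex) \<Rightarrow> (nat \<Rightarrow> complex) \<Rightarrow> complex"
  where "partial_deriv i f = (\<lambda>x. deriv (\<lambda>t. f (x(i := t))) (x i))"

definition partial_derivs :: "expo \<Rightarrow> ((nat \<Rightarrow> complex) \<Rightarrow> complex) \<Rightarrow> (nat \<Rightarrow> complex) \<Rightarrow> complex"
  where "partial_derivs \<gamma> f =
    fold (\<lambda>i. partial_deriv i ^^ lookup \<gamma> i) (sorted_list_of_set (keys \<gamma>)) f"

definition taylor_poly :: "nat \<Rightarrow> nat \<Rightarrow> ((nat \<Rightarrow> complex) \<Rightarrow> complex) \<Rightarrow> (expo \<Rightarrow>\<^sub>0 complex)"
  where "taylor_poly n m f = (\<Sum>\<gamma>\<in>monoms n 0 m.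
    Poly_Mapping.single \<gamma> (partial_derivs \<gamma> f (\<lambda>_. 0) / (\<Prod>i\<in>keys \<gamma>. fact (lookup \<gamma> i))))"

definition taylor_polys :: "nat \<Rightarrow> nat \<Rightarrow> nat \<Rightarrow> nat \<Rightarrow> (expo \<Rightarrow>\<^sub>0 complex) set"
  where "taylor_polys n d e m =
    {taylor_poly n m (\<lambda>x. poly_eval x P / poly_eval x Q) | P Q.
      P \<in> polys n d \<and> Q \<in> polys n e \<and> poly_eval (\<lambda>_. 0) P = 1 \<and> poly_eval (\<lambda>_. 0) Q = 1}"

definition taylor_variety :: "nat \<Rightarrow> nat \<Rightarrow> nat \<Rightarrow> nat \<Rightarrow> ppoint set"
  where "taylor_variety n d e m = zariski n m closure_of (proj_point ` taylor_polys n d e m)"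

definition taylor_top :: "nat \<Rightarrow> nat \<Rightarrow> nat \<Rightarrow> nat \<Rightarrow> ppoint topology"
  where "taylor_top n d e m = subtopology (zariski n m) (taylor_variety n d e m)"


section \<open>Pade matrices\<close>

definition pade_entry :: "(expo \<Rightarrow>\<^sub>0 complex) \<Rightarrow> expo \<Rightarrow> expo \<Rightarrow> complex"
  where "pade_entry T \<alpha> \<beta> = (if \<forall>i. lookup \<beta> i \<le> lookup \<alpha> i then lookup T (\<alpha> - \<beta>) else 0)"

text \<open>
  The rows and columns are listed in the library order on exponent vectors; this choice does
  not affect the rank.
\<close>

definition pade_submatrix :: "expo list \<Rightarrow> expo list \<Rightarrow> (expo \<Rightarrow>\<^sub>0 complex) \<Rightarrow> complex mat"
  where "pade_submatrix rs cs T =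
    mat (length rs) (length cs) (\<lambda>(i, j). pade_entry T (rs ! i) (cs ! j))"

definition pade_matrix :: "nat \<Rightarrow> nat \<Rightarrow> nat \<Rightarrow> nat \<Rightarrow> (expo \<Rightarrow>\<^sub>0 complex) \<Rightarrow> complex mat"
  where "pade_matrix n d e m =
    pade_submatrix (sorted_list_of_set (monoms n (d + 1) m)) (sorted_list_of_set (monoms n 0 e))"

definition reduced_pade_matrix :: "nat \<Rightarrow> nat \<Rightarrow> nat \<Rightarrow> nat \<Rightarrow> (expo \<Rightarrow>\<^sub>0 complex) \<Rightarrow> complex mat"
  where "reduced_pade_matrix n d e m =
    pade_submatrix (sorted_list_of_set (monoms n (d + 1) m)) (sorted_list_of_set (monoms n 0 e - {0}))"

definition mat_rank :: "complex mat \<Rightarrow> nat"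
  where "mat_rank A = vec_space.rank (dim_row A) A"

definition generic_pade_rank :: "nat \<Rightarrow> nat \<Rightarrow> nat \<Rightarrow> nat \<Rightarrow> nat \<Rightarrow> bool"
  where "generic_pade_rank n d e m r \<longleftrightarrow>
    (\<exists>U. openin (taylor_top n d e m) U \<and> U \<noteq> {} \<and>
      (\<forall>p\<in>U. \<forall>T\<in>p. mat_rank (reduced_pade_matrix n d e m T) = r))"

end

theory Submission
  imports Defs
begin

text \<open>
  The fibres of the map \<open>(P, Q) \<mapsto> P / Q\<close> onto Taylor polynomials are affine linear: the
  denominators producing a given \<open>T\<close> form a coset of the kernel of its reduced Pade matrix. If \<open>J\<close>
  indexes \<open>r\<close> columns that are independent at a general point, then a general \<open>T\<close> has exactly one
  denominator supported on \<open>J\<close>. So the Taylor variety is the closure of the image of a linear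
  space \<open>L\<close> whose coordinates are the nonconstant numerator coefficients and the denominator
  coefficients in \<open>J\<close>, and fraction-free elimination recovers these coordinates rationally from \<open>T\<close>.

  Lower bound: the closures of the images of a flag of coordinate subspaces through a general point
  of \<open>L\<close> form a strict chain, since every coordinate is a quotient of two forms in \<open>T\<close>. Upper
  bound: forms separating the members of a chain of length \<open>l\<close> give \<open>(N + 1)\<^sup>l\<close> linearly
  independent forms of degree \<open>O(N)\<close> on the variety, but pulled back to \<open>L\<close> these are polynomials
  of degree \<open>O(N)\<close> in \<open>dim L\<close> variables, so \<open>l \<le> dim L\<close>.
\<close>

text \<open>Points are projective, so a parameter can be read off only as an identity between two
  forms of equal degree. The constant coefficient, which is 1 on the parametrization, supplies the
  factors that balance degrees. Rows of degree 1 to \<open>d\<close> are met by choosing the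
  numerator; the rows of degree \<open>d + 1\<close> to \<open>m\<close> are the ones that constrain
  the denominator. The numerical hypothesis yields \<open>d \<le> m\<close>, so that all nonconstant
  numerator coefficients are determined by \<open>T\<close> and the denominator. The image of
  \<open>L\<close> is dense because, wherever the rank is \<open>r\<close> and the columns in
  \<open>J\<close> stay independent, these columns span all others: any denominator can then be
  moved into \<open>J\<close> without changing \<open>T\<close>. That this happens generically is
  seen on the line joining two parameters, where a nonzero polynomial in one variable has a nonroot.
  The upper bound holds because \<open>(N + 1)\<^sup>l\<close> outgrows
  \<open>(C * N + 1)\<^sup>k\<close> for every constant \<open>C\<close> once
  \<open>l > k\<close>.\<close>

section \<open>Coefficients of products and evaluation of polynomials\<close>

lemma poly_mapping_additive_induct [case_names zero add single]:
  assumes "P 0" "\<And>F G. P F \<Longrightarrow> P G \<Longrightarrow> P (F + G)" "\<And>\<gamma> c. P (Poly_Mapping.single \<gamma> c)"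
  shows "P (F :: 'a \<Rightarrow>\<^sub>0 'b::comm_monoid_add)"
proof -
  have eq: "F = (\<Sum>\<gamma>\<in>keys F. Poly_Mapping.single \<gamma> (lookup F \<gamma>))"
    by (rule poly_mapping_eqI) (simp add: lookup_sum lookup_single when_def in_keys_iff)
  have "P (\<Sum>\<gamma>\<in>A. Poly_Mapping.single \<gamma> (lookup F \<gamma>))" for A
    by (induction A rule: infinite_finite_induct) (auto intro: assms)
  then show ?thesis
    using eq by metis
qed

text \<open>In the convolution product, \<beta> contributes to the coefficient at \<alpha> only
  through \<alpha> - \<beta>, so multiplication by \<open>T\<close> acts on coefficients as the Pade
  matrix. The divisibility guard in \<open>pade_entry\<close> matters because subtraction of
  exponents is truncated.\<close>

lemma lookup_mult_pade:
  "lookup (F * T) \<alpha> = (\<Sum>\<beta>\<in>keys F. lookup F \<beta> * pade_entry T \<alpha> \<beta>)"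
proof -
  have pade: "(\<Sum>q. lookup T q when \<alpha> = \<beta> + q) = pade_entry T \<alpha> \<beta>" for \<beta>
  proof (cases "\<forall>i. lookup \<beta> i \<le> lookup \<alpha> i")
    case True
    then have "\<beta> + (\<alpha> - \<beta>) = \<alpha>"
      by (simp add: poly_mapping_eq_iff fun_eq_iff lookup_add lookup_minus)
    then have "\<alpha> = \<beta> + q \<longleftrightarrow> \<alpha> - \<beta> = q" for q
      by (auto simp: add_diff_cancel_left')
    then show ?thesis
      using True by (simp add: pade_entry_def)
  next
    case False
    then have "\<alpha> \<noteq> \<beta> + q" for q
      by (auto simp: lookup_add)
    then show ?thesis
      using False by (auto simp: pade_entry_def)
  qed
  have "lookup (F * T) \<alpha> = (\<Sum>\<beta>. lookup F \<beta> * pade_entry T \<alpha> \<beta>)"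
    by (simp add: lookup_mult pade)
  also have "\<dots> = (\<Sum>\<beta>\<in>keys F. lookup F \<beta> * pade_entry T \<alpha> \<beta>)"
    by (rule Sum_any.expand_superset) (auto simp: in_keys_iff)
  finally show ?thesis .
qed

lemma lookup_mult_pade_superset:
  assumes "finite A" "keys F \<subseteq> A"
  shows "lookup (F * T) \<alpha> = (\<Sum>\<beta>\<in>A. lookup F \<beta> * pade_entry T \<alpha> \<beta>)"
  unfolding lookup_mult_pade
  by (rule sum.mono_neutral_left) (use assms in \<open>auto simp: in_keys_iff\<close>)

lemma poly_eval_at_zero: "poly_eval (\<lambda>_. 0) F = lookup F 0"
  for F :: "('v \<Rightarrow>\<^sub>0 nat) \<Rightarrow>\<^sub>0 'a::comm_ring_1"
proof (induction F rule: poly_mapping_additive_induct)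
  case (single \<gamma> c)
  show ?case
  proof (cases "\<gamma> = 0")
    case True
    then show ?thesis by (simp add: poly_eval_single mon_eval_def)
  next
    case False
    then obtain i where "i \<in> keys \<gamma>"
      by (metis all_not_in_conv keys_eq_empty)
    then have "mon_eval (\<lambda>_. 0 :: 'a) \<gamma> = 0"
      unfolding mon_eval_def by (intro prod_zero bexI[of _ i]) (simp_all add: in_keys_iff zero_power)
    then show ?thesis using False by (simp add: poly_eval_single lookup_single)
  qed
qed (simp_all add: poly_eval_add lookup_add)

lemma poly_eval_uminus: "poly_eval x (- F) = - poly_eval x F"
  using poly_eval_add[of x F "- F"] by (simp add: minus_unique)

lemma poly_eval_diff: "poly_eval x (F - G) = poly_eval x F - poly_eval x G"
  using poly_eval_add[of x F "- G"] by (simp add: poly_eval_uminus)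

lemma poly_eval_one [simp]: "poly_eval x 1 = 1"
  using poly_eval_single[of x 0 1] by (simp add: mon_eval_def)

lemma poly_eval_power: "poly_eval x (F ^ k) = poly_eval x F ^ k"
  by (induction k) (simp_all add: poly_eval_mult)

section \<open>Order of vanishing at the origin\<close>

text \<open>Membership in the \<open>k\<close>-th power of the ideal of the origin; a difference of
  order \<open>Suc m\<close> expresses congruence of Taylor expansions through degree
  \<open>m\<close> without power series.\<close>

definition ord_ge :: "nat \<Rightarrow> (expo \<Rightarrow>\<^sub>0 complex) \<Rightarrow> bool"
  where "ord_ge k F \<longleftrightarrow> (\<forall>\<mu>. mdeg \<mu> < k \<longrightarrow> lookup F \<mu> = 0)"

lemma ord_ge_0 [simp]: "ord_ge 0 F"
  by (simp add: ord_ge_def)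

lemma ord_ge_add: "ord_ge k F \<Longrightarrow> ord_ge k G \<Longrightarrow> ord_ge k (F + G)"
  and ord_ge_diff: "ord_ge k F \<Longrightarrow> ord_ge k G \<Longrightarrow> ord_ge k (F - G)"
  and ord_ge_mono: "ord_ge k F \<Longrightarrow> l \<le> k \<Longrightarrow> ord_ge l F"
  by (simp_all add: ord_ge_def lookup_add lookup_minus)

lemma ord_ge_mult:
  assumes "ord_ge k F" "ord_ge l G"
  shows "ord_ge (k + l) (F * G)"
  unfolding ord_ge_def
proof (intro allI impI, rule ccontr)
  fix \<mu> assume \<mu>: "mdeg \<mu> < k + l" "lookup (F * G) \<mu> \<noteq> 0"
  then obtain a b where ab: "\<mu> = a + b" "a \<in> keys F" "b \<in> keys G"
    using keys_mult[of F G] by (auto simp: in_keys_iff[symmetric])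
  then have "k \<le> mdeg a" "l \<le> mdeg b"
    using assms by (auto simp: ord_ge_def in_keys_iff intro: leI)
  then show False
    using \<mu>(1) ab(1) by (simp add: mdeg_add)
qed

lemma ord_ge_mult_left: "ord_ge k G \<Longrightarrow> ord_ge k (F * G)"
  using ord_ge_mult[of 0 F k G] by simp

lemma ord_ge_power: "ord_ge 1 F \<Longrightarrow> ord_ge k (F ^ k)"
  by (induction k) (use ord_ge_mult[of 1 F] in auto)

lemma mdeg_eq_0_iff: "mdeg \<gamma> = 0 \<longleftrightarrow> \<gamma> = 0"
proof
  assume "mdeg \<gamma> = 0"
  then have "\<forall>i\<in>keys \<gamma>. lookup \<gamma> i = 0" by (simp add: mdeg_def)
  then show "\<gamma> = 0" by (intro poly_mapping_eqI) (auto simp: in_keys_iff)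
qed (simp add: mdeg_def)

lemma ord_ge_1_iff: "ord_ge (Suc 0) F \<longleftrightarrow> lookup F 0 = 0"
  by (auto simp: ord_ge_def mdeg_eq_0_iff)

text \<open>\<open>Q\<close> is a unit modulo every power of the ideal of the origin: since
  \<open>F = (1 - Q) * F + Q * F\<close> and \<open>1 - Q\<close> has order at least 1, the order of
  \<open>F\<close> rises one step at a time up to \<open>k\<close>.\<close>

lemma ord_ge_cancel:
  assumes "ord_ge k (Q * F)" "lookup Q 0 = 1"
  shows "ord_ge k F"
proof -
  define R where "R = 1 - Q"
  have "ord_ge 1 R"
    using assms(2) by (simp add: R_def ord_ge_1_iff lookup_minus)
  then have "ord_ge l F" if "l \<le> k" for l
    using that
  proof (induction l)
    case (Suc l)
    then have "ord_ge (Suc l) (R * F)"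
      using ord_ge_mult[of 1 R l F] by simp
    moreover have "ord_ge (Suc l) (Q * F)"
      using assms(1) Suc.prems ord_ge_mono by blast
    ultimately have "ord_ge (Suc l) (R * F + Q * F)"
      by (rule ord_ge_add)
    then show ?case by (simp add: R_def algebra_simps)
  qed simp
  then show ?thesis by simp
qed

section \<open>Formal partial derivatives\<close>

text \<open>The truncated subtraction of exponents is harmless: when the variable does not occur,
  the coefficient carries a factor 0.\<close>

definition pdiff :: "nat \<Rightarrow> (expo \<Rightarrow>\<^sub>0 complex) \<Rightarrow> (expo \<Rightarrow>\<^sub>0 complex)"
  where "pdiff i F = (\<Sum>\<gamma>\<in>keys F.
    Poly_Mapping.single (\<gamma> - Poly_Mapping.single i 1) (of_nat (lookup \<gamma> i) * lookup F \<gamma>))"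

lemma pdiff_superset:
  assumes "finite A" "keys F \<subseteq> A"
  shows "pdiff i F = (\<Sum>\<gamma>\<in>A.
    Poly_Mapping.single (\<gamma> - Poly_Mapping.single i 1) (of_nat (lookup \<gamma> i) * lookup F \<gamma>))"
  unfolding pdiff_def
  by (rule sum.mono_neutral_left) (use assms in \<open>auto simp: in_keys_iff\<close>)

lemma pdiff_zero [simp]: "pdiff i 0 = 0"
  by (simp add: pdiff_def)

lemma pdiff_single:
  "pdiff i (Poly_Mapping.single \<gamma> c) =
    Poly_Mapping.single (\<gamma> - Poly_Mapping.single i 1) (of_nat (lookup \<gamma> i) * c)"
  by (subst pdiff_superset[of "{\<gamma>}"]) auto

lemma pdiff_add: "pdiff i (F + G) = pdiff i F + pdiff i G"
proof -
  let ?A = "keys F \<union> keys G"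
  have *: "finite ?A" "keys F \<subseteq> ?A" "keys G \<subseteq> ?A" "keys (F + G) \<subseteq> ?A"
    by (simp_all add: Poly_Mapping.keys_add)
  show ?thesis
    unfolding pdiff_superset[OF *(1,2)] pdiff_superset[OF *(1,3)] pdiff_superset[OF *(1,4)]
    by (simp add: lookup_add distrib_left single_add sum.distrib)
qed

lemma pdiff_uminus: "pdiff i (- F) = - pdiff i F"
  using pdiff_add[of i F "- F"] by (simp add: minus_unique)

lemma pdiff_diff: "pdiff i (F - G) = pdiff i F - pdiff i G"
  using pdiff_add[of i F "- G"] by (simp add: pdiff_uminus)

lemma pdiff_mult_single:
  "pdiff i (Poly_Mapping.single a x * Poly_Mapping.single b y) =
    pdiff i (Poly_Mapping.single a x) * Poly_Mapping.single b y
      + Poly_Mapping.single a x * pdiff i (Poly_Mapping.single b y)"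
proof -
  let ?e = "Poly_Mapping.single i (1::nat)"
  have 1: "Poly_Mapping.single (a - ?e + b) (of_nat (lookup a i) * c)
      = Poly_Mapping.single (a + b - ?e) (of_nat (lookup a i) * c)" for a b :: expo and c :: complex
  proof (cases "lookup a i = 0")
    case False
    then have "a - ?e + b = a + b - ?e"
      by (auto simp: poly_mapping_eq_iff fun_eq_iff lookup_add lookup_minus lookup_single when_def)
    then show ?thesis by simp
  qed simp
  show ?thesis
    using 1[of a b "x * y"] 1[of b a "x * y"]
    by (simp add: pdiff_single mult_single lookup_add algebra_simps flip: single_add)
qed

lemma pdiff_mult: "pdiff i (F * G) = pdiff i F * G + F * pdiff i G"
proof (induction F rule: poly_mapping_additive_induct)
  case (single a x)
  show ?case
  proof (induction G rule: poly_mapping_additive_induct)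
    case (single b y)
    show ?case by (rule pdiff_mult_single)
  qed (simp_all add: pdiff_add distrib_left)
qed (simp_all add: pdiff_add distrib_right)

lemma pdiff_power: "pdiff i (F ^ k) = of_nat k * F ^ (k - 1) * pdiff i F"
proof (induction k)
  case 0
  show ?case using pdiff_single[of i 0 1] by simp
next
  case (Suc k)
  then show ?case
    by (cases k) (simp_all add: pdiff_mult algebra_simps)
qed

lemma lookup_pdiff:
  "lookup (pdiff i F) \<gamma> = of_nat (Suc (lookup \<gamma> i)) * lookup F (\<gamma> + Poly_Mapping.single i 1)"
proof (induction F rule: poly_mapping_additive_induct)
  case (single a c)
  let ?e = "Poly_Mapping.single i (1::nat)"
  show ?case
  proof (cases "lookup a i = 0")
    case True
    then have "a \<noteq> \<gamma> + ?e" by (auto simp: lookup_add)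
    then show ?thesis using True by (simp add: pdiff_single lookup_single)
  next
    case False
    have "a - ?e = \<gamma> \<longleftrightarrow> a = \<gamma> + ?e"
      using False by (force simp: poly_mapping_eq_iff fun_eq_iff lookup_add lookup_minus lookup_single when_def)
    moreover have "lookup a i = Suc (lookup \<gamma> i)" if "a = \<gamma> + ?e"
      using that by (simp add: lookup_add)
    ultimately show ?thesis
      by (simp add: pdiff_single lookup_single when_def)
  qed
qed (simp_all add: pdiff_add lookup_add algebra_simps)

lemma lookup_pdiff_funpow:
  "lookup ((pdiff i ^^ k) F) \<gamma> =
    fact (lookup \<gamma> i + k) / fact (lookup \<gamma> i) * lookup F (\<gamma> + Poly_Mapping.single i k)"
proof (induction k arbitrary: \<gamma>)
  case (Suc k)
  have "\<gamma> + Poly_Mapping.single i 1 + Poly_Mapping.single i k = \<gamma> + Poly_Mapping.single i (Suc k)"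
    by (simp add: add.assoc flip: single_add)
  moreover have "of_nat (Suc a) * (y / fact (Suc a) * z) = y / fact a * z" for a and y z :: complex
    by (simp del: of_nat_Suc)
  ultimately show ?case
    by (simp add: lookup_pdiff Suc lookup_add del: of_nat_Suc fact_Suc)
qed simp

lemma ord_ge_pdiff: "ord_ge (Suc k) F \<Longrightarrow> ord_ge k (pdiff i F)"
proof -
  have "mdeg (\<mu> + Poly_Mapping.single i 1) = Suc (mdeg \<mu>)" for \<mu> :: expo
    unfolding mdeg_add by (simp add: mdeg_def)
  then show "ord_ge (Suc k) F \<Longrightarrow> ord_ge k (pdiff i F)"
    by (simp add: ord_ge_def lookup_pdiff)
qed

lemma DERIV_poly_eval:
  "((\<lambda>t. poly_eval (x(i := t)) F) has_field_derivative poly_eval x (pdiff i F)) (at (x i))"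
proof (induction F rule: poly_mapping_additive_induct)
  case zero
  then show ?case by simp
next
  case (add F G)
  then show ?case
    unfolding poly_eval_add pdiff_add by (rule DERIV_add)
next
  case (single \<gamma> c)
  let ?e = "Poly_Mapping.single i (1::nat)"
  define A where "A = insert i (keys \<gamma>)"
  define C where "C = (\<Prod>j\<in>A - {i}. x j ^ lookup \<gamma> j)"
  have A: "finite A" "i \<in> A" by (auto simp: A_def)
  have ev: "mon_eval (x(i := t)) \<gamma> = t ^ lookup \<gamma> i * C" for t
  proof -
    have "mon_eval (x(i := t)) \<gamma> = (\<Prod>j\<in>A. (x(i := t)) j ^ lookup \<gamma> j)"
      by (rule mon_eval_superset) (auto simp: A_def)
    also have "\<dots> = t ^ lookup \<gamma> i * C"
      unfolding C_def prod.remove[OF A] by (auto intro!: prod.cong)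
    finally show ?thesis .
  qed
  have "mon_eval x (\<gamma> - ?e) = (\<Prod>j\<in>A. x j ^ lookup (\<gamma> - ?e) j)"
    by (rule mon_eval_superset) (auto simp: A_def in_keys_iff lookup_minus)
  also have "\<dots> = x i ^ (lookup \<gamma> i - 1) * C"
    unfolding C_def prod.remove[OF A]
    by (auto intro!: prod.cong simp: lookup_minus lookup_single when_def)
  finally have e: "mon_eval x (\<gamma> - ?e) = x i ^ (lookup \<gamma> i - 1) * C" .
  show ?case
    unfolding poly_eval_single pdiff_single ev e
    by (auto intro!: derivative_eq_intros)
qed

section \<open>Taylor polynomials of rational functions\<close>

text \<open>The invariant carried through differentiation: \<open>T\<close> is the jet of
  \<open>A / Q ^ j\<close>, with the denominator cleared. The exponent \<open>j\<close> is
  existential because each derivative raises it, and zeros of \<open>Q\<close> are excluded because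
  the derivative is uncontrolled there.\<close>

definition has_jet :: "(expo \<Rightarrow>\<^sub>0 complex) \<Rightarrow> nat \<Rightarrow> ((nat \<Rightarrow> complex) \<Rightarrow> complex) \<Rightarrow> (expo \<Rightarrow>\<^sub>0 complex) \<Rightarrow> bool"
  where "has_jet Q k f T \<longleftrightarrow> (\<exists>A j. (\<forall>x. poly_eval x Q \<noteq> 0 \<longrightarrow> f x = poly_eval x A / poly_eval x Q ^ j)
    \<and> ord_ge k (A - Q ^ j * T))"

lemma has_jet_mono: "has_jet Q k f T \<Longrightarrow> l \<le> k \<Longrightarrow> has_jet Q l f T"
  unfolding has_jet_def using ord_ge_mono by blast

lemma has_jet_partial_deriv:
  assumes "has_jet Q (Suc k) f T"
  shows "has_jet Q k (partial_deriv i f) (pdiff i T)"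
proof -
  obtain A j where f: "\<And>x. poly_eval x Q \<noteq> 0 \<Longrightarrow> f x = poly_eval x A / poly_eval x Q ^ j"
    and ord: "ord_ge (Suc k) (A - Q ^ j * T)"
    using assms by (auto simp: has_jet_def)
  define B where "B = pdiff i A * Q - of_nat j * A * pdiff i Q"
  have "partial_deriv i f x = poly_eval x B / poly_eval x Q ^ (j + 1)" if x: "poly_eval x Q \<noteq> 0" for x
  proof -
    let ?a = "poly_eval x A" and ?a' = "poly_eval x (pdiff i A)"
    let ?q = "poly_eval x Q" and ?q' = "poly_eval x (pdiff i Q)"
    \<comment> \<open>The fraction represents \<open>f\<close> only off the zeros of
      \<open>Q\<close>; continuity makes this a whole neighbourhood of \<open>x i\<close>, which
      differentiation needs.\<close>
    have contQ: "((\<lambda>t. poly_eval (x(i := t)) Q) \<longlongrightarrow> ?q) (nhds (x i))"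
      using DERIV_isCont[OF DERIV_poly_eval[of x i Q]]
        tendsto_at_iff_tendsto_nhds[of "\<lambda>t. poly_eval (x(i := t)) Q" "x i"]
      by (simp add: isCont_def)
    have "\<forall>\<^sub>F t in nhds (x i). poly_eval (x(i := t)) Q \<noteq> 0"
    proof -
      have "\<forall>\<^sub>F t in nhds (x i). poly_eval (x(i := t)) Q \<in> - {0}"
        by (rule topological_tendstoD[of _ "?q"])
          (use contQ x in \<open>simp_all add: open_Compl\<close>)
      then show ?thesis by simp
    qed
    then have ev: "\<forall>\<^sub>F t in nhds (x i). f (x(i := t)) =
        poly_eval (x(i := t)) A / poly_eval (x(i := t)) Q ^ j"
      by eventually_elim (rule f)
    have der: "((\<lambda>t. poly_eval (x(i := t)) A / poly_eval (x(i := t)) Q ^ j) has_field_derivative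
        (?a' * ?q ^ j - ?a * (of_nat j * ?q ^ (j - 1) * ?q')) / (?q ^ j * ?q ^ j)) (at (x i))"
      using DERIV_divide[OF DERIV_poly_eval[of x i A] DERIV_power[OF DERIV_poly_eval[of x i Q], of j]] x
      by (simp add: mult.assoc mult.commute[of ?q'])
    have "partial_deriv i f x = (?a' * ?q ^ j - ?a * (of_nat j * ?q ^ (j - 1) * ?q')) / (?q ^ j * ?q ^ j)"
      unfolding partial_deriv_def using deriv_cong_ev[OF ev refl] DERIV_imp_deriv[OF der] by simp
    also have "\<dots> = (?a' * ?q - of_nat j * ?a * ?q') / ?q ^ (j + 1)"
    proof (cases j)
      case (Suc l)
      then show ?thesis using x by (simp add: divide_simps) (simp add: algebra_simps)
    qed (use x in simp)
    also have "of_nat j = poly_eval x (of_nat j)"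
      using poly_eval_single[of x 0 "of_nat j :: complex"] by (simp add: mon_eval_def)
    finally show ?thesis by (simp add: B_def poly_eval_diff poly_eval_mult)
  qed
  moreover have "ord_ge k (B - Q ^ (j + 1) * pdiff i T)"
  proof -
    have "Q * pdiff i (Q ^ j) = of_nat j * Q ^ j * pdiff i Q"
      unfolding pdiff_power by (cases j) (simp_all add: algebra_simps)
    then have "Q * (pdiff i (Q ^ j) * T) = of_nat j * Q ^ j * pdiff i Q * T"
      by (metis mult.assoc)
    \<comment> \<open>The error of the new jet is built from the old error
      \<open>A - Q ^ j * T\<close> and its derivative. Only the derivative loses an order, from
      \<open>Suc k\<close> to \<open>k\<close>.\<close>
    then have "B - Q ^ (j + 1) * pdiff i T =
        Q * pdiff i (A - Q ^ j * T) - of_nat j * pdiff i Q * (A - Q ^ j * T)"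
      by (simp add: B_def pdiff_diff pdiff_mult algebra_simps)
    moreover have "ord_ge k (A - Q ^ j * T)"
      using ord by (rule ord_ge_mono) simp
    ultimately show ?thesis
      using ord_ge_pdiff[OF ord] by (auto intro!: ord_ge_diff ord_ge_mult_left)
  qed
  ultimately show ?thesis
    unfolding has_jet_def by blast
qed

lemma has_jet_partial_deriv_funpow:
  "has_jet Q (l + k) f T \<Longrightarrow> has_jet Q k ((partial_deriv i ^^ l) f) ((pdiff i ^^ l) T)"
proof (induction l arbitrary: k)
  case (Suc l)
  from Suc.prems have "has_jet Q (l + Suc k) f T" by simp
  then show ?case
    using Suc.IH has_jet_partial_deriv by fastforce
qed simp

lemma has_jet_fold:
  "has_jet Q (sum_list (map g xs) + k) f T \<Longrightarrow>
    has_jet Q k (fold (\<lambda>i. partial_deriv i ^^ g i) xs f) (fold (\<lambda>i. pdiff i ^^ g i) xs T)"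
proof (induction xs arbitrary: f T)
  case (Cons i xs)
  then show ?case
    using has_jet_partial_deriv_funpow[of Q "g i" "sum_list (map g xs) + k" f T i]
    by (simp add: add.assoc)
qed simp

lemma lookup_fold_pdiff:
  "distinct xs \<Longrightarrow> lookup (fold (\<lambda>i. pdiff i ^^ g i) xs T) 0 =
    (\<Prod>i\<in>set xs. fact (g i)) * lookup T (\<Sum>i\<in>set xs. Poly_Mapping.single i (g i))"
proof (induction xs arbitrary: T)
  case (Cons i xs)
  have "lookup (\<Sum>j\<in>set xs. Poly_Mapping.single j (g j)) i = 0"
    using Cons.prems by (auto simp: lookup_sum lookup_single when_def)
  then show ?case
    using Cons by (simp add: lookup_pdiff_funpow add.commute)
qed simp

lemma has_jet_at_0:
  assumes "has_jet Q 1 f T" "lookup Q 0 = 1"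
  shows "f (\<lambda>_. 0) = lookup T 0"
proof -
  have Q: "poly_eval (\<lambda>_. 0) Q = 1"
    using assms(2) by (simp add: poly_eval_at_zero)
  obtain A j where A: "f (\<lambda>_. 0) = poly_eval (\<lambda>_. 0) A" "ord_ge 1 (A - Q ^ j * T)"
    using assms(1) Q unfolding has_jet_def by (metis div_by_1 one_neq_zero power_one)
  have "0 = poly_eval (\<lambda>_. 0) (A - Q ^ j * T)"
    using A(2) by (simp only: One_nat_def ord_ge_1_iff poly_eval_at_zero)
  then show ?thesis
    using A(1) Q by (simp add: poly_eval_diff poly_eval_mult poly_eval_power poly_eval_at_zero[of T])
qed

lemma lookup_taylor_poly:
  "lookup (taylor_poly n m f) \<gamma> = (if \<gamma> \<in> monoms n 0 m then
    partial_derivs \<gamma> f (\<lambda>_. 0) / (\<Prod>i\<in>keys \<gamma>. fact (lookup \<gamma> i)) else 0)"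
  by (simp add: taylor_poly_def lookup_sum lookup_single when_def)

lemma mem_polys_iff: "P \<in> polys n d \<longleftrightarrow> (\<forall>\<gamma>. \<gamma> \<notin> monoms n 0 d \<longrightarrow> lookup P \<gamma> = 0)"
  by (auto simp: polys_def in_keys_iff)

text \<open>Taking \<open>mdeg \<gamma>\<close> derivatives, at most \<open>m\<close> in number,
  costs that many of the \<open>Suc m\<close> orders, so one order is left, which is what evaluation
  at the origin needs. The congruence therefore determines every coefficient of the Taylor
  polynomial.\<close>

lemma taylor_poly_quotient:
  assumes T: "T \<in> polys n m" "ord_ge (Suc m) (P - Q * T)" and Q: "lookup Q 0 = 1"
  shows "taylor_poly n m (\<lambda>x. poly_eval x P / poly_eval x Q) = T"
proof (rule poly_mapping_eqI)
  fix \<gamma>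
  let ?f = "\<lambda>x. poly_eval x P / poly_eval x Q"
  have "partial_derivs \<gamma> ?f (\<lambda>_. 0) = (\<Prod>i\<in>keys \<gamma>. fact (lookup \<gamma> i)) * lookup T \<gamma>"
    if \<gamma>: "\<gamma> \<in> monoms n 0 m"
  proof -
    let ?xs = "sorted_list_of_set (keys \<gamma>)"
    have "has_jet Q (Suc m) ?f T"
      unfolding has_jet_def using T(2) by (intro exI[of _ P] exI[of _ 1]) auto
    moreover have "mdeg \<gamma> \<le> m"
      using \<gamma> by (simp add: monoms_def)
    ultimately have "has_jet Q (mdeg \<gamma> + 1) ?f T"
      using has_jet_mono by simp
    moreover have "mdeg \<gamma> = sum_list (map (lookup \<gamma>) ?xs)"
      by (simp add: mdeg_def sum_list_distinct_conv_sum_set)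
    ultimately have "has_jet Q 1 (partial_derivs \<gamma> ?f) (fold (\<lambda>i. pdiff i ^^ lookup \<gamma> i) ?xs T)"
      unfolding partial_derivs_def using has_jet_fold[of Q "lookup \<gamma>" ?xs 1 ?f T] by simp
    then have "partial_derivs \<gamma> ?f (\<lambda>_. 0) = lookup (fold (\<lambda>i. pdiff i ^^ lookup \<gamma> i) ?xs T) 0"
      using Q by (rule has_jet_at_0)
    also have "\<dots> = (\<Prod>i\<in>keys \<gamma>. fact (lookup \<gamma> i)) * lookup T \<gamma>"
      by (simp add: lookup_fold_pdiff poly_mapping_eq_sum_single[of \<gamma>, symmetric])
    finally show ?thesis .
  qed
  then show "lookup (taylor_poly n m ?f) \<gamma> = lookup T \<gamma>"
    using T(1) by (auto simp: lookup_taylor_poly mem_polys_iff)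
qed

section \<open>Linear algebra\<close>

text \<open>Gaussian elimination by induction on the equations: either equation \<mu>0 is void, or
  it is solved for a pivot unknown \<open>b0\<close>, which is then eliminated from the
  others.\<close>

lemma homogeneous_system_nontrivial:
  fixes A :: "'b \<Rightarrow> 'm \<Rightarrow> 'a::field"
  assumes "finite M" "finite B" "card M < card B"
  shows "\<exists>c. (\<exists>b\<in>B. c b \<noteq> 0) \<and> (\<forall>\<mu>\<in>M. (\<Sum>b\<in>B. c b * A b \<mu>) = 0)"
  using assms
proof (induction M arbitrary: B A rule: finite_induct)
  case empty
  then have "B \<noteq> {}" by auto
  then show ?case by (intro exI[of _ "\<lambda>_. 1"]) auto
next
  case (insert \<mu>0 M)
  have card: "card M < card B"
    using insert by simp
  show ?case
  proof (cases "\<forall>b\<in>B. A b \<mu>0 = 0")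
    case True
    then show ?thesis
      using insert.IH[OF insert.prems(1) card, of A] by auto
  next
    case False
    then obtain b0 where b0: "b0 \<in> B" "A b0 \<mu>0 \<noteq> 0" by blast
    let ?B = "B - {b0}"
    have "card M < card ?B" "finite ?B"
      using b0 insert by auto
    then obtain c where c: "\<exists>b\<in>?B. c b \<noteq> 0"
      "\<forall>\<mu>\<in>M. (\<Sum>b\<in>?B. c b * (A b \<mu> - A b \<mu>0 / A b0 \<mu>0 * A b0 \<mu>)) = 0"
      using insert.IH[of ?B "\<lambda>b \<mu>. A b \<mu> - A b \<mu>0 / A b0 \<mu>0 * A b0 \<mu>"] by blast
    define c' where "c' = c(b0 := - (\<Sum>b\<in>?B. c b * (A b \<mu>0 / A b0 \<mu>0)))"
    have "(\<Sum>b\<in>B. c' b * A b \<mu>) = (\<Sum>b\<in>?B. c b * (A b \<mu> - A b \<mu>0 / A b0 \<mu>0 * A b0 \<mu>))" for \<mu>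
    proof -
      have "(\<Sum>b\<in>B. c' b * A b \<mu>) = c' b0 * A b0 \<mu> + (\<Sum>b\<in>?B. c' b * A b \<mu>)"
        using insert.prems(1) b0(1) by (rule sum.remove)
      also have "(\<Sum>b\<in>?B. c' b * A b \<mu>) = (\<Sum>b\<in>?B. c b * A b \<mu>)"
        by (rule sum.cong) (auto simp: c'_def)
      finally show ?thesis
        by (simp add: c'_def right_diff_distrib sum_subtractf sum_distrib_right mult.assoc)
    qed
    moreover have "(\<Sum>b\<in>?B. c b * (A b \<mu>0 - A b \<mu>0 / A b0 \<mu>0 * A b0 \<mu>0)) = 0"
      using b0 by simp
    ultimately have "\<forall>\<mu>\<in>insert \<mu>0 M. (\<Sum>b\<in>B. c' b * A b \<mu>) = 0"
      using c(2) by simp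
    moreover have "\<exists>b\<in>B. c' b \<noteq> 0"
      using c(1) by (auto simp: c'_def)
    ultimately show ?thesis by blast
  qed
qed

section \<open>Independent columns and matrix rank\<close>

text \<open>Columns form an indexed family, so equal columns at different indices count as
  dependent, unlike in a set of vectors.\<close>

definition indep_columns :: "'i set \<Rightarrow> 'j set \<Rightarrow> ('i \<Rightarrow> 'j \<Rightarrow> 'a::comm_ring_1) \<Rightarrow> bool"
  where "indep_columns I J a \<longleftrightarrow>
    (\<forall>c. (\<forall>i\<in>I. (\<Sum>j\<in>J. c j * a i j) = 0) \<longrightarrow> (\<forall>j\<in>J. c j = 0))"

lemma indep_columnsD:
  "indep_columns I J a \<Longrightarrow> (\<And>i. i \<in> I \<Longrightarrow> (\<Sum>j\<in>J. c j * a i j) = 0) \<Longrightarrow> j \<in> J \<Longrightarrow> c j = 0"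
  by (auto simp: indep_columns_def)

lemma indep_columns_insertD:
  assumes "indep_columns I (insert j0 J) a" "finite J" "j0 \<notin> J"
  shows "indep_columns I J a"
  unfolding indep_columns_def
proof (intro allI impI)
  fix c assume c: "\<forall>i\<in>I. (\<Sum>j\<in>J. c j * a i j) = 0"
  have "(\<Sum>j\<in>insert j0 J. (c(j0 := 0)) j * a i j) = (\<Sum>j\<in>J. c j * a i j)" for i
    using assms(2,3) by (auto intro!: sum.cong)
  then have *: "\<forall>j\<in>J. (c(j0 := 0)) j = 0"
    using indep_columnsD[OF assms(1), of "c(j0 := 0)"] c by simp
  show "\<forall>j\<in>J. c j = 0"
  proof
    fix j assume "j \<in> J"
    then show "c j = 0" using bspec[OF *, of j] assms(3) by (auto split: if_splits)
  qed
qed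

text \<open>Both halves translate between independent sets of vectors and independent families: a
  maximal independent set of columns is lifted to indices by \<open>g\<close>, and an independent
  family has pairwise distinct columns, so passing to the set of vectors keeps the
  cardinality.\<close>

lemma
  fixes a :: "'i \<Rightarrow> 'j \<Rightarrow> complex" and rs :: "'i list" and cs :: "'j list"
  defines "A \<equiv> mat (length rs) (length cs) (\<lambda>(i, j). a (rs ! i) (cs ! j))"
  shows mat_rank_indep_columns: "\<exists>J\<subseteq>set cs. card J = mat_rank A \<and> indep_columns (set rs) J a"
    and mat_rank_ge_indep_columns:
      "\<And>J. J \<subseteq> set cs \<Longrightarrow> indep_columns (set rs) J a \<Longrightarrow> card J \<le> mat_rank A"
proof -
  define nr where "nr = length rs"
  interpret vec_space "TYPE(complex)" nr .
  have A: "A \<in> carrier_mat nr (length cs)" and rank: "mat_rank A = rank A"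
    by (auto simp: A_def nr_def mat_rank_def)
  define col where "col j = vec nr (\<lambda>i. a (rs ! i) j)" for j
  have cols: "set (cols A) = col ` set cs"
  proof -
    have "cols A = map col cs"
      by (rule nth_equalityI) (auto simp: A_def col_def nr_def intro!: eq_vecI)
    then show ?thesis by simp
  qed
  have col_index: "col j $ i = a (rs ! i) j" if "i < nr" for i j
    using that by (simp add: col_def)
  have carrier: "col ` X \<subseteq> carrier_vec nr" for X
    by (auto simp: col_def)
  have rows: "(\<forall>i\<in>set rs. P i) \<longleftrightarrow> (\<forall>i<nr. P (rs ! i))" for P
    by (auto simp: nr_def all_set_conv_all_nth)
  show "\<exists>J\<subseteq>set cs. card J = mat_rank A \<and> indep_columns (set rs) J a"
  proof -
    obtain S where S: "maximal S (\<lambda>T. T \<subseteq> set (cols A) \<and> lin_indpt T)"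
      using maximal_exists_superset[of "set (cols A)" "\<lambda>T. T \<subseteq> set (cols A) \<and> lin_indpt T" "{}"]
        finite_lin_indpt2 by (auto simp: lin_dep_def)
    have S': "S \<subseteq> col ` set cs" "lin_indpt S"
      using S unfolding maximal_def cols by auto
    then have finS: "finite S" using finite_surj by blast
    define g where "g = inv_into (set cs) col"
    have g: "g v \<in> set cs" "col (g v) = v" if "v \<in> S" for v
      using that S'(1) unfolding g_def by (auto intro: inv_into_into f_inv_into_f)
    have inj: "inj_on g S"
      using g(2) by (rule inj_on_inverseI)
    have "indep_columns (set rs) (g ` S) a"
      unfolding indep_columns_def
    proof (intro allI impI ballI, rule ccontr)
      fix c j assume c: "\<forall>i\<in>set rs. (\<Sum>j\<in>g ` S. c j * a i j) = 0" and j: "j \<in> g ` S" "c j \<noteq> 0"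
      have S_car: "S \<subseteq> carrier_vec nr" using S'(1) carrier by blast
      have "lincomb (c \<circ> g) S = 0\<^sub>v nr"
      proof (rule eq_vecI)
        fix i assume "i < dim_vec (0\<^sub>v nr :: complex vec)"
        then have i: "i < nr" by simp
        have "lincomb (c \<circ> g) S $ i = (\<Sum>v\<in>S. c (g v) * v $ i)"
          using lincomb_index[OF i S_car] by simp
        also have "\<dots> = (\<Sum>v\<in>S. c (g v) * a (rs ! i) (g v))"
        proof (rule sum.cong)
          fix v assume "v \<in> S"
          then show "c (g v) * v $ i = c (g v) * a (rs ! i) (g v)"
            using col_index[OF i, of "g v"] g(2) by simp
        qed simp
        also have "\<dots> = (\<Sum>j\<in>g ` S. c j * a (rs ! i) j)"
          using inj by (simp add: sum.reindex)
        finally show "lincomb (c \<circ> g) S $ i = 0\<^sub>v nr $ i"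
          using c i unfolding rows by simp
      qed (use lincomb_dim[OF finS S_car] in simp)
      moreover obtain v where "v \<in> S" "(c \<circ> g) v \<noteq> 0" using j by auto
      ultimately have "lin_dep S"
        by (intro lin_dep_crit[OF finS order_refl, where a = "c \<circ> g" and v = v]) auto
      then show False using S'(2) by contradiction
    qed
    moreover have "card (g ` S) = mat_rank A"
      using card_image[OF inj] rank_card_indpt[OF A S] rank by simp
    moreover have "g ` S \<subseteq> set cs" using g(1) by blast
    ultimately show ?thesis by blast
  qed
  fix J assume J: "J \<subseteq> set cs" "indep_columns (set rs) J a"
  have fin: "finite J" using J(1) finite_subset by blast
  have inj: "inj_on col J"
  proof (rule inj_onI, rule ccontr)
    fix j k assume jk: "j \<in> J" "k \<in> J" "col j = col k" "j \<noteq> k"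
    define c where "c = (\<lambda>l. (if l = j then 1 else 0) - (if l = k then 1 else 0) :: complex)"
    have "(\<Sum>l\<in>J. c l * a (rs ! i) l) = a (rs ! i) j - a (rs ! i) k" for i
      using jk fin by (simp add: c_def left_diff_distrib sum_subtractf if_distrib[of "\<lambda>x. x * _"] sum.delta' cong: if_cong)
    moreover have "a (rs ! i) j = a (rs ! i) k" if "i < nr" for i
      using col_index[OF that, of j] col_index[OF that, of k] jk(3) by simp
    ultimately have "\<forall>i\<in>set rs. (\<Sum>l\<in>J. c l * a i l) = 0"
      unfolding rows by simp
    then have "c j = 0"
      using indep_columnsD[OF J(2)] jk(1) by blast
    then show False using jk(4) by (simp add: c_def)
  qed
  have "lin_indpt (col ` J)"
  proof
    assume "lin_dep (col ` J)"
    then obtain c w where c: "lincomb c (col ` J) = 0\<^sub>v nr" "w \<in> col ` J" "c w \<noteq> 0"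
      using finite_lin_dep[of "col ` J"] fin carrier by auto
    have "(\<Sum>j\<in>J. c (col j) * a (rs ! i) j) = 0" if i: "i < nr" for i
    proof -
      have "(\<Sum>j\<in>J. c (col j) * a (rs ! i) j) = (\<Sum>v\<in>col ` J. c v * v $ i)"
        using inj col_index[OF i] by (simp add: sum.reindex)
      also have "\<dots> = lincomb c (col ` J) $ i"
        using lincomb_index[OF i carrier] by simp
      finally show ?thesis using c(1) i by simp
    qed
    then have "\<forall>i\<in>set rs. (\<Sum>j\<in>J. c (col j) * a i j) = 0"
      unfolding rows by simp
    then show False
      using indep_columnsD[OF J(2), of "c \<circ> col"] c(2,3) by auto
  qed
  moreover have "col ` J \<subseteq> set (cols A)"
    unfolding cols using J(1) by (rule image_mono)
  ultimately have "card (col ` J) \<le> rank A"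
    by (intro rank_ge_card_indpt[OF A])
  then show "card J \<le> mat_rank A"
    using rank card_image[OF inj] by simp
qed

text \<open>An independent family whose size is the rank becomes dependent when \<open>k\<close> is
  added, and in the resulting relation \<open>k\<close> has a nonzero coefficient because the
  columns in \<open>J\<close> alone admit no nontrivial relation.\<close>

lemma mat_rank_column_span:
  fixes a :: "'i \<Rightarrow> 'j \<Rightarrow> complex"
  assumes J: "J \<subseteq> set cs" "indep_columns (set rs) J a"
    and card: "card J = mat_rank (mat (length rs) (length cs) (\<lambda>(i, j). a (rs ! i) (cs ! j)))"
    and k: "k \<in> set cs"
  shows "\<exists>q. \<forall>i\<in>set rs. a i k = (\<Sum>j\<in>J. q j * a i j)"
proof (cases "k \<in> J")
  case True
  have "finite J" using J(1) finite_subset by blast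
  then have *: "(\<Sum>j\<in>J. (if j = k then 1 else 0) * a i j) = a i k" for i
    using True by (simp add: if_distrib[of "\<lambda>x. x * _"] sum.delta' cong: if_cong)
  show ?thesis
    by (rule exI[of _ "\<lambda>j. if j = k then 1 else 0"]) (simp add: *)
next
  case False
  have fin: "finite J" using J(1) finite_subset by blast
  have "\<not> indep_columns (set rs) (insert k J) a"
  proof
    assume "indep_columns (set rs) (insert k J) a"
    then have "card (insert k J) \<le> card J"
      unfolding card using J(1) k by (intro mat_rank_ge_indep_columns) simp_all
    then show False using False fin by simp
  qed
  then obtain c where c: "\<forall>i\<in>set rs. (\<Sum>j\<in>insert k J. c j * a i j) = 0" "\<not> (\<forall>j\<in>insert k J. c j = 0)"
    unfolding indep_columns_def not_all not_imp by (elim exE conjE)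
  have sum: "c k * a i k + (\<Sum>j\<in>J. c j * a i j) = 0" if "i \<in> set rs" for i
    using c(1) that fin False by simp
  have ck: "c k \<noteq> 0"
  proof
    assume ck: "c k = 0"
    then have "c j = 0" if "j \<in> J" for j
      using indep_columnsD[OF J(2), of c j] sum that by simp
    then show False using c(2) ck by simp
  qed
  define q where "q j = - c j / c k" for j
  have "a i k = (\<Sum>j\<in>J. q j * a i j)" if "i \<in> set rs" for i
  proof -
    have "c k * (\<Sum>j\<in>J. q j * a i j) = - (\<Sum>j\<in>J. c j * a i j)"
      using ck by (simp add: q_def sum_distrib_left sum_negf)
    also have "\<dots> = c k * a i k"
      using sum[OF that] by (intro minus_unique) (simp add: add.commute)
    finally show ?thesis using ck by simp
  qed
  then have "\<forall>i\<in>set rs. a i k = (\<Sum>j\<in>J. q j * a i j)" by (rule ballI)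
  then show ?thesis by (rule exI[of "\<lambda>q. \<forall>i\<in>set rs. a i k = (\<Sum>j\<in>J. q j * a i j)"])
qed

section \<open>Forms\<close>

text \<open>The degree is kept explicit because sums stay homogeneous only within one degree; the
  zero polynomial belongs to every degree, so empty sums and default values cause no
  exception.\<close>

definition hforms :: "nat \<Rightarrow> nat \<Rightarrow> nat \<Rightarrow> ((expo \<Rightarrow>\<^sub>0 nat) \<Rightarrow>\<^sub>0 complex) set"
  where "hforms n m k = {F. \<forall>\<mu>\<in>keys F. keys \<mu> \<subseteq> monoms n 0 m \<and> mdeg \<mu> = k}"

lemma forms_eq_hforms: "forms n m = (\<Union>k. hforms n m k)"
  by (auto simp: forms_def hforms_def)

lemma hforms_0 [simp]: "0 \<in> hforms n m k"
  by (simp add: hforms_def)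

lemma hforms_add: "F \<in> hforms n m k \<Longrightarrow> G \<in> hforms n m k \<Longrightarrow> F + G \<in> hforms n m k"
  using Poly_Mapping.keys_add[of F G] unfolding hforms_def by blast

lemma hforms_uminus: "F \<in> hforms n m k \<Longrightarrow> - F \<in> hforms n m k"
  by (simp add: hforms_def in_keys_iff)

lemma hforms_diff: "F \<in> hforms n m k \<Longrightarrow> G \<in> hforms n m k \<Longrightarrow> F - G \<in> hforms n m k"
  using hforms_add[of F n m k "- G"] hforms_uminus by simp

lemma hforms_sum: "(\<And>i. i \<in> I \<Longrightarrow> F i \<in> hforms n m k) \<Longrightarrow> (\<Sum>i\<in>I. F i) \<in> hforms n m k"
  by (induction I rule: infinite_finite_induct) (auto intro: hforms_add)

lemma hforms_mult:
  assumes "F \<in> hforms n m k" "G \<in> hforms n m l"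
  shows "F * G \<in> hforms n m (k + l)"
  unfolding hforms_def
proof (intro CollectI ballI)
  fix \<mu> assume "\<mu> \<in> keys (F * G)"
  then obtain a b where ab: "\<mu> = a + b" "a \<in> keys F" "b \<in> keys G"
    using keys_mult[of F G] by blast
  then show "keys \<mu> \<subseteq> monoms n 0 m \<and> mdeg \<mu> = k + l"
    using assms Poly_Mapping.keys_add[of a b] unfolding hforms_def
    by (simp add: mdeg_add) (meson Un_least subset_trans)
qed

lemma hforms_const: "Poly_Mapping.single 0 c \<in> hforms n m 0"
  by (simp add: hforms_def mdeg_def)

lemma hforms_1: "1 \<in> hforms n m 0"
  using hforms_const[of 1] by simp

lemma hforms_power: "F \<in> hforms n m k \<Longrightarrow> F ^ l \<in> hforms n m (k * l)"
  by (induction l) (auto intro: hforms_1 dest: hforms_mult)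

lemma hforms_prod:
  "(\<And>i. i \<in> I \<Longrightarrow> F i \<in> hforms n m (k i)) \<Longrightarrow> (\<Prod>i\<in>I. F i) \<in> hforms n m (\<Sum>i\<in>I. k i)"
  by (induction I rule: infinite_finite_induct) (auto intro: hforms_1 hforms_mult)

definition form_var :: "expo \<Rightarrow> (expo \<Rightarrow>\<^sub>0 nat) \<Rightarrow>\<^sub>0 complex"
  where "form_var \<gamma> = Poly_Mapping.single (Poly_Mapping.single \<gamma> 1) 1"

lemma hforms_var: "\<gamma> \<in> monoms n 0 m \<Longrightarrow> form_var \<gamma> \<in> hforms n m 1"
  by (simp add: hforms_def form_var_def mdeg_def)

lemma poly_eval_var [simp]: "poly_eval x (form_var \<gamma>) = x \<gamma>"
  by (simp add: form_var_def poly_eval_single mon_eval_def)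

lemma poly_eval_const [simp]: "poly_eval x (Poly_Mapping.single 0 c) = c"
  by (simp add: poly_eval_single mon_eval_def)

text \<open>
  Fraction-free elimination, one column at a time; \<open>X\<close> only serves to give \<open>\<delta>\<close> a positive degree
  when there are no columns.
\<close>

lemma dual_forms:
  fixes a :: "'i \<Rightarrow> 'j \<Rightarrow> (expo \<Rightarrow>\<^sub>0 nat) \<Rightarrow>\<^sub>0 complex"
  assumes "finite J" and I: "finite I"
    and "\<And>i j. i \<in> I \<Longrightarrow> j \<in> J \<Longrightarrow> a i j \<in> hforms n m 1"
    and X: "X \<in> hforms n m 1" "poly_eval x X \<noteq> 0"
    and "indep_columns I J (\<lambda>i j. poly_eval x (a i j))"
  shows "\<exists>k \<delta> w. \<delta> \<in> hforms n m (Suc k) \<and> poly_eval x \<delta> \<noteq> 0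
    \<and> (\<forall>j\<in>J. \<forall>i\<in>I. w j i \<in> hforms n m k)
    \<and> (\<forall>j\<in>J. \<forall>j'\<in>J. (\<Sum>i\<in>I. w j i * a i j') = (if j = j' then \<delta> else 0))"
  using assms(1,3,6)
proof (induction J rule: finite_induct)
  case empty
  then show ?case
    using X by (intro exI[of _ 0] exI[of _ X]) simp
next
  case (insert j0 J)
  have "indep_columns I J (\<lambda>i j. poly_eval x (a i j))"
    using insert.prems(2) insert.hyps by (rule indep_columns_insertD)
  from insert.IH[OF insert.prems(1)[OF _ insertI2] this]
  obtain k \<delta> w where \<delta>: "\<delta> \<in> hforms n m (Suc k)" "poly_eval x \<delta> \<noteq> 0"
    and w: "\<And>j i. j \<in> J \<Longrightarrow> i \<in> I \<Longrightarrow> w j i \<in> hforms n m k"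
    and dual: "\<And>j j'. j \<in> J \<Longrightarrow> j' \<in> J \<Longrightarrow> (\<Sum>i\<in>I. w j i * a i j') = (if j = j' then \<delta> else 0)"
    by blast
  \<comment> \<open>If column \<open>j0\<close> were a combination of the columns in
    \<open>J\<close>, its coefficients would be \<open>s j\<close> divided by \<delta>; so
    \<open>b\<close> is the obstruction with the denominator cleared. If \<open>b\<close> vanished
    at \<open>x\<close> in all rows, it would be a relation with nonzero coefficient \<delta> at
    \<open>j0\<close>.\<close>
  define s where "s j = (\<Sum>i\<in>I. w j i * a i j0)" for j
  define b where "b i = \<delta> * a i j0 - (\<Sum>j\<in>J. s j * a i j)" for i
  have "\<exists>i0\<in>I. poly_eval x (b i0) \<noteq> 0"
  proof (rule ccontr)
    assume "\<not> (\<exists>i0\<in>I. poly_eval x (b i0) \<noteq> 0)"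
    then have b0: "\<And>i. i \<in> I \<Longrightarrow> poly_eval x (b i) = 0" by blast
    define c where "c j = (if j = j0 then poly_eval x \<delta> else - poly_eval x (s j))" for j
    have "(\<Sum>j\<in>insert j0 J. c j * poly_eval x (a i j)) = 0" if "i \<in> I" for i
    proof -
      have "(\<Sum>j\<in>J. c j * poly_eval x (a i j)) = (\<Sum>j\<in>J. - (poly_eval x (s j) * poly_eval x (a i j)))"
        by (rule sum.cong) (use insert.hyps(2) in \<open>auto simp: c_def\<close>)
      then have "(\<Sum>j\<in>insert j0 J. c j * poly_eval x (a i j)) = poly_eval x (b i)"
        using insert.hyps
        by (simp add: b_def poly_eval_diff poly_eval_sum poly_eval_mult c_def[of j0] sum_negf)
      then show ?thesis using b0 that by simp
    qed
    then have "c j0 = 0"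
      using indep_columnsD[OF insert.prems(2), of c j0] by simp
    then show False using \<delta>(2) by (simp add: c_def)
  qed
  then obtain i0 where i0: "i0 \<in> I" "poly_eval x (b i0) \<noteq> 0" by blast
  \<comment> \<open>The row functional that reads entry \<open>i0\<close> of the residual: it
    vanishes on the columns in \<open>J\<close> and takes the value \<open>b i0\<close> on column
    \<open>j0\<close>.\<close>
  define v where "v i = (if i = i0 then \<delta> else 0) - (\<Sum>j\<in>J. a i0 j * w j i)" for i
  have v: "(\<Sum>i\<in>I. v i * a i j') = \<delta> * a i0 j' - (\<Sum>j\<in>J. a i0 j * (\<Sum>i\<in>I. w j i * a i j'))" for j'
  proof -
    have "(\<Sum>i\<in>I. v i * a i j') =
        (\<Sum>i\<in>I. (if i = i0 then \<delta> * a i j' else 0)) - (\<Sum>i\<in>I. \<Sum>j\<in>J. a i0 j * (w j i * a i j'))"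
      by (simp add: v_def left_diff_distrib sum_subtractf sum_distrib_right mult.assoc
          if_distrib[of "\<lambda>x. x * _"] cong: if_cong)
    also have "(\<Sum>i\<in>I. \<Sum>j\<in>J. a i0 j * (w j i * a i j')) = (\<Sum>j\<in>J. a i0 j * (\<Sum>i\<in>I. w j i * a i j'))"
      by (subst sum.swap) (simp add: sum_distrib_left)
    finally show ?thesis using I i0(1) by simp
  qed
  have v_J: "(\<Sum>i\<in>I. v i * a i j') = 0" if "j' \<in> J" for j'
  proof -
    have "(\<Sum>j\<in>J. a i0 j * (\<Sum>i\<in>I. w j i * a i j')) = (\<Sum>j\<in>J. if j = j' then a i0 j * \<delta> else 0)"
      by (rule sum.cong) (use dual that in auto)
    then show ?thesis
      using that insert.hyps(1) by (simp add: v mult.commute)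
  qed
  have v_j0: "(\<Sum>i\<in>I. v i * a i j0) = b i0"
    by (simp add: v b_def s_def mult.commute)
  \<comment> \<open>Scaling by \<open>b i0\<close> and subtracting \<open>s j * v i\<close> removes
    the pairing of the old functionals with column \<open>j0\<close>. All diagonal values become
    \<open>\<delta> * b i0\<close>, and the degree index passes from \<open>k\<close> to
    \<open>2 * k + 2\<close>.\<close>
  define w' where "w' j i = (if j = j0 then \<delta> * v i else b i0 * w j i - s j * v i)" for j i
  have s_form: "s j \<in> hforms n m (Suc k)" if "j \<in> J" for j
    unfolding s_def using hforms_mult[OF w[OF that] insert.prems(1)] by (intro hforms_sum) fastforce
  have b_form: "b i0 \<in> hforms n m (Suc k + 1)"
    unfolding b_def using i0(1)
    by (intro hforms_diff hforms_sum hforms_mult \<delta>(1) s_form insert.prems(1)) auto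
  have v_form: "v i \<in> hforms n m (Suc k)" if "i \<in> I" for i
  proof -
    have "a i0 j * w j i \<in> hforms n m (Suc k)" if "j \<in> J" for j
      using hforms_mult[OF insert.prems(1) w[OF that \<open>i \<in> I\<close>], of i0 j] i0(1) that by simp
    then show ?thesis
      unfolding v_def using \<delta>(1) by (intro hforms_diff hforms_sum) auto
  qed
  have "w' j i \<in> hforms n m (Suc k + Suc k)" if "j \<in> insert j0 J" "i \<in> I" for j i
  proof (cases "j = j0")
    case True
    then show ?thesis
      using hforms_mult[OF \<delta>(1) v_form[OF that(2)]] by (simp add: w'_def)
  next
    case False
    then have "j \<in> J" using that by simp
    then show ?thesis
      using hforms_mult[OF b_form w[OF _ that(2)]] hforms_mult[OF s_form v_form[OF that(2)]] False
      by (auto simp: w'_def intro!: hforms_diff)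
  qed
  moreover have "\<delta> * b i0 \<in> hforms n m (Suc (Suc k + Suc k))"
    using hforms_mult[OF \<delta>(1) b_form] by simp
  moreover have "poly_eval x (\<delta> * b i0) \<noteq> 0"
    using \<delta>(2) i0(2) by (simp add: poly_eval_mult)
  moreover have "(\<Sum>i\<in>I. w' j i * a i j') = (if j = j' then \<delta> * b i0 else 0)"
    if "j \<in> insert j0 J" "j' \<in> insert j0 J" for j j'
  proof (cases "j = j0")
    case True
    then have "(\<Sum>i\<in>I. w' j i * a i j') = \<delta> * (\<Sum>i\<in>I. v i * a i j')"
      by (simp add: w'_def sum_distrib_left mult.assoc)
    then show ?thesis
      using True that(2) v_j0 v_J insert.hyps(2) by auto
  next
    case False
    then have j: "j \<in> J" using that by simp
    have "(\<Sum>i\<in>I. w' j i * a i j') = b i0 * (\<Sum>i\<in>I. w j i * a i j') - s j * (\<Sum>i\<in>I. v i * a i j')"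
      using False
      by (simp add: w'_def left_diff_distrib sum_subtractf sum_distrib_left mult.assoc)
    then show ?thesis
      using False j that(2) v_j0 v_J dual[OF j] insert.hyps(2)
      by (auto simp: s_def[symmetric] mult.commute[of "b i0"])
  qed
  ultimately show ?case by blast
qed

section \<open>Polynomial functions of bounded degree\<close>

definition poly_fun :: "nat \<Rightarrow> (('v \<Rightarrow> complex) \<Rightarrow> complex) \<Rightarrow> bool"
  where "poly_fun D f \<longleftrightarrow> (\<exists>F. (\<forall>\<mu>\<in>keys F. mdeg \<mu> \<le> D) \<and> f = (\<lambda>u. poly_eval u F))"

lemma poly_fun_mono: "poly_fun D f \<Longrightarrow> D \<le> E \<Longrightarrow> poly_fun E f"
  unfolding poly_fun_def using order_trans by blast

lemma poly_fun_const: "poly_fun D (\<lambda>_. c)"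
  unfolding poly_fun_def by (intro exI[of _ "Poly_Mapping.single 0 c"]) (simp add: mdeg_def poly_eval_single mon_eval_def)

lemma poly_fun_var: "poly_fun 1 (\<lambda>u. u v)"
  unfolding poly_fun_def
  by (intro exI[of _ "Poly_Mapping.single (Poly_Mapping.single v 1) 1"])
    (simp add: mdeg_def poly_eval_single mon_eval_def)

lemma poly_fun_add:
  assumes "poly_fun D f" "poly_fun D g"
  shows "poly_fun D (\<lambda>u. f u + g u)"
proof -
  obtain F G where "\<forall>\<mu>\<in>keys F. mdeg \<mu> \<le> D" "f = (\<lambda>u. poly_eval u F)"
    "\<forall>\<mu>\<in>keys G. mdeg \<mu> \<le> D" "g = (\<lambda>u. poly_eval u G)"
    using assms unfolding poly_fun_def by blast
  then show ?thesis
    unfolding poly_fun_def using Poly_Mapping.keys_add[of F G]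
    by (intro exI[of _ "F + G"]) (auto simp: poly_eval_add)
qed

lemma poly_fun_mult:
  assumes "poly_fun D f" "poly_fun E g"
  shows "poly_fun (D + E) (\<lambda>u. f u * g u)"
proof -
  obtain F G where F: "\<forall>\<mu>\<in>keys F. mdeg \<mu> \<le> D" "f = (\<lambda>u. poly_eval u F)"
    and G: "\<forall>\<mu>\<in>keys G. mdeg \<mu> \<le> E" "g = (\<lambda>u. poly_eval u G)"
    using assms unfolding poly_fun_def by blast
  have "\<forall>\<mu>\<in>keys (F * G). mdeg \<mu> \<le> D + E"
  proof
    fix \<mu> assume "\<mu> \<in> keys (F * G)"
    then obtain a b where "\<mu> = a + b" "a \<in> keys F" "b \<in> keys G"
      using keys_mult[of F G] by blast
    then show "mdeg \<mu> \<le> D + E"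
      using F(1) G(1) by (simp add: mdeg_add add_mono)
  qed
  then show ?thesis
    unfolding poly_fun_def using F(2) G(2)
    by (intro exI[of _ "F * G"]) (simp add: poly_eval_mult)
qed

lemma poly_fun_sum: "(\<And>i. i \<in> I \<Longrightarrow> poly_fun D (f i)) \<Longrightarrow> poly_fun D (\<lambda>u. \<Sum>i\<in>I. f i u)"
  by (induction I rule: infinite_finite_induct) (auto intro: poly_fun_const poly_fun_add)

lemma poly_fun_scale: "poly_fun D f \<Longrightarrow> poly_fun D (\<lambda>u. c * f u)"
  using poly_fun_mult[OF poly_fun_const[of 0 c]] by simp

lemma poly_fun_power: "poly_fun D f \<Longrightarrow> poly_fun (D * k) (\<lambda>u. f u ^ k)"
  by (induction k) (auto intro: poly_fun_const dest: poly_fun_mult)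

lemma poly_fun_prod:
  "(\<And>i. i \<in> I \<Longrightarrow> poly_fun (D i) (f i)) \<Longrightarrow> poly_fun (\<Sum>i\<in>I. D i) (\<lambda>u. \<Prod>i\<in>I. f i u)"
  by (induction I rule: infinite_finite_induct) (auto intro: poly_fun_const poly_fun_mult)

lemma poly_fun_form_comp:
  assumes "\<And>\<gamma>. poly_fun D (\<lambda>u. \<phi> u \<gamma>)" "F \<in> hforms n m k"
  shows "poly_fun (D * k) (\<lambda>u. poly_eval (\<phi> u) F)"
proof -
  have "poly_fun (D * k) (\<lambda>u. lookup F \<mu> * mon_eval (\<phi> u) \<mu>)" if "\<mu> \<in> keys F" for \<mu>
  proof -
    have "poly_fun (\<Sum>i\<in>keys \<mu>. D * lookup \<mu> i) (\<lambda>u. mon_eval (\<phi> u) \<mu>)"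
      unfolding mon_eval_def by (intro poly_fun_prod poly_fun_power assms(1))
    moreover have "(\<Sum>i\<in>keys \<mu>. D * lookup \<mu> i) = D * k"
      using assms(2) that by (simp add: hforms_def mdeg_def flip: sum_distrib_left)
    ultimately show ?thesis by (intro poly_fun_scale) simp
  qed
  then show ?thesis
    unfolding poly_eval_def by (intro poly_fun_sum)
qed

lemma poly_fun_on_line:
  assumes "poly_fun D f"
  shows "\<exists>p. \<forall>t. f (\<lambda>i. a i + t * b i) = poly p t"
proof -
  obtain F where F: "f = (\<lambda>u. poly_eval u F)"
    using assms unfolding poly_fun_def by blast
  define p where "p = (\<Sum>\<mu>\<in>keys F. Polynomial.smult (lookup F \<mu>) (\<Prod>i\<in>keys \<mu>. [:a i, b i:] ^ lookup \<mu> i))"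
  have "\<forall>t. f (\<lambda>i. a i + t * b i) = poly p t"
    by (simp add: F p_def poly_eval_def mon_eval_def poly_sum poly_prod)
  then show ?thesis ..
qed

section \<open>Linear dependence of polynomial functions by counting\<close>

text \<open>Bounding each exponent by \<open>D\<close> overestimates the monomials of degree at most
  \<open>D\<close>, but the crude bound suffices: what matters for the growth is the exponent
  \<open>card W\<close>.\<close>

lemma card_bounded_exponents:
  assumes "finite W"
  shows "finite {\<mu>. keys \<mu> \<subseteq> W \<and> (\<forall>i. lookup \<mu> i \<le> D)}" (is "finite ?M")
    and "card {\<mu>. keys \<mu> \<subseteq> W \<and> (\<forall>i. lookup \<mu> i \<le> D)} \<le> (D + 1) ^ card W"
proof -
  let ?f = "\<lambda>\<mu>. restrict (lookup \<mu>) W"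
  have inj: "inj_on ?f ?M"
  proof (intro inj_onI poly_mapping_eqI)
    fix \<mu> \<nu> i assume "\<mu> \<in> ?M" "\<nu> \<in> ?M" "?f \<mu> = ?f \<nu>"
    moreover from this have "lookup \<mu> i = 0 \<and> lookup \<nu> i = 0" if "i \<notin> W"
      using that by (auto simp: in_keys_iff[symmetric] simp flip: not_in_keys_iff_lookup_eq_zero)
    ultimately show "lookup \<mu> i = lookup \<nu> i"
      by (cases "i \<in> W") (auto dest: fun_cong[of _ _ i])
  qed
  have sub: "?f ` ?M \<subseteq> PiE W (\<lambda>_. {..D})" by auto
  have fin: "finite (PiE W (\<lambda>_. {..D}))" using assms by (intro finite_PiE) auto
  show "finite ?M" using inj sub fin by (meson finite_imageD finite_subset)
  have "card ?M = card (?f ` ?M)" using card_image[OF inj] by simp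
  also have "\<dots> \<le> card (PiE W (\<lambda>_. {..D}))" using fin sub by (rule card_mono)
  also have "\<dots> = (D + 1) ^ card W" using assms by (simp add: card_PiE)
  finally show "card ?M \<le> (D + 1) ^ card W" .
qed

text \<open>On the subspace where only variables in \<open>W\<close> may be nonzero, the functions
  \<open>g b\<close> are combinations of at most \<open>(D + 1) ^ card W\<close> monomials, so a
  larger family satisfies a linear relation there.\<close>

lemma poly_fun_family_dependent:
  fixes W :: "'v set"
  assumes W: "finite W" and B: "finite B" "(D + 1) ^ card W < card B"
    and g: "\<And>b. b \<in> B \<Longrightarrow> poly_fun D (g b)"
  shows "\<exists>c. (\<exists>b\<in>B. c b \<noteq> 0) \<and> (\<forall>u. (\<forall>v. v \<notin> W \<longrightarrow> u v = 0) \<longrightarrow> (\<Sum>b\<in>B. c b * g b u) = 0)"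
proof -
  define M where "M = {\<mu> :: 'v \<Rightarrow>\<^sub>0 nat. keys \<mu> \<subseteq> W \<and> (\<forall>i. lookup \<mu> i \<le> D)}"
  obtain G where G: "\<And>b \<mu>. b \<in> B \<Longrightarrow> \<mu> \<in> keys (G b) \<Longrightarrow> mdeg \<mu> \<le> D"
    "\<And>b. b \<in> B \<Longrightarrow> g b = (\<lambda>u. poly_eval u (G b))"
    using g unfolding poly_fun_def by metis
  have M: "finite M" "card M < card B"
    using card_bounded_exponents[OF W, of D] B(2) by (auto simp: M_def)
  obtain c where c: "\<exists>b\<in>B. c b \<noteq> 0" "\<And>\<mu>. \<mu> \<in> M \<Longrightarrow> (\<Sum>b\<in>B. c b * lookup (G b) \<mu>) = 0"
    using homogeneous_system_nontrivial[OF M(1) B(1) M(2), of "\<lambda>b. lookup (G b)"] by blast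
  have "(\<Sum>b\<in>B. c b * g b u) = 0" if u: "\<forall>v. v \<notin> W \<longrightarrow> u v = 0" for u
  proof -
    have "g b u = (\<Sum>\<mu>\<in>M. lookup (G b) \<mu> * mon_eval u \<mu>)" if b: "b \<in> B" for b
    proof -
      have "g b u = (\<Sum>\<mu>\<in>keys (G b) \<union> M. lookup (G b) \<mu> * mon_eval u \<mu>)"
        unfolding G(2)[OF b] using M(1) by (intro poly_eval_superset) auto
      also have "\<dots> = (\<Sum>\<mu>\<in>M. lookup (G b) \<mu> * mon_eval u \<mu>)"
      proof (rule sum.mono_neutral_right)
        show "\<forall>\<mu>\<in>keys (G b) \<union> M - M. lookup (G b) \<mu> * mon_eval u \<mu> = 0"
        proof
          fix \<mu> assume \<mu>: "\<mu> \<in> keys (G b) \<union> M - M"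
          have "lookup \<mu> i \<le> D" for i
          proof (cases "i \<in> keys \<mu>")
            case True
            then have "lookup \<mu> i \<le> mdeg \<mu>"
              unfolding mdeg_def by (intro member_le_sum) simp_all
            then show ?thesis using G(1)[OF b, of \<mu>] \<mu> by auto
          qed (simp add: in_keys_iff)
          \<comment> \<open>The degree bound keeps every exponent of \<mu> at most \<open>D\<close>,
            so \<mu> can lie outside \<open>M\<close> only by involving a variable outside
            \<open>W\<close>, where \<open>u\<close> is zero.\<close>
          then obtain i where i: "i \<in> keys \<mu>" "i \<notin> W"
            using \<mu> by (auto simp: M_def)
          then have "u i ^ lookup \<mu> i = 0"
            using u by (simp add: in_keys_iff zero_power)
          then have "mon_eval u \<mu> = 0"
            unfolding mon_eval_def using i(1) by (intro prod_zero) auto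
          then show "lookup (G b) \<mu> * mon_eval u \<mu> = 0" by simp
        qed
      qed (use M(1) in auto)
      finally show ?thesis .
    qed
    then have "(\<Sum>b\<in>B. c b * g b u) = (\<Sum>b\<in>B. \<Sum>\<mu>\<in>M. c b * lookup (G b) \<mu> * mon_eval u \<mu>)"
      by (intro sum.cong) (simp_all add: sum_distrib_left mult.assoc)
    also have "\<dots> = (\<Sum>\<mu>\<in>M. (\<Sum>b\<in>B. c b * lookup (G b) \<mu>) * mon_eval u \<mu>)"
      by (subst sum.swap) (simp add: sum_distrib_right)
    also have "\<dots> = 0" using c(2) by simp
    finally show ?thesis .
  qed
  then show ?thesis using c(1) by blast
qed

section \<open>Counting monomials\<close>

text \<open>Stars and bars: the slack \<open>d - mdeg \<gamma>\<close> is appended as one more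
  entry, turning exponent vectors of degree at most \<open>d\<close> into lists of length
  \<open>Suc n\<close> with sum exactly \<open>d\<close>.\<close>

lemma card_monoms: "card (monoms n 0 d) = (d + n) choose n"
proof -
  let ?L = "{l :: nat list. length l = Suc n \<and> sum_list l = d}"
  let ?f = "\<lambda>\<gamma> :: expo. map (lookup \<gamma>) [0..<n] @ [d - mdeg \<gamma>]"
  let ?g = "\<lambda>l. Poly_Mapping.nth (take n l)"
  have mdeg: "mdeg \<gamma> = sum_list (map (lookup \<gamma>) [0..<n])" if "keys \<gamma> \<subseteq> {..<n}" for \<gamma>
    using mdeg_superset[OF _ that] by (simp add: sum_list_distinct_conv_sum_set atLeast0LessThan)
  have lookup: "lookup (?g l) i = (if i < n then l ! i else 0)" if "length l = Suc n" for l i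
    using that by (simp add: nth_default_def)
  have keys: "keys (?g l) \<subseteq> {..<n}" if "length l = Suc n" for l
    using lookup[OF that] by (auto simp: in_keys_iff simp del: keys_nth lookup_nth split: if_splits)
  have map: "map (lookup (?g l)) [0..<n] = take n l" if "length l = Suc n" for l
    by (rule nth_equalityI) (use that lookup[OF that] in auto)
  have split: "l = take n l @ [l ! n]" if "length l = Suc n" for l :: "nat list"
    using take_Suc_conv_app_nth[of n l] that by simp
  have sum: "sum_list l = mdeg (?g l) + l ! n" if "length l = Suc n" for l
    using arg_cong[OF split[OF that], of sum_list] mdeg[OF keys[OF that]] map[OF that] by simp
  have "bij_betw ?f (monoms n 0 d) ?L"
  proof (rule bij_betw_byWitness[of _ ?g])
    show "\<forall>\<gamma>\<in>monoms n 0 d. ?g (?f \<gamma>) = \<gamma>"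
    proof (intro ballI poly_mapping_eqI)
      fix \<gamma> i assume \<gamma>: "\<gamma> \<in> monoms n 0 d"
      show "lookup (?g (?f \<gamma>)) i = lookup \<gamma> i"
        using \<gamma> by (subst lookup) (auto simp: nth_append monoms_def in_keys_iff)
    qed
    show "\<forall>l\<in>?L. ?f (?g l) = l"
    proof
      fix l assume l: "l \<in> ?L"
      then have "d - mdeg (?g l) = l ! n" using sum[of l] by simp
      then show "?f (?g l) = l" using l map[of l] split[of l] by simp
    qed
    show "?f ` monoms n 0 d \<subseteq> ?L"
      using mdeg by (auto simp: monoms_def)
    show "?g ` ?L \<subseteq> monoms n 0 d"
      using keys sum by (auto simp: monoms_def simp del: keys_nth)
  qed
  then have "card (monoms n 0 d) = card ?L" by (rule bij_betw_same_card)
  also have "\<dots> = (d + n) choose d" by (simp add: card_length_sum_list)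
  also have "\<dots> = (d + n) choose n" using binomial_symmetric[of d "d + n"] by simp
  finally show ?thesis .
qed

lemma card_monoms_1: "card (monoms n 1 d) = ((d + n) choose n) - 1"
proof -
  have "monoms n 1 d = monoms n 0 d - {0}"
    by (auto simp: monoms_def mdeg_eq_0_iff Suc_le_eq simp flip: neq0_conv)
  moreover have "0 \<in> monoms n 0 d" by (simp add: monoms_def mdeg_def)
  ultimately show ?thesis by (simp add: card_monoms)
qed

section \<open>Zariski-closed sets\<close>

lemma proj_point_self: "T \<in> proj_point T"
proof -
  have "Poly_Mapping.map ((*) 1) T = T"
    by (rule poly_mapping_eqI) (simp add: lookup_map_times)
  then show ?thesis
    unfolding proj_point_def by (intro CollectI exI[of _ 1]) simp
qed

lemma proj_point_mem_proj_space: "T \<in> polys n m \<Longrightarrow> T \<noteq> 0 \<Longrightarrow> proj_point T \<in> proj_space n m"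
  by (simp add: proj_space_def)

lemma hforms_imp_forms: "F \<in> hforms n m k \<Longrightarrow> F \<in> forms n m"
  by (auto simp: forms_eq_hforms)

lemma mem_zero_locus_singleton:
  assumes "F \<in> forms n m" "T \<in> polys n m" "T \<noteq> 0"
  shows "proj_point T \<in> zero_locus n m {F} \<longleftrightarrow> poly_eval (lookup T) F = 0"
  using mem_zero_locus_iff[of "{F}" n m T] assms proj_point_mem_proj_space by simp

lemma zero_locus_mult:
  assumes "F \<in> forms n m" "G \<in> forms n m"
  shows "zero_locus n m {F * G} = zero_locus n m {F} \<union> zero_locus n m {G}"
  using zero_locus_Un[of "{F}" n m "{G}"] assms by simp

lemma closedin_zero_locus: "F \<in> forms n m \<Longrightarrow> closedin (zariski n m) (zero_locus n m {F})"
  unfolding closedin_zariski by (intro exI[of _ "{F}"]) simp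

lemma closure_subset_zero_locus_iff:
  assumes "F \<in> forms n m" "S \<subseteq> polys n m - {0}"
  shows "zariski n m closure_of (proj_point ` S) \<subseteq> zero_locus n m {F} \<longleftrightarrow>
    (\<forall>T\<in>S. poly_eval (lookup T) F = 0)"
proof
  assume sub: "zariski n m closure_of (proj_point ` S) \<subseteq> zero_locus n m {F}"
  show "\<forall>T\<in>S. poly_eval (lookup T) F = 0"
  proof
    fix T assume "T \<in> S"
    then have T: "T \<in> polys n m" "T \<noteq> 0" using assms(2) by auto
    have "proj_point ` S \<subseteq> topspace (zariski n m)"
      using assms(2) by (auto simp: proj_space_def)
    then have "proj_point T \<in> zariski n m closure_of (proj_point ` S)"
      using closure_of_subset \<open>T \<in> S\<close> by blast
    then show "poly_eval (lookup T) F = 0"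
      using sub mem_zero_locus_singleton[OF assms(1) T] by blast
  qed
next
  assume van: "\<forall>T\<in>S. poly_eval (lookup T) F = 0"
  have "proj_point T \<in> zero_locus n m {F}" if "T \<in> S" for T
    using mem_zero_locus_singleton[OF assms(1), of T] van that assms(2) by auto
  then show "zariski n m closure_of (proj_point ` S) \<subseteq> zero_locus n m {F}"
    by (intro closure_of_minimal closedin_zero_locus assms(1)) blast
qed

lemma separating_form:
  assumes "closedin (zariski n m) Z" "Y \<subseteq> proj_space n m" "\<not> Y \<subseteq> Z"
  obtains F where "F \<in> forms n m" "Z \<subseteq> zero_locus n m {F}" "\<not> Y \<subseteq> zero_locus n m {F}"
proof -
  obtain S where S: "S \<subseteq> forms n m" "Z = zero_locus n m S"
    using assms(1) unfolding closedin_zariski by blast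
  obtain y where y: "y \<in> Y" "y \<notin> Z" using assms(3) by blast
  then obtain T F where F: "T \<in> y" "F \<in> S" "poly_eval (lookup T) F \<noteq> 0"
    unfolding S(2) zero_locus_def using assms(2) by blast
  show thesis
  proof (rule that)
    show "F \<in> forms n m" using F(2) S(1) by blast
    show "Z \<subseteq> zero_locus n m {F}" using F(2) by (auto simp: S(2) zero_locus_def)
    show "\<not> Y \<subseteq> zero_locus n m {F}" using y(1) F(1,3) by (auto simp: zero_locus_def)
  qed
qed

section \<open>Irreducible closed sets and chains\<close>

text \<open>The homogeneous counterpart of the primality of the vanishing ideal of an irreducible
  set.\<close>

lemma irreducible_in_forms_mult:
  assumes "irreducible_in (zariski n m) Z" "F \<in> forms n m" "G \<in> forms n m"
    and "Z \<subseteq> zero_locus n m {F * G}"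
  shows "Z \<subseteq> zero_locus n m {F} \<or> Z \<subseteq> zero_locus n m {G}"
  using assms(1)[unfolded irreducible_in_def, THEN conjunct2, THEN conjunct2, rule_format,
      of "zero_locus n m {F}" "zero_locus n m {G}"]
    closedin_zero_locus[OF assms(2)] closedin_zero_locus[OF assms(3)] assms(4)
  by (simp add: zero_locus_mult[OF assms(2,3)])

lemma irreducible_in_subtopology_iff:
  assumes "closedin X S" "Z \<subseteq> S"
  shows "irreducible_in (subtopology X S) Z \<longleftrightarrow> irreducible_in X Z"
proof
  assume Z: "irreducible_in (subtopology X S) Z"
  show "irreducible_in X Z"
    unfolding irreducible_in_def
  proof (intro conjI allI impI)
    fix A B assume AB: "closedin X A \<and> closedin X B \<and> Z \<subseteq> A \<union> B"
    have "closedin (subtopology X S) (A \<inter> S)" "closedin (subtopology X S) (B \<inter> S)"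
      using AB by (auto simp: closedin_subtopology)
    moreover have "Z \<subseteq> (A \<inter> S) \<union> (B \<inter> S)" using AB assms(2) by blast
    ultimately have "Z \<subseteq> A \<inter> S \<or> Z \<subseteq> B \<inter> S"
      using Z unfolding irreducible_in_def by blast
    then show "Z \<subseteq> A \<or> Z \<subseteq> B" by blast
  qed (use Z in \<open>auto simp: irreducible_in_def\<close>)
next
  assume Z: "irreducible_in X Z"
  show "irreducible_in (subtopology X S) Z"
    unfolding irreducible_in_def
  proof (intro conjI allI impI)
    fix A B assume "closedin (subtopology X S) A \<and> closedin (subtopology X S) B \<and> Z \<subseteq> A \<union> B"
    then have "closedin X A \<and> closedin X B \<and> Z \<subseteq> A \<union> B"
      by (simp add: closedin_closed_subtopology[OF assms(1)])
    then show "Z \<subseteq> A \<or> Z \<subseteq> B"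
      using Z unfolding irreducible_in_def by blast
  qed (use Z assms in \<open>auto simp: irreducible_in_def\<close>)
qed

lemma krull_dim_subtopology_eqI:
  assumes X: "closedin T X"
    and upper: "\<And>l Z. (\<And>i. i \<le> l \<Longrightarrow> closedin T (Z i) \<and> irreducible_in T (Z i) \<and> Z i \<subseteq> X) \<Longrightarrow>
      (\<And>i. i < l \<Longrightarrow> Z i \<subset> Z (Suc i)) \<Longrightarrow> l \<le> k"
    and lower: "\<And>i. i \<le> k \<Longrightarrow> closedin T (Y i) \<and> irreducible_in T (Y i) \<and> Y i \<subseteq> X"
      "\<And>i. i < k \<Longrightarrow> Y i \<subset> Y (Suc i)"
  shows "krull_dim (subtopology T X) = enat k"
proof -
  have eq: "closedin (subtopology T X) A \<and> irreducible_in (subtopology T X) A \<longleftrightarrow>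
      closedin T A \<and> irreducible_in T A \<and> A \<subseteq> X" for A
    using irreducible_in_subtopology_iff[OF X, of A] closedin_closed_subtopology[OF X, of A] by blast
  show ?thesis
    unfolding krull_dim_def eq
  proof (rule antisym)
    show "Sup {enat k |k. \<exists>Z. (\<forall>i\<le>k. closedin T (Z i) \<and> irreducible_in T (Z i) \<and> Z i \<subseteq> X) \<and>
        (\<forall>i<k. Z i \<subset> Z (Suc i))} \<le> enat k"
    proof (rule Sup_least, clarify)
      fix l Z
      assume "\<forall>i\<le>l. closedin T (Z i) \<and> irreducible_in T (Z i) \<and> Z i \<subseteq> X" "\<forall>i<l. Z i \<subset> Z (Suc i)"
      then have "l \<le> k" by (intro upper[of l Z]) blast+
      then show "enat l \<le> enat k" by simp
    qed
    show "enat k \<le> Sup {enat k |k. \<exists>Z. (\<forall>i\<le>k. closedin T (Z i) \<and> irreducible_in T (Z i) \<and> Z i \<subseteq> X) \<and>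
        (\<forall>i<k. Z i \<subset> Z (Suc i))}"
    proof (rule Sup_upper)
      show "enat k \<in> {enat k |k. \<exists>Z. (\<forall>i\<le>k. closedin T (Z i) \<and> irreducible_in T (Z i) \<and> Z i \<subseteq> X) \<and>
          (\<forall>i<k. Z i \<subset> Z (Suc i))}"
        by (rule CollectI, rule exI[of _ k], rule conjI[OF refl], rule exI[of _ Y])
          (use lower in blast)
    qed
  qed
qed

text \<open>
  This is the algebraic independence of the forms \<open>F\<^sub>i\<close> on \<open>Z\<^sub>l\<close>; the powers of the coordinate
  \<open>\<gamma>\<close> only bring all monomials in the \<open>F\<^sub>i\<close> to one degree.
\<close>

lemma chain_forms_independent:
  fixes c :: "(nat \<Rightarrow> nat) \<Rightarrow> complex"
  assumes irr: "\<And>i. i \<le> l \<Longrightarrow> irreducible_in (zariski n m) (Z i)"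
    and chain: "\<And>i. i < l \<Longrightarrow> Z i \<subseteq> Z (Suc i)"
    and F: "\<And>i. i < l \<Longrightarrow> F i \<in> hforms n m (a i)"
      "\<And>i. i < l \<Longrightarrow> Z i \<subseteq> zero_locus n m {F i}"
      "\<And>i. i < l \<Longrightarrow> \<not> Z (Suc i) \<subseteq> zero_locus n m {F i}"
    and \<gamma>: "\<gamma> \<in> monoms n 0 m" "\<not> Z 0 \<subseteq> zero_locus n m {form_var \<gamma>}"
    and B: "finite B" "B \<noteq> {}" "\<And>b. b \<in> B \<Longrightarrow> c b \<noteq> 0" "inj_on (\<lambda>b. restrict b {..<l}) B"
      "\<And>b. b \<in> B \<Longrightarrow> w b + (\<Sum>i<l. a i * b i) = M"
  shows "\<not> Z l \<subseteq> zero_locus n m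
    {\<Sum>b\<in>B. Poly_Mapping.single 0 (c b) * form_var \<gamma> ^ w b * (\<Prod>i<l. F i ^ b i)}"
  using irr chain F B
proof (induction l arbitrary: B M)
  case 0
  obtain b where b: "b \<in> B" using 0 by blast
  \<comment> \<open>With \<open>l = 0\<close> all restrictions agree, so injectivity leaves a single
    term, a nonzero multiple of a power of the coordinate.\<close>
  have "b' = b" if "b' \<in> B" for b'
    by (rule inj_onD[OF 0(9) _ that b]) (simp add: restrict_def)
  then have "B = {b}" using b by blast
  moreover obtain p where p: "p \<in> Z 0" "p \<notin> zero_locus n m {form_var \<gamma>}"
    using \<gamma>(2) by blast
  moreover have "p \<in> proj_space n m"
    using 0(1) p(1) by (auto simp: irreducible_in_def)
  then obtain T where "T \<in> p" "lookup T \<gamma> \<noteq> 0"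
    using p(2) by (auto simp: zero_locus_def)
  ultimately show ?case
    using 0(8)[OF b] by (auto simp: zero_locus_def poly_eval_mult poly_eval_power subset_iff)
next
  case (Suc l)
  let ?term = "\<lambda>b. Poly_Mapping.single 0 (c b) * form_var \<gamma> ^ w b * (\<Prod>i<l. F i ^ b i)"
  \<comment> \<open>The smallest exponent of \<open>F l\<close> is divided out, so that the quotient
    \<open>G\<close> keeps some terms without \<open>F l\<close>; primality on
    \<open>Z (Suc l)\<close> then discards the factor \<open>F l ^ j0\<close>.\<close>
  define j0 where "j0 = Min ((\<lambda>b. b l) ` B)"
  define B0 where "B0 = {b \<in> B. b l = j0}"
  define G where "G = (\<Sum>b\<in>B. ?term b * F l ^ (b l - j0))"
  have j0_le: "j0 \<le> b l" if "b \<in> B" for b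
    unfolding j0_def using Suc.prems(6) that by (intro Min_le) auto
  have "j0 \<in> (\<lambda>b. b l) ` B"
    unfolding j0_def using Suc.prems(6,7) by (intro Min_in) auto
  then have B0: "finite B0" "B0 \<noteq> {}" "B0 \<subseteq> B"
    using Suc.prems(6) by (auto simp: B0_def)
  have Fl: "F l \<in> hforms n m (a l)" using Suc.prems(3) by simp
  have prod: "(\<Prod>i<l. F i ^ b i) \<in> hforms n m (\<Sum>i<l. a i * b i)" for b
    using Suc.prems(3) by (intro hforms_prod hforms_power) auto
  have var: "form_var \<gamma> ^ k \<in> hforms n m k" for k
    using hforms_power[OF hforms_var[OF \<gamma>(1)], of k] by simp
  have G_form: "G \<in> hforms n m (M - a l * j0)"
    unfolding G_def
  proof (rule hforms_sum)
    fix b assume b: "b \<in> B"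
    have "w b + (\<Sum>i<l. a i * b i) + a l * b l = M"
      using Suc.prems(10)[OF b] by (simp add: add.assoc)
    moreover have "a l * b l = a l * (b l - j0) + a l * j0"
      using j0_le[OF b] by (simp flip: distrib_left)
    ultimately have "0 + w b + (\<Sum>i<l. a i * b i) + a l * (b l - j0) = M - a l * j0"
      by simp
    moreover have "?term b * F l ^ (b l - j0) \<in> hforms n m (0 + w b + (\<Sum>i<l. a i * b i) + a l * (b l - j0))"
      by (intro hforms_mult hforms_const var prod hforms_power Fl)
    ultimately show "?term b * F l ^ (b l - j0) \<in> hforms n m (M - a l * j0)"
      by (simp only:)
  qed
  have H: "(\<Sum>b\<in>B. Poly_Mapping.single 0 (c b) * form_var \<gamma> ^ w b * (\<Prod>i<Suc l. F i ^ b i)) = F l ^ j0 * G"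
    unfolding G_def sum_distrib_left
  proof (rule sum.cong[OF refl])
    fix b assume "b \<in> B"
    then have "F l ^ b l = F l ^ j0 * F l ^ (b l - j0)"
      using j0_le by (simp flip: power_add)
    then show "Poly_Mapping.single 0 (c b) * form_var \<gamma> ^ w b * (\<Prod>i<Suc l. F i ^ b i)
        = F l ^ j0 * (?term b * F l ^ (b l - j0))"
      by (simp only: prod.lessThan_Suc ac_simps)
  qed
  show ?case
  proof
    assume "Z (Suc l) \<subseteq> zero_locus n m
      {\<Sum>b\<in>B. Poly_Mapping.single 0 (c b) * form_var \<gamma> ^ w b * (\<Prod>i<Suc l. F i ^ b i)}"
    then have "Z (Suc l) \<subseteq> zero_locus n m {F l ^ j0} \<or> Z (Suc l) \<subseteq> zero_locus n m {G}"
      unfolding H using Suc.prems(1)[of "Suc l"] hforms_power[OF Fl] G_form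
      by (intro irreducible_in_forms_mult) (auto intro: hforms_imp_forms)
    then show False
    proof
      assume "Z (Suc l) \<subseteq> zero_locus n m {F l ^ j0}"
      then have "Z (Suc l) \<subseteq> zero_locus n m {F l}"
        by (auto simp: zero_locus_def poly_eval_power)
      then show False using Suc.prems(5)[of l] by simp
    next
      assume *: "Z (Suc l) \<subseteq> zero_locus n m {G}"
      \<comment> \<open>On \<open>Z l\<close>, where \<open>F l\<close> vanishes, every term of
        \<open>G\<close> whose exponent exceeds \<open>j0\<close> disappears. The rest involves only
        \<open>F i\<close> with \<open>i < l\<close>, which is the situation of the induction
        hypothesis.\<close>
      have "poly_eval (lookup T) (\<Sum>b\<in>B0. ?term b) = 0" if T: "p \<in> Z l" "T \<in> p" for p T
      proof -
        have "poly_eval (lookup T) (F l) = 0"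
          using Suc.prems(4)[of l] T by (auto simp: zero_locus_def)
        then have "poly_eval (lookup T) (?term b * F l ^ (b l - j0)) =
            (if b \<in> B0 then poly_eval (lookup T) (?term b) else 0)" if "b \<in> B" for b
          using that j0_le[OF that] by (auto simp: B0_def poly_eval_mult poly_eval_power zero_power)
        then have "poly_eval (lookup T) G = (\<Sum>b\<in>B. if b \<in> B0 then poly_eval (lookup T) (?term b) else 0)"
          unfolding G_def poly_eval_sum by (intro sum.cong) auto
        also have "\<dots> = (\<Sum>b\<in>B0. poly_eval (lookup T) (?term b))"
          using B0(3) Suc.prems(6) by (simp add: sum.If_cases Int_absorb1)
        finally have "poly_eval (lookup T) (\<Sum>b\<in>B0. ?term b) = poly_eval (lookup T) G"
          by (simp add: poly_eval_sum)
        moreover have "p \<in> zero_locus n m {G}"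
          using * Suc.prems(2)[of l] T(1) by auto
        ultimately show ?thesis using T(2) by (simp add: zero_locus_def)
      qed
      moreover have "Z l \<subseteq> proj_space n m"
        using Suc.prems(1)[of l] by (simp add: irreducible_in_def)
      ultimately have "Z l \<subseteq> zero_locus n m {\<Sum>b\<in>B0. ?term b}"
        by (auto simp: zero_locus_def)
      moreover have "\<not> Z l \<subseteq> zero_locus n m {\<Sum>b\<in>B0. ?term b}"
      proof (rule Suc.IH[where M = "M - a l * j0"])
        show "inj_on (\<lambda>b. restrict b {..<l}) B0"
        proof (rule inj_onI)
          fix b b' assume b: "b \<in> B0" "b' \<in> B0" "restrict b {..<l} = restrict b' {..<l}"
          have "b i = b' i" if "i < Suc l" for i
          proof (cases "i = l")
            case False
            then show ?thesis using fun_cong[OF b(3), of i] that by simp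
          qed (use b(1,2) in \<open>simp add: B0_def\<close>)
          then have "restrict b {..<Suc l} = restrict b' {..<Suc l}"
            by (intro restrict_ext) simp
          then show "b = b'"
            using Suc.prems(9) b(1,2) B0(3) by (blast dest: inj_onD)
        qed
        show "w b + (\<Sum>i<l. a i * b i) = M - a l * j0" if "b \<in> B0" for b
          using Suc.prems(10)[of b] that by (auto simp: B0_def)
      qed (use Suc.prems B0 in auto)
      ultimately show False by contradiction
    qed
  qed
qed

section \<open>Closures of images of polynomial maps\<close>

text \<open>\<open>N\<close> is chosen so that \<open>(C + 1) ^ k\<close> is less than
  \<open>N + 1\<close>: the constant is absorbed by a single extra factor, which
  \<open>k < l\<close> provides.\<close>

lemma exponential_growth:
  assumes "k < l"
  shows "\<exists>N::nat. (C * N + 1) ^ k < (N + 1) ^ l"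
proof -
  define N where "N = (C + 1) ^ k"
  have "(C * N + 1) ^ k \<le> ((C + 1) * (N + 1)) ^ k"
    by (rule power_mono) auto
  also have "\<dots> = N * (N + 1) ^ k"
    by (simp only: N_def power_mult_distrib)
  also have "\<dots> < (N + 1) * (N + 1) ^ k"
    by simp
  also have "\<dots> = (N + 1) ^ Suc k" by simp
  also have "\<dots> \<le> (N + 1) ^ l"
    using assms by (intro power_increasing) auto
  finally show ?thesis by blast
qed

lemma nonzero_poly_nonroot:
  fixes q :: "complex Polynomial.poly"
  assumes "q \<noteq> 0"
  obtains t where "poly q t \<noteq> 0"
  using assms that poly_all_0_iff_0[of q] by auto

text \<open>These are the properties of the Taylor parametrization on which both chain bounds rest.
  The fixed coefficient 1 keeps \<open>\<phi> u\<close> nonzero, hence a projective point, and the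
  degree bound \<open>D\<close> is uniform in \<gamma>.\<close>

locale polynomial_family =
  fixes n m D :: nat and \<phi> :: "('v \<Rightarrow> complex) \<Rightarrow> (expo \<Rightarrow>\<^sub>0 complex)"
  assumes \<phi>_polys: "\<phi> u \<in> polys n m"
    and \<phi>_0: "lookup (\<phi> u) 0 = 1"
    and \<phi>_poly_fun: "poly_fun D (\<lambda>u. lookup (\<phi> u) \<gamma>)"
begin

definition image_closure :: "('v \<Rightarrow> complex) set \<Rightarrow> ppoint set"
  where "image_closure A = zariski n m closure_of (proj_point ` \<phi> ` A)"

lemma \<phi>_nonzero: "\<phi> u \<noteq> 0"
  using \<phi>_0[of u] by auto

lemma image_subset: "\<phi> ` A \<subseteq> polys n m - {0}"
  using \<phi>_polys \<phi>_nonzero by auto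

lemma closedin_image_closure: "closedin (zariski n m) (image_closure A)"
  by (simp add: image_closure_def)

lemma image_closure_mono: "A \<subseteq> A' \<Longrightarrow> image_closure A \<subseteq> image_closure A'"
  unfolding image_closure_def by (intro closure_of_mono image_mono)

lemma image_closure_subset_zero_locus_iff:
  "F \<in> forms n m \<Longrightarrow> image_closure A \<subseteq> zero_locus n m {F} \<longleftrightarrow>
    (\<forall>u\<in>A. poly_eval (lookup (\<phi> u)) F = 0)"
  unfolding image_closure_def by (simp add: closure_subset_zero_locus_iff[OF _ image_subset])

lemma mem_image_closure: "u \<in> A \<Longrightarrow> proj_point (\<phi> u) \<in> image_closure A"
  unfolding image_closure_def
  using closure_of_subset[of "proj_point ` \<phi> ` A" "zariski n m"] image_subset
  by (auto simp: proj_space_def)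

lemma form_on_line:
  assumes "F \<in> forms n m"
  shows "\<exists>q. \<forall>t. poly_eval (lookup (\<phi> (\<lambda>i. a i + t * b i))) F = poly q t"
proof -
  obtain k where "F \<in> hforms n m k"
    using assms by (auto simp: forms_eq_hforms)
  then have "poly_fun (D * k) (\<lambda>u. poly_eval (lookup (\<phi> u)) F)"
    using \<phi>_poly_fun by (intro poly_fun_form_comp)
  then show ?thesis by (rule poly_fun_on_line)
qed

text \<open>Along the line from \<open>u\<close> at \<open>t = 0\<close> to \<open>v\<close> at
  \<open>t = 1\<close> both forms become univariate polynomials, each nonzero at one of these two
  values; so their product has a nonroot.\<close>

lemma forms_nonvanishing_on_line:
  assumes "F \<in> forms n m" "G \<in> forms n m"
    and "poly_eval (lookup (\<phi> u)) F \<noteq> 0" "poly_eval (lookup (\<phi> v)) G \<noteq> 0"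
  obtains t where "poly_eval (lookup (\<phi> (\<lambda>i. u i + t * (v i - u i)))) F \<noteq> 0"
    "poly_eval (lookup (\<phi> (\<lambda>i. u i + t * (v i - u i)))) G \<noteq> 0"
proof -
  obtain p where p: "\<forall>t. poly_eval (lookup (\<phi> (\<lambda>i. u i + t * (v i - u i)))) F = poly p t"
    using form_on_line[OF assms(1), of u "\<lambda>i. v i - u i"] ..
  obtain q where q: "\<forall>t. poly_eval (lookup (\<phi> (\<lambda>i. u i + t * (v i - u i)))) G = poly q t"
    using form_on_line[OF assms(2), of u "\<lambda>i. v i - u i"] ..
  have "p \<noteq> 0" "q \<noteq> 0"
    using p[THEN spec, of 0] q[THEN spec, of 1] assms(3,4) by auto
  then obtain t where "poly (p * q) t \<noteq> 0"
    using nonzero_poly_nonroot[of "p * q"] by auto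
  then show thesis using p q by (intro that[of t]) auto
qed

text \<open>If neither closed set contained the image, each would yield a form nonzero somewhere on
  \<open>A\<close>; the line through the two points stays in \<open>A\<close> and contains a point
  where neither form vanishes.\<close>

lemma irreducible_image_closure:
  assumes "A \<noteq> {}" and line: "\<And>u v t. u \<in> A \<Longrightarrow> v \<in> A \<Longrightarrow> (\<lambda>i. u i + t * (v i - u i)) \<in> A"
  shows "irreducible_in (zariski n m) (image_closure A)"
  unfolding irreducible_in_def
proof (intro conjI allI impI)
  show "image_closure A \<subseteq> topspace (zariski n m)"
    unfolding image_closure_def by (rule closure_of_subset_topspace)
  show "image_closure A \<noteq> {}"
    using assms(1) mem_image_closure by blast
  fix Y Z
  assume YZ: "closedin (zariski n m) Y \<and> closedin (zariski n m) Z \<and> image_closure A \<subseteq> Y \<union> Z"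
  show "image_closure A \<subseteq> Y \<or> image_closure A \<subseteq> Z"
  proof (rule ccontr)
    assume not: "\<not> (image_closure A \<subseteq> Y \<or> image_closure A \<subseteq> Z)"
    have sub: "image_closure A \<subseteq> proj_space n m"
      unfolding image_closure_def using closure_of_subset_topspace[of "zariski n m"] by simp
    obtain F where F: "F \<in> forms n m" "Y \<subseteq> zero_locus n m {F}" "\<not> image_closure A \<subseteq> zero_locus n m {F}"
      using separating_form[of n m Y "image_closure A"] YZ not sub by auto
    obtain G where G: "G \<in> forms n m" "Z \<subseteq> zero_locus n m {G}" "\<not> image_closure A \<subseteq> zero_locus n m {G}"
      using separating_form[of n m Z "image_closure A"] YZ not sub by auto
    obtain u v where uv: "u \<in> A" "poly_eval (lookup (\<phi> u)) F \<noteq> 0" "v \<in> A" "poly_eval (lookup (\<phi> v)) G \<noteq> 0"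
      using F(3)[unfolded image_closure_subset_zero_locus_iff[OF F(1)]]
        G(3)[unfolded image_closure_subset_zero_locus_iff[OF G(1)]] by auto
    obtain t where t: "poly_eval (lookup (\<phi> (\<lambda>i. u i + t * (v i - u i)))) F \<noteq> 0"
      "poly_eval (lookup (\<phi> (\<lambda>i. u i + t * (v i - u i)))) G \<noteq> 0"
      by (rule forms_nonvanishing_on_line[OF F(1) G(1) uv(2,4)])
    define x where "x = (\<lambda>i. u i + t * (v i - u i))"
    have "proj_point (\<phi> x) \<in> image_closure A"
      using line[OF uv(1,3)] by (intro mem_image_closure) (simp add: x_def)
    then have "proj_point (\<phi> x) \<in> zero_locus n m {F} \<or> proj_point (\<phi> x) \<in> zero_locus n m {G}"
      using YZ F(2) G(2) by blast
    then show False
      using t mem_zero_locus_singleton[OF _ \<phi>_polys \<phi>_nonzero, of _ x] F(1) G(1)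
      unfolding x_def by auto
  qed
qed

section \<open>Bounds for chains of irreducible closed subsets\<close>

text \<open>The hypothesis \<open>dense\<close> says, in terms of forms, that the parameters
  supported on \<open>W\<close> have dense image. A linear relation among pulled-back forms is found
  on these parameters and spreads to the whole image closure.\<close>

lemma chain_length_le:
  assumes W: "finite W"
    and dense: "\<And>F. F \<in> forms n m \<Longrightarrow>
      (\<And>u. (\<forall>v. v \<notin> W \<longrightarrow> u v = 0) \<Longrightarrow> poly_eval (lookup (\<phi> u)) F = 0) \<Longrightarrow>
      image_closure UNIV \<subseteq> zero_locus n m {F}"
    and Z: "\<And>i. i \<le> l \<Longrightarrow> closedin (zariski n m) (Z i) \<and> irreducible_in (zariski n m) (Z i)
        \<and> Z i \<subseteq> image_closure UNIV"
      "\<And>i. i < l \<Longrightarrow> Z i \<subset> Z (Suc i)"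
  shows "l \<le> card W"
proof (rule ccontr)
  assume "\<not> l \<le> card W"
  have proj: "Z i \<subseteq> proj_space n m" if "i \<le> l" for i
    using Z(1)[OF that] by (simp add: irreducible_in_def)
  have "\<forall>i\<in>{..<l}. \<exists>Fa. fst Fa \<in> hforms n m (snd Fa) \<and> Z i \<subseteq> zero_locus n m {fst Fa}
      \<and> \<not> Z (Suc i) \<subseteq> zero_locus n m {fst Fa}"
  proof
    fix i assume "i \<in> {..<l}"
    then have that: "i < l" by simp
    have not: "\<not> Z (Suc i) \<subseteq> Z i" using Z(2)[OF that] by blast
    have cl: "closedin (zariski n m) (Z i)" "Z (Suc i) \<subseteq> proj_space n m"
      using Z(1)[of i] proj[of "Suc i"] that by auto
    obtain F where "F \<in> forms n m" "Z i \<subseteq> zero_locus n m {F}" "\<not> Z (Suc i) \<subseteq> zero_locus n m {F}"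
      by (rule separating_form[OF cl not])
    moreover from this obtain k where "F \<in> hforms n m k" by (auto simp: forms_eq_hforms)
    ultimately show "\<exists>Fa. fst Fa \<in> hforms n m (snd Fa) \<and> Z i \<subseteq> zero_locus n m {fst Fa}
      \<and> \<not> Z (Suc i) \<subseteq> zero_locus n m {fst Fa}"
      by (intro exI[of _ "(F, k)"]) simp
  qed
  from bchoice[OF this] obtain Fa where Fa: "\<forall>i\<in>{..<l}. fst (Fa i) \<in> hforms n m (snd (Fa i))
      \<and> Z i \<subseteq> zero_locus n m {fst (Fa i)} \<and> \<not> Z (Suc i) \<subseteq> zero_locus n m {fst (Fa i)}" ..
  define F where "F i = fst (Fa i)" for i
  define a where "a i = snd (Fa i)" for i
  have F: "F i \<in> hforms n m (a i)" "Z i \<subseteq> zero_locus n m {F i}"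
    "\<not> Z (Suc i) \<subseteq> zero_locus n m {F i}" if "i < l" for i
    using Fa that by (auto simp: F_def a_def)
  obtain y where y: "y \<in> Z 0"
    using Z(1)[of 0] by (auto simp: irreducible_in_def)
  then have "y \<in> proj_space n m" using proj[of 0] by blast
  then obtain T where T: "T \<in> polys n m" "T \<noteq> 0" "proj_point T \<in> Z 0"
    using y by (auto simp: proj_space_def)
  then have "keys T \<noteq> {}" by simp
  \<comment> \<open>The padding coordinate has to be nonzero at a point of \<open>Z 0\<close>. The
    constant coordinate cannot be taken for it in general, since it may vanish at points of the
    closure.\<close>
  then obtain \<gamma> where \<gamma>: "\<gamma> \<in> keys T" by blast
  then have \<gamma>_mon: "\<gamma> \<in> monoms n 0 m" using T(1) by (auto simp: polys_def)
  have \<gamma>_van: "\<not> Z 0 \<subseteq> zero_locus n m {form_var \<gamma>}"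
    using T(3) \<gamma> mem_zero_locus_singleton[OF hforms_imp_forms[OF hforms_var[OF \<gamma>_mon]] T(1,2)]
    by (auto simp: in_keys_iff)
  define A where "A = (\<Sum>i<l. a i)"
  \<comment> \<open>Forms of degree \<open>A * N\<close> pull back to polynomials of degree at most
    \<open>D * A * N\<close>; this \<open>N\<close> makes the number of exponent choices exceed the
    bound on the number of monomials in \<open>W\<close>.\<close>
  obtain N where N: "(D * A * N + 1) ^ card W < (N + 1) ^ l"
    using exponential_growth[of "card W" l "D * A"] \<open>\<not> l \<le> card W\<close> by auto
  define B where "B = PiE {..<l} (\<lambda>_. {..N})"
  \<comment> \<open>The power of \<open>form_var \<gamma>\<close> that lifts a product of the
    \<open>F i\<close> to degree \<open>A * N\<close>; for \<open>b\<close> in \<open>B\<close> the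
    subtraction is exact because each \<open>b i\<close> is at most \<open>N\<close>.\<close>
  define w where "w b = A * N - (\<Sum>i<l. a i * b i)" for b :: "nat \<Rightarrow> nat"
  have w: "w b + (\<Sum>i<l. a i * b i) = A * N" if "b \<in> B" for b
  proof -
    have "(\<Sum>i<l. a i * b i) \<le> (\<Sum>i<l. a i * N)"
      using that by (intro sum_mono mult_left_mono) (auto simp: B_def PiE_iff)
    then show ?thesis by (simp add: w_def A_def sum_distrib_right)
  qed
  define f where "f b = form_var \<gamma> ^ w b * (\<Prod>i<l. F i ^ b i)" for b :: "nat \<Rightarrow> nat"
  have f: "f b \<in> hforms n m (A * N)" if "b \<in> B" for b
  proof -
    have "form_var \<gamma> ^ w b \<in> hforms n m (w b)"
      using hforms_power[OF hforms_var[OF \<gamma>_mon], of "w b"] by simp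
    moreover have "(\<Prod>i<l. F i ^ b i) \<in> hforms n m (\<Sum>i<l. a i * b i)"
      using F(1) by (intro hforms_prod hforms_power) auto
    ultimately show ?thesis
      unfolding f_def w[OF that, symmetric] by (rule hforms_mult)
  qed
  have B: "finite B" "card B = (N + 1) ^ l"
    by (simp_all add: B_def card_PiE finite_PiE)
  have "\<exists>c. (\<exists>b\<in>B. c b \<noteq> 0) \<and> (\<forall>u. (\<forall>v. v \<notin> W \<longrightarrow> u v = 0) \<longrightarrow>
      (\<Sum>b\<in>B. c b * poly_eval (lookup (\<phi> u)) (f b)) = 0)"
  proof (rule poly_fun_family_dependent[OF W B(1)])
    show "(D * (A * N) + 1) ^ card W < card B" using N B(2) by (simp add: mult.assoc)
    show "poly_fun (D * (A * N)) (\<lambda>u. poly_eval (lookup (\<phi> u)) (f b))" if "b \<in> B" for b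
      by (rule poly_fun_form_comp[OF \<phi>_poly_fun f[OF that]])
  qed
  then obtain c where "(\<exists>b\<in>B. c b \<noteq> 0) \<and> (\<forall>u. (\<forall>v. v \<notin> W \<longrightarrow> u v = 0) \<longrightarrow>
      (\<Sum>b\<in>B. c b * poly_eval (lookup (\<phi> u)) (f b)) = 0)" ..
  then have c: "\<exists>b\<in>B. c b \<noteq> 0"
    and sum0: "\<And>u. (\<forall>v. v \<notin> W \<longrightarrow> u v = 0) \<Longrightarrow> (\<Sum>b\<in>B. c b * poly_eval (lookup (\<phi> u)) (f b)) = 0"
    by simp_all
  define B' where "B' = {b \<in> B. c b \<noteq> 0}"
  define H where "H = (\<Sum>b\<in>B'. Poly_Mapping.single 0 (c b) * form_var \<gamma> ^ w b * (\<Prod>i<l. F i ^ b i))"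
  have H_eval: "poly_eval x H = (\<Sum>b\<in>B. c b * poly_eval x (f b))" for x
  proof -
    have "poly_eval x H = (\<Sum>b\<in>B'. c b * poly_eval x (f b))"
      by (simp add: H_def f_def poly_eval_sum poly_eval_mult mult.assoc)
    also have "\<dots> = (\<Sum>b\<in>B. c b * poly_eval x (f b))"
      using B(1) by (intro sum.mono_neutral_left) (auto simp: B'_def)
    finally show ?thesis .
  qed
  have H_form: "H \<in> hforms n m (A * N)"
    unfolding H_def
  proof (rule hforms_sum)
    fix b assume "b \<in> B'"
    then show "Poly_Mapping.single 0 (c b) * form_var \<gamma> ^ w b * (\<Prod>i<l. F i ^ b i) \<in> hforms n m (A * N)"
      using hforms_mult[OF hforms_const f, of b "c b"] by (simp add: f_def B'_def mult.assoc)
  qed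
  have "image_closure UNIV \<subseteq> zero_locus n m {H}"
  proof (rule dense[OF hforms_imp_forms[OF H_form]])
    fix u :: "'v \<Rightarrow> complex" assume "\<forall>v. v \<notin> W \<longrightarrow> u v = 0"
    then show "poly_eval (lookup (\<phi> u)) H = 0" unfolding H_eval by (rule sum0)
  qed
  then have "Z l \<subseteq> zero_locus n m {H}"
    using Z(1)[of l] by blast
  moreover have "\<not> Z l \<subseteq> zero_locus n m {H}"
    unfolding H_def
  proof (rule chain_forms_independent[where Z = Z and l = l and F = F and a = a and w = w and M = "A * N"])
    show "finite B'" "B' \<noteq> {}" using B(1) c by (auto simp: B'_def)
    show "c b \<noteq> 0" if "b \<in> B'" for b using that by (simp add: B'_def)
    show "w b + (\<Sum>i<l. a i * b i) = A * N" if "b \<in> B'" for b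
      using w that by (simp add: B'_def)
    show "irreducible_in (zariski n m) (Z i)" if "i \<le> l" for i using Z(1)[OF that] by simp
    show "Z i \<subseteq> Z (Suc i)" if "i < l" for i using Z(2)[OF that] by blast
    show "inj_on (\<lambda>b. restrict b {..<l}) B'"
    proof (rule inj_onI)
      fix b b' assume b: "b \<in> B'" "b' \<in> B'" "restrict b {..<l} = restrict b' {..<l}"
      have "restrict x {..<l} = x" if "x \<in> B'" for x
        by (rule PiE_restrict[where B = "\<lambda>_. {..N}"]) (use that in \<open>simp add: B'_def B_def\<close>)
      note r = this
      show "b = b'" using r[OF b(1), symmetric] b(3) r[OF b(2)] by (rule trans[OF trans])
    qed
    show "F i \<in> hforms n m (a i)" "Z i \<subseteq> zero_locus n m {F i}" "\<not> Z (Suc i) \<subseteq> zero_locus n m {F i}"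
      if "i < l" for i using F[OF that] by simp_all
    show "\<gamma> \<in> monoms n 0 m" "\<not> Z 0 \<subseteq> zero_locus n m {form_var \<gamma>}" by (fact \<gamma>_mon \<gamma>_van)+
  qed
  ultimately show False by contradiction
qed

text \<open>By \<open>coord\<close>, each coordinate in \<open>W\<close> is a quotient of two forms
  of equal degree in \<open>\<phi> u\<close>, with denominator nonzero at \<open>p\<close>; such
  quotients tell apart the closures belonging to successive members of a flag through
  \<open>p\<close>.\<close>

lemma coordinate_chain:
  assumes W: "finite W"
    and p: "\<And>v. v \<notin> W \<Longrightarrow> p v = 0"
    and coord: "\<And>v. v \<in> W \<Longrightarrow> \<exists>k. \<exists>F\<in>hforms n m k. \<exists>G\<in>hforms n m k. poly_eval (lookup (\<phi> p)) G \<noteq> 0 \<and>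
      (\<forall>u. (\<forall>v. v \<notin> W \<longrightarrow> u v = 0) \<longrightarrow>
        poly_eval (lookup (\<phi> u)) F = poly_eval (lookup (\<phi> u)) G * u v)"
  shows "\<exists>Y. (\<forall>i\<le>card W. closedin (zariski n m) (Y i) \<and> irreducible_in (zariski n m) (Y i)
      \<and> Y i \<subseteq> image_closure UNIV) \<and> (\<forall>i<card W. Y i \<subset> Y (Suc i))"
proof -
  obtain h where h: "bij_betw h {..<card W} W"
    using ex_bij_betw_nat_finite[OF W] by (auto simp: atLeast0LessThan)
  \<comment> \<open>The affine subspace through \<open>p\<close> in which the first \<open>i\<close>
    coordinates of \<open>W\<close> are free; \<open>L 0\<close> is the point
    \<open>p\<close>.\<close>
  define L where "L i = {u. \<forall>v. v \<notin> h ` {..<i} \<longrightarrow> u v = p v}" for i :: nat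
  define Y where "Y i = image_closure (L i)" for i
  have L_off: "u v = 0" if "u \<in> L i" "i \<le> card W" "v \<notin> W" for u v i
  proof -
    have "h ` {..<i} \<subseteq> W" using h that(2) by (auto simp: bij_betw_def)
    then have "v \<notin> h ` {..<i}" using that(3) by blast
    then show ?thesis using that p by (simp add: L_def)
  qed
  have irr: "irreducible_in (zariski n m) (Y i)" for i
    unfolding Y_def
  proof (rule irreducible_image_closure)
    show "L i \<noteq> {}" by (auto simp: L_def)
  qed (auto simp: L_def)
  have "Y i \<subset> Y (Suc i)" if i: "i < card W" for i
  proof -
    define v where "v = h i"
    have v: "v \<in> W" using h i by (auto simp: v_def bij_betw_def)
    have v_new: "v \<notin> h ` {..<i}"
      using h i inj_onD[of h "{..<card W}" i] by (force simp: v_def bij_betw_def)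
    obtain k F G where FG: "F \<in> hforms n m k" "G \<in> hforms n m k" "poly_eval (lookup (\<phi> p)) G \<noteq> 0"
      and eq: "\<And>u. (\<forall>v. v \<notin> W \<longrightarrow> u v = 0) \<Longrightarrow>
        poly_eval (lookup (\<phi> u)) F = poly_eval (lookup (\<phi> u)) G * u v"
      using coord[OF v] by blast
    \<comment> \<open>Since \<open>F\<close> equals \<open>G\<close> times the coordinate
      \<open>v\<close>, this form equals \<open>G\<close> times \<open>u v - p v\<close>: it
      vanishes while the coordinate is frozen at \<open>p v\<close>, and not identically once it is
      free.\<close>
    define H where "H = F - Poly_Mapping.single 0 (p v) * G"
    have "H \<in> hforms n m k"
      unfolding H_def using hforms_mult[OF hforms_const FG(2)] by (intro hforms_diff FG(1)) simp
    then have H: "H \<in> forms n m" by (rule hforms_imp_forms)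
    have H_eval: "poly_eval (lookup (\<phi> u)) H = poly_eval (lookup (\<phi> u)) G * (u v - p v)"
      if "\<forall>v. v \<notin> W \<longrightarrow> u v = 0" for u
      using eq[OF that] by (simp add: H_def poly_eval_diff poly_eval_mult algebra_simps)
    have "Y i \<subseteq> zero_locus n m {H}"
      unfolding Y_def image_closure_subset_zero_locus_iff[OF H]
    proof
      fix u assume u: "u \<in> L i"
      then have "u v = p v" using v_new by (simp add: L_def)
      then show "poly_eval (lookup (\<phi> u)) H = 0"
        using H_eval L_off[OF u] i by simp
    qed
    moreover have "\<not> Y (Suc i) \<subseteq> zero_locus n m {H}"
    proof -
      define e where "e x = (if x = v then 1 else 0 :: complex)" for x
      obtain q where q: "\<forall>t. poly_eval (lookup (\<phi> (\<lambda>x. p x + t * e x))) G = poly q t"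
        using form_on_line[OF hforms_imp_forms[OF FG(2)], of p e] ..
      have "q \<noteq> 0" using q[THEN spec, of 0] FG(3) by auto
      \<comment> \<open>The factor \<open>[:0, 1:]\<close> forces \<open>t\<close> to be nonzero, so
        one choice of \<open>t\<close> both moves the coordinate \<open>v\<close> and keeps
        \<open>G\<close> nonzero.\<close>
      then have "q * [:0, 1:] \<noteq> 0" by simp
      then obtain t where "poly (q * [:0, 1:]) t \<noteq> 0"
        by (rule nonzero_poly_nonroot)
      then have t: "poly q t \<noteq> 0" "t \<noteq> 0" by auto
      define u where "u = (\<lambda>x. p x + t * e x)"
      have u: "u \<in> L (Suc i)"
        by (auto simp: L_def u_def e_def v_def lessThan_Suc)
      have "u v - p v = t" by (simp add: u_def e_def)
      then have "poly_eval (lookup (\<phi> u)) H \<noteq> 0"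
        using H_eval[of u] L_off[OF u] i q[THEN spec, of t] t by (simp add: u_def)
      then show ?thesis
        unfolding Y_def image_closure_subset_zero_locus_iff[OF H] using u by blast
    qed
    moreover have "Y i \<subseteq> Y (Suc i)"
      unfolding Y_def by (rule image_closure_mono) (auto simp: L_def lessThan_Suc)
    ultimately show ?thesis by blast
  qed
  moreover have "closedin (zariski n m) (Y i) \<and> irreducible_in (zariski n m) (Y i) \<and> Y i \<subseteq> image_closure UNIV" for i
    using irr closedin_image_closure image_closure_mono[of "L i" UNIV] by (simp add: Y_def)
  ultimately show ?thesis by (intro exI[of _ Y]) simp
qed

end

section \<open>The parametrization of the Taylor variety\<close>

text \<open>The normalization is built in, so that the remaining coefficients range over a full
  affine space instead of a slice of one.\<close>

definition unit_poly :: "nat \<Rightarrow> nat \<Rightarrow> (expo \<Rightarrow> complex) \<Rightarrow> (expo \<Rightarrow>\<^sub>0 complex)"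
  where "unit_poly n d u = 1 + (\<Sum>\<gamma>\<in>monoms n 1 d. Poly_Mapping.single \<gamma> (u \<gamma>))"

lemma monoms_0_eq: "monoms n 0 d = insert 0 (monoms n 1 d)"
proof (rule Set.set_eqI)
  fix \<gamma> :: expo
  show "\<gamma> \<in> monoms n 0 d \<longleftrightarrow> \<gamma> \<in> insert 0 (monoms n 1 d)"
  proof (cases "\<gamma> = 0")
    case True
    then show ?thesis by (simp add: monoms_def mdeg_def)
  next
    case False
    then have "1 \<le> mdeg \<gamma>" using mdeg_eq_0_iff[of \<gamma>] by linarith
    then show ?thesis using False by (auto simp: monoms_def)
  qed
qed

lemma zero_not_in_monoms_1 [simp]: "0 \<notin> monoms n (Suc 0) d"
  by (simp add: monoms_def mdeg_def)

lemma lookup_unit_poly: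
  "lookup (unit_poly n d u) \<gamma> = (if \<gamma> = 0 then 1 else if \<gamma> \<in> monoms n 1 d then u \<gamma> else 0)"
  by (auto simp: unit_poly_def lookup_add lookup_sum lookup_one lookup_single when_def)

lemma unit_poly_in_polys: "unit_poly n d u \<in> polys n d"
  unfolding mem_polys_iff monoms_0_eq by (auto simp: lookup_unit_poly)

lemma unit_poly_of_poly:
  assumes "P \<in> polys n d" "lookup P 0 = 1"
  shows "P = unit_poly n d (lookup P)"
proof (rule poly_mapping_eqI)
  fix \<gamma>
  show "lookup P \<gamma> = lookup (unit_poly n d (lookup P)) \<gamma>"
    using assms unfolding mem_polys_iff monoms_0_eq by (auto simp: lookup_unit_poly)
qed

definition truncate :: "nat \<Rightarrow> nat \<Rightarrow> (expo \<Rightarrow>\<^sub>0 complex) \<Rightarrow> (expo \<Rightarrow>\<^sub>0 complex)"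
  where "truncate n m F = (\<Sum>\<gamma>\<in>monoms n 0 m. Poly_Mapping.single \<gamma> (lookup F \<gamma>))"

lemma lookup_truncate:
  "lookup (truncate n m F) \<gamma> = (if \<gamma> \<in> monoms n 0 m then lookup F \<gamma> else 0)"
  by (auto simp: truncate_def lookup_sum lookup_single when_def)

text \<open>The inverse of the denominator \<open>Q\<close> is the geometric series in
  \<open>1 - Q\<close>, cut off at \<open>m\<close> because \<open>1 - Q\<close> has order at least
  1. No division occurs, so the coefficients are polynomials in the parameters: \<open>Inl\<close>
  indexes those of the numerator, \<open>Inr\<close> those of the denominator.\<close>

definition expansion :: "nat \<Rightarrow> nat \<Rightarrow> nat \<Rightarrow> nat \<Rightarrow> (expo + expo \<Rightarrow> complex) \<Rightarrow> (expo \<Rightarrow>\<^sub>0 complex)"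
  where "expansion n d e m u = truncate n m
    (unit_poly n d (u \<circ> Inl) * (\<Sum>j\<le>m. (1 - unit_poly n e (u \<circ> Inr)) ^ j))"

text \<open>\<open>truncate n m\<close> also drops monomials in variables beyond the first
  \<open>n\<close>; this predicate ensures that there are none to lose.\<close>

definition in_vars :: "nat \<Rightarrow> (expo \<Rightarrow>\<^sub>0 complex) \<Rightarrow> bool"
  where "in_vars n F \<longleftrightarrow> (\<forall>\<mu>. \<not> keys \<mu> \<subseteq> {..<n} \<longrightarrow> lookup F \<mu> = 0)"

lemma in_vars_mult:
  assumes "in_vars n F" "in_vars n G"
  shows "in_vars n (F * G)"
  unfolding in_vars_def
proof (intro allI impI, rule ccontr)
  fix \<mu> assume \<mu>: "\<not> keys \<mu> \<subseteq> {..<n}" "lookup (F * G) \<mu> \<noteq> 0"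
  then have "\<mu> \<in> keys (F * G)" by (simp add: in_keys_iff)
  then obtain a b where ab: "\<mu> = a + b" "a \<in> keys F" "b \<in> keys G"
    using keys_mult[of F G] by blast
  then have "keys a \<subseteq> {..<n}" "keys b \<subseteq> {..<n}"
    using assms unfolding in_vars_def in_keys_iff by blast+
  then show False
    using \<mu>(1) Poly_Mapping.keys_add[of a b] unfolding ab(1) by blast
qed

lemma in_vars_diff: "in_vars n F \<Longrightarrow> in_vars n G \<Longrightarrow> in_vars n (F - G)"
  by (simp add: in_vars_def lookup_minus)

lemma in_vars_add: "in_vars n F \<Longrightarrow> in_vars n G \<Longrightarrow> in_vars n (F + G)"
  by (simp add: in_vars_def lookup_add)

lemma in_vars_0: "in_vars n 0"
  by (simp add: in_vars_def)

lemma in_vars_1: "in_vars n 1"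
  by (auto simp: in_vars_def lookup_one when_def)

lemma in_vars_power: "in_vars n F \<Longrightarrow> in_vars n (F ^ k)"
  by (induction k) (auto intro: in_vars_1 in_vars_mult)

lemma in_vars_sum: "(\<And>i. i \<in> I \<Longrightarrow> in_vars n (F i)) \<Longrightarrow> in_vars n (\<Sum>i\<in>I. F i)"
  by (induction I rule: infinite_finite_induct) (simp_all add: in_vars_add in_vars_0)

lemma in_vars_polys: "P \<in> polys n d \<Longrightarrow> in_vars n P"
  by (simp add: in_vars_def mem_polys_iff monoms_def)

lemma ord_ge_truncate:
  assumes "in_vars n F"
  shows "ord_ge (Suc m) (F - truncate n m F)"
  unfolding ord_ge_def
proof (intro allI impI)
  fix \<mu> :: expo assume \<mu>: "mdeg \<mu> < Suc m"
  show "lookup (F - truncate n m F) \<mu> = 0"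
  proof (cases "keys \<mu> \<subseteq> {..<n}")
    case True
    then show ?thesis using \<mu> by (simp add: lookup_minus lookup_truncate monoms_def)
  next
    case False
    then show ?thesis using assms by (simp add: lookup_minus lookup_truncate monoms_def in_vars_def)
  qed
qed

lemma eq_if_ord_ge:
  assumes "T \<in> polys n m" "T' \<in> polys n m" "ord_ge (Suc m) (T - T')"
  shows "T = T'"
proof (rule poly_mapping_eqI)
  fix \<gamma>
  show "lookup T \<gamma> = lookup T' \<gamma>"
  proof (cases "\<gamma> \<in> monoms n 0 m")
    case True
    then show ?thesis using assms(3) by (simp add: ord_ge_def monoms_def lookup_minus)
  qed (use assms(1,2) in \<open>simp add: mem_polys_iff\<close>)
qed

lemma expansion_in_polys: "expansion n d e m u \<in> polys n m"
  unfolding expansion_def mem_polys_iff by (simp add: lookup_truncate)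

text \<open>The residual splits into the tail \<open>P * (1 - Q) ^ Suc m\<close> of the geometric
  series and \<open>Q\<close> times the part cut off by truncation; both have order above
  \<open>m\<close>.\<close>

lemma expansion_quotient:
  "ord_ge (Suc m) (unit_poly n d (u \<circ> Inl) - unit_poly n e (u \<circ> Inr) * expansion n d e m u)"
proof -
  define P where "P = unit_poly n d (u \<circ> Inl)"
  define Q where "Q = unit_poly n e (u \<circ> Inr)"
  define S where "S = (\<Sum>j\<le>m. (1 - Q) ^ j)"
  have vars: "in_vars n P" "in_vars n Q"
    unfolding P_def Q_def by (rule in_vars_polys[OF unit_poly_in_polys])+
  have "in_vars n (P * S)"
    unfolding S_def
    by (intro in_vars_mult vars in_vars_sum in_vars_power in_vars_diff in_vars_1)
  then have "ord_ge (Suc m) (Q * (P * S - truncate n m (P * S)))"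
    by (intro ord_ge_mult_left ord_ge_truncate)
  moreover have "ord_ge 1 (1 - Q)"
    by (simp add: ord_ge_1_iff lookup_minus Q_def lookup_unit_poly)
  then have "ord_ge (Suc m) (P * (1 - Q) ^ Suc m)"
    by (intro ord_ge_mult_left ord_ge_power)
  moreover have "P - Q * truncate n m (P * S) = P * (1 - Q) ^ Suc m + Q * (P * S - truncate n m (P * S))"
  proof -
    have "1 - (1 - Q) ^ Suc m = Q * S"
      using one_diff_power_eq[of "1 - Q" "Suc m"] by (simp only: S_def lessThan_Suc_atMost) simp
    then have "P * (1 - (1 - Q) ^ Suc m) = P * (Q * S)" by (rule arg_cong)
    then have "P = P * (1 - Q) ^ Suc m + P * (Q * S)"
      by (simp only: right_diff_distrib mult_1_right diff_eq_eq add.commute)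
    then have "P - Q * R = P * (1 - Q) ^ Suc m + P * (Q * S) - Q * R" for R
      by (rule arg_cong)
    then show ?thesis
      by (simp only: right_diff_distrib mult.left_commute[of P Q] add_diff_eq)
  qed
  ultimately show ?thesis
    unfolding expansion_def P_def[symmetric] Q_def[symmetric] S_def[symmetric]
    by (simp add: ord_ge_add)
qed

text \<open>Both polynomials satisfy the same congruence and the denominator cancels as a unit;
  representatives of degree at most \<open>m\<close> then coincide.\<close>

lemma expansion_unique:
  assumes "T \<in> polys n m"
    and "ord_ge (Suc m) (unit_poly n d (u \<circ> Inl) - unit_poly n e (u \<circ> Inr) * T)"
  shows "T = expansion n d e m u"
proof (rule eq_if_ord_ge[OF assms(1) expansion_in_polys])
  let ?Q = "unit_poly n e (u \<circ> Inr)"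
  have "ord_ge (Suc m) (?Q * (T - expansion n d e m u))"
    using ord_ge_diff[OF expansion_quotient[of m n d u e] assms(2)] by (simp add: algebra_simps)
  then show "ord_ge (Suc m) (T - expansion n d e m u)"
    by (rule ord_ge_cancel) (simp add: lookup_unit_poly)
qed

lemma lookup_expansion_0: "lookup (expansion n d e m u) 0 = 1"
proof -
  have "ord_ge (Suc 0) (unit_poly n d (u \<circ> Inl) - unit_poly n e (u \<circ> Inr) * expansion n d e m u)"
    by (rule ord_ge_mono[OF expansion_quotient]) simp
  then have "poly_eval (\<lambda>_. 0) (unit_poly n d (u \<circ> Inl) - unit_poly n e (u \<circ> Inr) * expansion n d e m u) = 0"
    by (simp only: ord_ge_1_iff poly_eval_at_zero)
  then show ?thesis
    unfolding poly_eval_diff poly_eval_mult by (simp add: poly_eval_at_zero lookup_unit_poly)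
qed

text \<open>From here on derivatives disappear: the congruence characterizes Taylor polynomials, and
  \<open>expansion\<close> solves it.\<close>

lemma taylor_polys_eq_range: "taylor_polys n d e m = range (expansion n d e m)"
proof (intro equalityI subsetI)
  fix T assume "T \<in> taylor_polys n d e m"
  then obtain P Q where T: "T = taylor_poly n m (\<lambda>x. poly_eval x P / poly_eval x Q)"
    and PQ: "P \<in> polys n d" "Q \<in> polys n e" "lookup P 0 = 1" "lookup Q 0 = 1"
    unfolding taylor_polys_def poly_eval_at_zero by blast
  define u where "u = case_sum (lookup P) (lookup Q)"
  have u: "u \<circ> Inl = lookup P" "u \<circ> Inr = lookup Q"
    by (auto simp: u_def)
  have "P = unit_poly n d (u \<circ> Inl)" "Q = unit_poly n e (u \<circ> Inr)"
    unfolding u using PQ unit_poly_of_poly by blast+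
  then have "ord_ge (Suc m) (P - Q * expansion n d e m u)"
    using expansion_quotient[of m n d u e] by simp
  then have "T = expansion n d e m u"
    unfolding T by (rule taylor_poly_quotient[OF expansion_in_polys _ PQ(4)])
  then show "T \<in> range (expansion n d e m)" by simp
next
  fix T assume "T \<in> range (expansion n d e m)"
  then obtain u where T: "T = expansion n d e m u" by blast
  define P where "P = unit_poly n d (u \<circ> Inl)"
  define Q where "Q = unit_poly n e (u \<circ> Inr)"
  have "P \<in> polys n d" "Q \<in> polys n e"
    by (simp_all only: P_def Q_def unit_poly_in_polys)
  moreover have P0: "lookup P 0 = 1" and Q0: "lookup Q 0 = 1"
    by (simp_all add: P_def Q_def lookup_unit_poly)
  moreover have "taylor_poly n m (\<lambda>x. poly_eval x P / poly_eval x Q) = T"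
    unfolding T
    by (rule taylor_poly_quotient[OF expansion_in_polys _ Q0]) (simp only: P_def Q_def expansion_quotient)
  ultimately show "T \<in> taylor_polys n d e m"
    unfolding taylor_polys_def poly_eval_at_zero by blast
qed

subsection \<open>Polynomial dependence on the parameters\<close>

text \<open>The support bound is uniform in \<open>u\<close>, which makes each coefficient of a
  product a sum over an index set independent of the parameters.\<close>

definition poly_family :: "nat \<Rightarrow> (('v \<Rightarrow> complex) \<Rightarrow> (expo \<Rightarrow>\<^sub>0 complex)) \<Rightarrow> bool"
  where "poly_family D F \<longleftrightarrow>
    (\<exists>A. finite A \<and> (\<forall>u. keys (F u) \<subseteq> A)) \<and> (\<forall>\<gamma>. poly_fun D (\<lambda>u. lookup (F u) \<gamma>))"

lemma poly_family_mono: "poly_family D F \<Longrightarrow> D \<le> E \<Longrightarrow> poly_family E F"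
  unfolding poly_family_def using poly_fun_mono by blast

lemma poly_family_const: "poly_family D (\<lambda>_. F)"
  unfolding poly_family_def by (auto intro: poly_fun_const exI[of _ "keys F"])

lemma poly_family_add:
  assumes "poly_family D F" "poly_family D G"
  shows "poly_family D (\<lambda>u. F u + G u)"
proof -
  obtain A B where "finite A" "\<forall>u. keys (F u) \<subseteq> A" "finite B" "\<forall>u. keys (G u) \<subseteq> B"
    using assms unfolding poly_family_def by blast
  moreover from this have "keys (F u + G u) \<subseteq> A \<union> B" for u
    using Poly_Mapping.keys_add[of "F u" "G u"] by blast
  ultimately have "\<exists>A. finite A \<and> (\<forall>u. keys (F u + G u) \<subseteq> A)"
    by (intro exI[of _ "A \<union> B"]) simp
  moreover have "\<forall>\<gamma>. poly_fun D (\<lambda>u. lookup (F u + G u) \<gamma>)"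
    using assms by (simp add: poly_family_def lookup_add poly_fun_add)
  ultimately show ?thesis by (simp add: poly_family_def)
qed

lemma poly_family_mult:
  assumes "poly_family D F" "poly_family E G"
  shows "poly_family (D + E) (\<lambda>u. F u * G u)"
proof -
  obtain A B where A: "finite A" "\<And>u. keys (F u) \<subseteq> A" and B: "finite B" "\<And>u. keys (G u) \<subseteq> B"
    using assms unfolding poly_family_def by blast
  have "keys (F u * G u) \<subseteq> (\<lambda>(a, b). a + b) ` (A \<times> B)" for u
  proof
    fix x assume "x \<in> keys (F u * G u)"
    then obtain a b where "x = a + b" "a \<in> keys (F u)" "b \<in> keys (G u)"
      using keys_mult[of "F u" "G u"] by blast
    then show "x \<in> (\<lambda>(a, b). a + b) ` (A \<times> B)"
      using A(2)[of u] B(2)[of u] by (intro image_eqI[of _ _ "(a, b)"]) auto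
  qed
  then have "\<exists>C. finite C \<and> (\<forall>u. keys (F u * G u) \<subseteq> C)"
    using A(1) B(1) by (intro exI[of _ "(\<lambda>(a, b). a + b) ` (A \<times> B)"]) simp
  moreover have "poly_fun (D + E) (\<lambda>u. lookup (F u * G u) \<gamma>)" for \<gamma>
  proof -
    have "poly_fun E (\<lambda>u. pade_entry (G u) \<gamma> \<beta>)" for \<beta>
    proof (cases "\<forall>i. lookup \<beta> i \<le> lookup \<gamma> i")
      case True
      then show ?thesis using assms(2) by (simp add: pade_entry_def poly_family_def)
    next
      case False
      then show ?thesis by (simp only: pade_entry_def if_False poly_fun_const)
    qed
    then show ?thesis
      unfolding lookup_mult_pade_superset[OF A]
      using assms(1) by (intro poly_fun_sum poly_fun_mult) (simp_all add: poly_family_def)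
  qed
  ultimately show ?thesis by (simp add: poly_family_def)
qed

lemma poly_family_diff:
  assumes "poly_family D F" "poly_family D G"
  shows "poly_family D (\<lambda>u. F u - G u)"
proof -
  have "poly_family D (\<lambda>u. F u + (- 1) * G u)"
    using poly_family_mult[OF poly_family_const[of 0 "- 1"] assms(2)] assms(1)
    by (intro poly_family_add) simp_all
  then show ?thesis by simp
qed

lemma poly_family_power: "poly_family D F \<Longrightarrow> poly_family (D * k) (\<lambda>u. F u ^ k)"
  by (induction k) (auto intro: poly_family_const dest: poly_family_mult)

lemma poly_family_sum:
  "(\<And>i. i \<in> I \<Longrightarrow> poly_family D (F i)) \<Longrightarrow> poly_family D (\<lambda>u. \<Sum>i\<in>I. F i u)"
  by (induction I rule: infinite_finite_induct) (auto intro: poly_family_const poly_family_add)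

lemma poly_family_unit_poly: "poly_family 1 (\<lambda>u. unit_poly n d (\<lambda>\<gamma>. u (f \<gamma>)))"
  unfolding poly_family_def
proof (intro conjI allI)
  show "\<exists>A. finite A \<and> (\<forall>u. keys (unit_poly n d (\<lambda>\<gamma>. u (f \<gamma>))) \<subseteq> A)"
    using unit_poly_in_polys by (intro exI[of _ "monoms n 0 d"]) (auto simp: polys_def)
  show "poly_fun 1 (\<lambda>u. lookup (unit_poly n d (\<lambda>\<gamma>. u (f \<gamma>))) \<gamma>)" for \<gamma>
    unfolding lookup_unit_poly
    by (cases "\<gamma> = 0"; cases "\<gamma> \<in> monoms n 1 d") (simp_all add: poly_fun_const poly_fun_var[simplified])
qed

text \<open>The degree is 1 from the numerator plus at most \<open>m\<close> from the powers of
  \<open>1 - Q\<close>.\<close>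

lemma poly_fun_expansion: "poly_fun (1 + m) (\<lambda>u. lookup (expansion n d e m u) \<gamma>)"
proof -
  have "poly_family (1 * j) (\<lambda>u. (1 - unit_poly n e (u \<circ> Inr)) ^ j)" for j and Inr :: "expo \<Rightarrow> expo + expo"
    unfolding comp_def
    by (intro poly_family_power poly_family_diff poly_family_const poly_family_unit_poly)
  then have "poly_family m (\<lambda>u. (1 - unit_poly n e (u \<circ> Inr)) ^ j)" if "j \<le> m" for j and Inr :: "expo \<Rightarrow> expo + expo"
    by (rule poly_family_mono) (use that in simp)
  then have "poly_family (1 + m) (\<lambda>u. unit_poly n d (u \<circ> Inl) * (\<Sum>j\<le>m. (1 - unit_poly n e (u \<circ> Inr)) ^ j))"
    using poly_family_unit_poly[of n d Inl] by (intro poly_family_mult poly_family_sum) (auto simp: comp_def)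
  then show ?thesis
    unfolding expansion_def lookup_truncate
    by (cases "\<gamma> \<in> monoms n 0 m") (simp_all add: poly_family_def poly_fun_const)
qed

interpretation expansion: polynomial_family n m "1 + m" "expansion n d e m" for n d e m
  by unfold_locales (rule expansion_in_polys lookup_expansion_0 poly_fun_expansion)+

subsection \<open>The linear equations of the fibres\<close>

lemma pade_entry_0_right [simp]: "pade_entry T \<alpha> 0 = lookup T \<alpha>"
  by (simp add: pade_entry_def)

lemma lookup_unit_poly_mult:
  "lookup (unit_poly n e q * T) \<alpha> = lookup T \<alpha> + (\<Sum>\<beta>\<in>monoms n 1 e. q \<beta> * pade_entry T \<alpha> \<beta>)"
proof -
  have "lookup (unit_poly n e q * T) \<alpha> =
      (\<Sum>\<beta>\<in>insert 0 (monoms n 1 e). lookup (unit_poly n e q) \<beta> * pade_entry T \<alpha> \<beta>)"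
    using unit_poly_in_polys[of n e q]
    by (intro lookup_mult_pade_superset) (simp_all add: polys_def monoms_0_eq)
  also have "\<dots> = lookup T \<alpha> + (\<Sum>\<beta>\<in>monoms n 1 e. lookup (unit_poly n e q) \<beta> * pade_entry T \<alpha> \<beta>)"
    by (simp add: lookup_unit_poly)
  also have "(\<Sum>\<beta>\<in>monoms n 1 e. lookup (unit_poly n e q) \<beta> * pade_entry T \<alpha> \<beta>) =
      (\<Sum>\<beta>\<in>monoms n 1 e. q \<beta> * pade_entry T \<alpha> \<beta>)"
    by (rule sum.cong) (auto simp: lookup_unit_poly)
  finally show ?thesis .
qed

text \<open>For fixed \<open>T\<close> the congruence is a linear system in the parameters, one
  equation per row. Rows of degree 1 to \<open>d\<close> define the numerator; rows of higher degree
  form the reduced Pade system with right-hand side \<open>- lookup T \<alpha>\<close>.\<close>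

lemma eq_expansion_iff:
  assumes T: "T \<in> polys n m"
  shows "T = expansion n d e m u \<longleftrightarrow> (\<forall>\<alpha>\<in>monoms n 0 m.
    lookup T \<alpha> + (\<Sum>\<beta>\<in>monoms n 1 e. u (Inr \<beta>) * pade_entry T \<alpha> \<beta>) =
      (if \<alpha> = 0 then 1 else if \<alpha> \<in> monoms n 1 d then u (Inl \<alpha>) else 0))"
    (is "_ \<longleftrightarrow> (\<forall>\<alpha>\<in>_. ?E \<alpha>)")
proof -
  let ?R = "unit_poly n d (u \<circ> Inl) - unit_poly n e (u \<circ> Inr) * T"
  have E: "?E \<alpha> \<longleftrightarrow> lookup ?R \<alpha> = 0" for \<alpha>
    by (auto simp: lookup_minus lookup_unit_poly_mult lookup_unit_poly)
  have "in_vars n ?R"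
    by (intro in_vars_diff in_vars_mult in_vars_polys[OF unit_poly_in_polys] in_vars_polys[OF T])
  then have "lookup ?R \<mu> = 0" if "\<not> keys \<mu> \<subseteq> {..<n}" for \<mu>
    using that by (simp add: in_vars_def)
  note off = this
  have "ord_ge (Suc m) ?R \<longleftrightarrow> (\<forall>\<alpha>\<in>monoms n 0 m. lookup ?R \<alpha> = 0)"
  proof
    assume R: "\<forall>\<alpha>\<in>monoms n 0 m. lookup ?R \<alpha> = 0"
    show "ord_ge (Suc m) ?R"
      unfolding ord_ge_def
    proof (intro allI impI)
      fix \<mu> :: expo assume "mdeg \<mu> < Suc m"
      then show "lookup ?R \<mu> = 0"
        using R off[of \<mu>] by (cases "keys \<mu> \<subseteq> {..<n}") (auto simp: monoms_def)
    qed
  qed (simp add: ord_ge_def monoms_def)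
  moreover have "T = expansion n d e m u \<longleftrightarrow> ord_ge (Suc m) ?R"
    using expansion_unique[OF T, of d u e] expansion_quotient[of m n d u e] by blast
  ultimately show ?thesis unfolding E by blast
qed

definition pade_form :: "expo \<Rightarrow> expo \<Rightarrow> (expo \<Rightarrow>\<^sub>0 nat) \<Rightarrow>\<^sub>0 complex"
  where "pade_form \<alpha> \<beta> = (if \<forall>i. lookup \<beta> i \<le> lookup \<alpha> i then form_var (\<alpha> - \<beta>) else 0)"

lemma poly_eval_pade_form [simp]: "poly_eval (lookup T) (pade_form \<alpha> \<beta>) = pade_entry T \<alpha> \<beta>"
  by (simp add: pade_form_def pade_entry_def)

lemma hforms_pade_form:
  assumes "\<alpha> \<in> monoms n 0 m"
  shows "pade_form \<alpha> \<beta> \<in> hforms n m 1"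
proof (cases "\<forall>i. lookup \<beta> i \<le> lookup \<alpha> i")
  case True
  then have "\<beta> + (\<alpha> - \<beta>) = \<alpha>"
    by (simp add: poly_mapping_eq_iff fun_eq_iff lookup_add lookup_minus)
  then have "mdeg (\<alpha> - \<beta>) \<le> mdeg \<alpha>"
    using mdeg_add[of \<beta> "\<alpha> - \<beta>"] by simp
  moreover have "keys (\<alpha> - \<beta>) \<subseteq> keys \<alpha>"
    by (auto simp: in_keys_iff lookup_minus)
  ultimately have "\<alpha> - \<beta> \<in> monoms n 0 m"
    using assms by (auto simp: monoms_def)
  then show ?thesis unfolding pade_form_def if_P[OF True] by (rule hforms_var)
next
  case False
  show ?thesis unfolding pade_form_def if_not_P[OF False] by (rule hforms_0)
qed

section \<open>The dimension of the Taylor variety\<close>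

text \<open>Where the columns in \<open>J\<close> span all columns, the denominator can be traded
  for one supported on \<open>J\<close> that gives the same combination of columns in the Pade rows;
  the rows of low degree are then restored by changing the numerator.\<close>

lemma expansion_restricted_support:
  assumes J: "J \<subseteq> monoms n 1 e"
    and span: "\<And>\<beta>. \<beta> \<in> monoms n 1 e \<Longrightarrow> \<exists>q. \<forall>\<alpha>\<in>monoms n (d + 1) m.
      pade_entry (expansion n d e m u) \<alpha> \<beta> = (\<Sum>j\<in>J. q j * pade_entry (expansion n d e m u) \<alpha> j)"
  shows "\<exists>u'. (\<forall>v. v \<notin> Inl ` monoms n 1 d \<union> Inr ` J \<longrightarrow> u' v = 0) \<and>
    expansion n d e m u = expansion n d e m u'"
proof -
  define T where "T = expansion n d e m u"
  have T: "T \<in> polys n m" unfolding T_def by (rule expansion_in_polys)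
  have fin: "finite J" using J finite_monoms finite_subset by blast
  have "\<forall>\<beta>\<in>monoms n 1 e. \<exists>q. \<forall>\<alpha>\<in>monoms n (d + 1) m.
      pade_entry T \<alpha> \<beta> = (\<Sum>j\<in>J. q j * pade_entry T \<alpha> j)"
    unfolding T_def using span by (rule ballI)
  from bchoice[OF this] obtain q where q: "\<forall>\<beta>\<in>monoms n 1 e. \<forall>\<alpha>\<in>monoms n (d + 1) m.
      pade_entry T \<alpha> \<beta> = (\<Sum>j\<in>J. q \<beta> j * pade_entry T \<alpha> j)" ..
  define b where "b j = (if j \<in> J then \<Sum>\<beta>\<in>monoms n 1 e. u (Inr \<beta>) * q \<beta> j else 0)" for j
  have sum_b: "(\<Sum>\<beta>\<in>monoms n 1 e. b \<beta> * pade_entry T \<alpha> \<beta>) = (\<Sum>j\<in>J. b j * pade_entry T \<alpha> j)" for \<alpha>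
    by (rule sum.mono_neutral_right) (use J in \<open>auto simp: b_def\<close>)
  have rows: "(\<Sum>\<beta>\<in>monoms n 1 e. b \<beta> * pade_entry T \<alpha> \<beta>) =
      (\<Sum>\<beta>\<in>monoms n 1 e. u (Inr \<beta>) * pade_entry T \<alpha> \<beta>)" if \<alpha>: "\<alpha> \<in> monoms n (d + 1) m" for \<alpha>
  proof -
    have "(\<Sum>\<beta>\<in>monoms n 1 e. u (Inr \<beta>) * pade_entry T \<alpha> \<beta>) =
        (\<Sum>\<beta>\<in>monoms n 1 e. \<Sum>j\<in>J. u (Inr \<beta>) * q \<beta> j * pade_entry T \<alpha> j)"
    proof (rule sum.cong[OF refl])
      fix \<beta> assume "\<beta> \<in> monoms n 1 e"
      then have eq: "pade_entry T \<alpha> \<beta> = (\<Sum>j\<in>J. q \<beta> j * pade_entry T \<alpha> j)"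
        using q \<alpha> by blast
      show "u (Inr \<beta>) * pade_entry T \<alpha> \<beta> = (\<Sum>j\<in>J. u (Inr \<beta>) * q \<beta> j * pade_entry T \<alpha> j)"
        unfolding eq by (simp add: sum_distrib_left mult.assoc)
    qed
    also have "\<dots> = (\<Sum>j\<in>J. b j * pade_entry T \<alpha> j)"
      by (subst sum.swap) (simp add: b_def sum_distrib_right)
    finally show ?thesis using sum_b by simp
  qed
  define u' where "u' = case_sum
    (\<lambda>\<alpha>. if \<alpha> \<in> monoms n 1 d then lookup T \<alpha> + (\<Sum>\<beta>\<in>monoms n 1 e. b \<beta> * pade_entry T \<alpha> \<beta>) else 0) b"
  have "T = expansion n d e m u'"
    unfolding eq_expansion_iff[OF T]
  proof
    fix \<alpha> assume \<alpha>: "\<alpha> \<in> monoms n 0 m"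
    \<comment> \<open>The constant row holds automatically, rows up to degree \<open>d\<close> hold
      by the choice of the numerator, and the remaining rows because the Pade combination is
      unchanged.\<close>
    consider "\<alpha> = 0" | "\<alpha> \<in> monoms n 1 d" | "\<alpha> \<noteq> 0" "\<alpha> \<notin> monoms n 1 d" "\<alpha> \<in> monoms n (d + 1) m"
      using \<alpha> monoms_0_eq[of n m] by (cases "mdeg \<alpha> \<le> d") (auto simp: monoms_def)
    then show "lookup T \<alpha> + (\<Sum>\<beta>\<in>monoms n 1 e. u' (Inr \<beta>) * pade_entry T \<alpha> \<beta>) =
      (if \<alpha> = 0 then 1 else if \<alpha> \<in> monoms n 1 d then u' (Inl \<alpha>) else 0)"
    proof cases
      case 1
      have "pade_entry T 0 \<beta> = 0" if "\<beta> \<in> monoms n 1 e" for \<beta>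
      proof -
        have "\<not> (\<forall>i. lookup \<beta> i \<le> lookup 0 i)"
        proof
          assume "\<forall>i. lookup \<beta> i \<le> lookup 0 i"
          then have "\<beta> = 0" by (intro poly_mapping_eqI) simp
          then show False using that by simp
        qed
        then show ?thesis by (simp only: pade_entry_def if_False)
      qed
      then show ?thesis using 1 lookup_expansion_0 by (simp add: T_def)
    next
      case 2
      then have "\<alpha> \<noteq> 0" using zero_not_in_monoms_1[of n d] by auto
      then show ?thesis using 2 by (simp add: u'_def)
    next
      case 3
      have "lookup T \<alpha> + (\<Sum>\<beta>\<in>monoms n 1 e. u (Inr \<beta>) * pade_entry T \<alpha> \<beta>) = 0"
        using eq_expansion_iff[OF T, of d e u] \<alpha> 3(1,2) by (simp add: T_def)
      then show ?thesis using 3 rows by (simp add: u'_def)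
    qed
  qed
  moreover have "u' v = 0" if "v \<notin> Inl ` monoms n 1 d \<union> Inr ` J" for v
    using that by (cases v) (auto simp: u'_def b_def)
  ultimately show ?thesis unfolding T_def by blast
qed

text \<open>Pairing the rows with the dual functionals solves the Pade system without division, as
  in Cramer's rule: \<delta> times a denominator coefficient is a form in \<open>T\<close>.
  Substituting this into the rows of low degree, multiplied by \<delta>, gives the numerator
  coefficients.\<close>

lemma coordinate_forms:
  assumes d: "d \<le> m" and J: "J \<subseteq> monoms n 1 e"
    and \<delta>: "\<delta> \<in> hforms n m (Suc k)"
    and w: "\<And>j i. j \<in> J \<Longrightarrow> i \<in> monoms n (d + 1) m \<Longrightarrow> w j i \<in> hforms n m k"
    and dual: "\<And>j j'. j \<in> J \<Longrightarrow> j' \<in> J \<Longrightarrow>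
      (\<Sum>i\<in>monoms n (d + 1) m. w j i * pade_form i j') = (if j = j' then \<delta> else 0)"
    and v: "v \<in> Inl ` monoms n 1 d \<union> Inr ` J"
    and nz: "poly_eval (lookup (expansion n d e m p)) \<delta> \<noteq> 0"
  shows "\<exists>k. \<exists>F\<in>hforms n m k. \<exists>G\<in>hforms n m k.
    poly_eval (lookup (expansion n d e m p)) G \<noteq> 0 \<and>
    (\<forall>u. (\<forall>v. v \<notin> Inl ` monoms n 1 d \<union> Inr ` J \<longrightarrow> u v = 0) \<longrightarrow>
      poly_eval (lookup (expansion n d e m u)) F = poly_eval (lookup (expansion n d e m u)) G * u v)"
proof -
  let ?W = "Inl ` monoms n 1 d \<union> Inr ` J" and ?R = "monoms n (d + 1) m"
  have fin: "finite J" using J finite_monoms finite_subset by blast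
  have R_sub: "?R \<subseteq> monoms n 0 m" by (auto simp: monoms_def)
  \<comment> \<open>The sign comes from moving the coefficient of \<open>T\<close> itself,
    contributed by the constant term 1 of the denominator, to the right-hand side.\<close>
  define \<psi> where "\<psi> j = - (\<Sum>i\<in>?R. w j i * form_var i)" for j
  have \<psi>_form: "\<psi> j \<in> hforms n m (Suc k)" if "j \<in> J" for j
    unfolding \<psi>_def
  proof (intro hforms_uminus hforms_sum)
    fix i assume "i \<in> ?R"
    then show "w j i * form_var i \<in> hforms n m (Suc k)"
      using hforms_mult[OF w[OF that] hforms_var[of i]] R_sub by auto
  qed
  have eq: "lookup (expansion n d e m u) \<alpha> + (\<Sum>\<beta>\<in>J. u (Inr \<beta>) * pade_entry (expansion n d e m u) \<alpha> \<beta>) =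
      (if \<alpha> = 0 then 1 else if \<alpha> \<in> monoms n 1 d then u (Inl \<alpha>) else 0)"
    if u: "\<forall>v. v \<notin> ?W \<longrightarrow> u v = 0" and \<alpha>: "\<alpha> \<in> monoms n 0 m" for u \<alpha>
  proof -
    have "(\<Sum>\<beta>\<in>J. u (Inr \<beta>) * pade_entry (expansion n d e m u) \<alpha> \<beta>) =
        (\<Sum>\<beta>\<in>monoms n 1 e. u (Inr \<beta>) * pade_entry (expansion n d e m u) \<alpha> \<beta>)"
      by (rule sum.mono_neutral_left) (use J u in auto)
    then show ?thesis
      using eq_expansion_iff[OF expansion_in_polys, of n d e m u d e u] \<alpha> by simp
  qed
  have \<psi>_eval: "poly_eval (lookup (expansion n d e m u)) (\<psi> j) =
      poly_eval (lookup (expansion n d e m u)) \<delta> * u (Inr j)"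
    if u: "\<forall>v. v \<notin> ?W \<longrightarrow> u v = 0" and j: "j \<in> J" for u j
  proof -
    let ?T = "expansion n d e m u"
    let ?w = "\<lambda>i. poly_eval (lookup ?T) (w j i)"
    have "- lookup ?T i = (\<Sum>\<beta>\<in>J. u (Inr \<beta>) * pade_entry ?T i \<beta>)" if i: "i \<in> ?R" for i
    proof -
      have "i \<in> monoms n 0 m" "i \<noteq> 0" "i \<notin> monoms n 1 d"
        using i by (auto simp: monoms_def mdeg_def)
      then show ?thesis using eq[OF u, of i] by (simp add: minus_unique)
    qed
    then have "poly_eval (lookup ?T) (\<psi> j) = (\<Sum>i\<in>?R. ?w i * (\<Sum>\<beta>\<in>J. u (Inr \<beta>) * pade_entry ?T i \<beta>))"
      unfolding \<psi>_def poly_eval_uminus poly_eval_sum poly_eval_mult poly_eval_var sum_negf[symmetric]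
      by (intro sum.cong) (simp_all flip: mult_minus_right)
    also have "\<dots> = (\<Sum>i\<in>?R. \<Sum>\<beta>\<in>J. u (Inr \<beta>) * (?w i * pade_entry ?T i \<beta>))"
      by (simp add: sum_distrib_left mult.left_commute)
    also have "\<dots> = (\<Sum>\<beta>\<in>J. u (Inr \<beta>) * (\<Sum>i\<in>?R. ?w i * pade_entry ?T i \<beta>))"
      by (subst sum.swap) (simp add: sum_distrib_left)
    also have "\<dots> = (\<Sum>\<beta>\<in>J. if \<beta> = j then u (Inr j) * poly_eval (lookup ?T) \<delta> else 0)"
    proof (rule sum.cong[OF refl])
      fix \<beta> assume "\<beta> \<in> J"
      have "(\<Sum>i\<in>?R. ?w i * pade_entry ?T i \<beta>) = poly_eval (lookup ?T) (\<Sum>i\<in>?R. w j i * pade_form i \<beta>)"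
        by (simp add: poly_eval_sum poly_eval_mult)
      then show "u (Inr \<beta>) * (\<Sum>i\<in>?R. ?w i * pade_entry ?T i \<beta>) =
          (if \<beta> = j then u (Inr j) * poly_eval (lookup ?T) \<delta> else 0)"
        using dual[OF j \<open>\<beta> \<in> J\<close>] by auto
    qed
    finally show ?thesis using fin j by (simp add: mult.commute)
  qed
  from v show ?thesis
  proof
    assume "v \<in> Inr ` J"
    then obtain j where j: "j \<in> J" "v = Inr j" by blast
    show ?thesis
      using \<psi>_form[OF j(1)] \<delta> nz \<psi>_eval[OF _ j(1)] unfolding j(2)
      by (intro exI[of _ "Suc k"] bexI[of _ "\<psi> j"] bexI[of _ \<delta>] conjI allI impI)
  next
    assume "v \<in> Inl ` monoms n 1 d"
    then obtain \<alpha> where \<alpha>: "\<alpha> \<in> monoms n 1 d" "v = Inl \<alpha>" by blast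
    \<comment> \<open>Here \<open>d \<le> m\<close> enters: the coefficient of \<open>T\<close> at
      \<alpha> has to be a projective coordinate.\<close>
    have \<alpha>_m: "\<alpha> \<in> monoms n 0 m" using \<alpha>(1) d by (auto simp: monoms_def)
    have \<alpha>_0: "\<alpha> \<noteq> 0" using \<alpha>(1) zero_not_in_monoms_1[of n d] by auto
    have m_0: "0 \<in> monoms n 0 m" by (simp add: monoms_0_eq)
    define F where "F = \<delta> * form_var \<alpha> + (\<Sum>\<beta>\<in>J. \<psi> \<beta> * pade_form \<alpha> \<beta>)"
    \<comment> \<open>The factor \<open>form_var 0\<close> has value 1 on the parametrization and
      raises the degree of \<delta> by one to match \<open>F\<close>.\<close>
    define G where "G = \<delta> * form_var 0"
    have "F \<in> hforms n m (Suc k + 1)"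
      unfolding F_def
      by (intro hforms_add hforms_sum hforms_mult \<delta> \<psi>_form hforms_var[OF \<alpha>_m] hforms_pade_form[OF \<alpha>_m])
    moreover have "G \<in> hforms n m (Suc k + 1)"
      unfolding G_def by (intro hforms_mult \<delta> hforms_var[OF m_0])
    moreover have "poly_eval (lookup (expansion n d e m p)) G \<noteq> 0"
      using nz by (simp add: G_def poly_eval_mult lookup_expansion_0)
    moreover have "poly_eval (lookup (expansion n d e m u)) F = poly_eval (lookup (expansion n d e m u)) G * u v"
      if u: "\<forall>v. v \<notin> ?W \<longrightarrow> u v = 0" for u
    proof -
      let ?T = "expansion n d e m u"
      have "poly_eval (lookup ?T) F = poly_eval (lookup ?T) \<delta> * lookup ?T \<alpha> +
          (\<Sum>\<beta>\<in>J. poly_eval (lookup ?T) \<delta> * u (Inr \<beta>) * pade_entry ?T \<alpha> \<beta>)"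
        unfolding F_def poly_eval_add poly_eval_sum poly_eval_mult poly_eval_var poly_eval_pade_form
        by (intro arg_cong2[of _ _ _ _ "(+)"] refl sum.cong) (simp add: \<psi>_eval[OF u])
      also have "\<dots> = poly_eval (lookup ?T) \<delta> *
          (lookup ?T \<alpha> + (\<Sum>\<beta>\<in>J. u (Inr \<beta>) * pade_entry ?T \<alpha> \<beta>))"
        by (simp add: distrib_left sum_distrib_left mult.assoc)
      also have "\<dots> = poly_eval (lookup ?T) \<delta> * u (Inl \<alpha>)"
        unfolding eq[OF u \<alpha>_m] using \<alpha>(1) \<alpha>_0 by simp
      finally show ?thesis
        by (simp add: G_def poly_eval_mult lookup_expansion_0 \<alpha>(2))
    qed
    ultimately show ?thesis
      by (intro exI[of _ "Suc k + 1"] bexI[of _ F] bexI[of _ G] conjI allI impI)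
  qed
qed

text \<open>If \<open>d\<close> exceeded \<open>m\<close>, Pascal's rule would make
  \<open>(d + n) choose n\<close> larger than \<open>(m + n) choose n\<close>; the extra summand is
  at least 1, which makes up for the subtracted 1.\<close>

lemma le_of_binomial_less:
  assumes "n \<ge> 1" "((d + n) choose n) - 1 + r < ((n + m) choose n)"
  shows "d \<le> m"
proof (rule ccontr)
  assume "\<not> d \<le> m"
  then have "Suc m + n \<le> d + n" by simp
  then have mono: "(Suc m + n) choose n \<le> (d + n) choose n"
    by (rule binomial_right_mono)
  obtain n' where n': "n = Suc n'" using assms(1) by (cases n) auto
  have "(Suc m + n) choose n = ((m + n) choose n') + ((m + n) choose n)"
    by (simp add: n')
  moreover have "(m + n) choose n' > 0" by (simp add: n')
  ultimately show False
    using mono assms(2) unfolding add.commute[of n m] by linarith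
qed

lemma mat_rank_reduced_pade_matrix:
  "mat_rank (reduced_pade_matrix n d e m T) =
    mat_rank (mat (length (sorted_list_of_set (monoms n (d + 1) m))) (length (sorted_list_of_set (monoms n 1 e)))
      (\<lambda>(i, j). pade_entry T (sorted_list_of_set (monoms n (d + 1) m) ! i) (sorted_list_of_set (monoms n 1 e) ! j)))"
proof -
  have "monoms n 0 e - {0} = monoms n 1 e" by (auto simp: monoms_0_eq)
  then show ?thesis by (simp only: reduced_pade_matrix_def pade_submatrix_def)
qed

theorem theorem5p1:
  fixes n d e m r :: nat
  assumes "n \<ge> 1"
    and "generic_pade_rank n d e m r"
    and "((d + n) choose n) - 1 + r < ((n + m) choose n)"
  shows "krull_dim (taylor_top n d e m) = enat (((d + n) choose n) - 1 + r)"
proof -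
  let ?\<phi> = "expansion n d e m" and ?R = "monoms n (d + 1) m" and ?C = "monoms n 1 e"
  let ?rs = "sorted_list_of_set ?R" and ?cs = "sorted_list_of_set ?C"
  have sets: "set ?rs = ?R" "set ?cs = ?C" by simp_all
  have d: "d \<le> m" using assms(1,3) by (rule le_of_binomial_less)
  have X: "taylor_variety n d e m = expansion.image_closure n m d e UNIV"
    by (simp only: taylor_variety_def taylor_polys_eq_range expansion.image_closure_def)
  obtain U where U: "openin (taylor_top n d e m) U" "U \<noteq> {}"
    and rank: "\<And>p T. p \<in> U \<Longrightarrow> T \<in> p \<Longrightarrow> mat_rank (reduced_pade_matrix n d e m T) = r"
    using assms(2) unfolding generic_pade_rank_def by blast
  obtain V where V: "openin (zariski n m) V" "U = V \<inter> taylor_variety n d e m"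
    using U(1) unfolding taylor_top_def openin_subtopology by blast
  obtain S where S: "S \<subseteq> forms n m" "V = proj_space n m - zero_locus n m S"
    using V(1) unfolding openin_zariski by blast
  \<comment> \<open>A nonempty open subset of the closure meets the set of Taylor polynomials
    itself, so the generic rank is attained at a parameter.\<close>
  have "\<exists>u0. proj_point (?\<phi> u0) \<in> V"
  proof -
    obtain p where "p \<in> V" "p \<in> zariski n m closure_of (proj_point ` taylor_polys n d e m)"
      using U(2) V(2) unfolding taylor_variety_def by blast
    then obtain y where "y \<in> proj_point ` taylor_polys n d e m" "y \<in> V"
      using V(1) unfolding in_closure_of by blast
    then show ?thesis unfolding taylor_polys_eq_range by blast
  qed
  then obtain u0 where u0: "proj_point (?\<phi> u0) \<in> V" ..
  then have "proj_point (?\<phi> u0) \<notin> zero_locus n m S" "proj_point (?\<phi> u0) \<in> proj_space n m"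
    using S(2) by auto
  \<comment> \<open>A single form nonzero at \<open>u0\<close> replaces the open set: it is enough
    for the rank to be \<open>r\<close> wherever \<open>E\<close> is nonzero.\<close>
  then obtain E where E: "E \<in> S" "poly_eval (lookup (?\<phi> u0)) E \<noteq> 0"
    using mem_zero_locus_iff[OF S(1)] by blast
  have E_form: "E \<in> forms n m" using E(1) S(1) by blast
  have rank_eq: "mat_rank (reduced_pade_matrix n d e m (?\<phi> u)) = r"
    if "poly_eval (lookup (?\<phi> u)) E \<noteq> 0" for u
  proof (rule rank[OF _ proj_point_self])
    have "proj_point (?\<phi> u) \<notin> zero_locus n m S"
      using mem_zero_locus_iff[OF S(1)] E(1) that by blast
    moreover have "proj_point (?\<phi> u) \<in> proj_space n m"
      by (rule proj_point_mem_proj_space[OF expansion_in_polys expansion.\<phi>_nonzero])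
    moreover have "proj_point (?\<phi> u) \<in> taylor_variety n d e m"
      unfolding X by (rule expansion.mem_image_closure) simp
    ultimately show "proj_point (?\<phi> u) \<in> U" unfolding V(2) S(2) by blast
  qed
  obtain J where J: "J \<subseteq> ?C" "card J = r" "indep_columns ?R J (pade_entry (?\<phi> u0))"
    using mat_rank_indep_columns[of ?cs ?rs "pade_entry (?\<phi> u0)"] rank_eq[OF E(2)]
    unfolding mat_rank_reduced_pade_matrix sets by auto
  have finJ: "finite J" using J(1) finite_monoms finite_subset by blast
  have m_0: "0 \<in> monoms n 0 m" by (simp add: monoms_0_eq)
  have R_sub: "?R \<subseteq> monoms n 0 m" by (auto simp: monoms_def)
  \<comment> \<open>Elimination is carried out once, with pivots nonzero at \<open>u0\<close>; the
    resulting identities between forms hold at every point. The constant coordinate, of value 1,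
    serves as the auxiliary form of positive degree.\<close>
  have "\<exists>k \<delta> w. \<delta> \<in> hforms n m (Suc k) \<and> poly_eval (lookup (?\<phi> u0)) \<delta> \<noteq> 0
    \<and> (\<forall>j\<in>J. \<forall>i\<in>?R. w j i \<in> hforms n m k)
    \<and> (\<forall>j\<in>J. \<forall>j'\<in>J. (\<Sum>i\<in>?R. w j i * pade_form i j') = (if j = j' then \<delta> else 0))"
  proof (rule dual_forms[OF finJ finite_monoms _ hforms_var[OF m_0]])
    show "pade_form i j \<in> hforms n m 1" if "i \<in> ?R" for i j
      using that R_sub by (intro hforms_pade_form) blast
  qed (use J(3) lookup_expansion_0 in simp_all)
  then obtain k \<delta> w where \<delta>: "\<delta> \<in> hforms n m (Suc k)" "poly_eval (lookup (?\<phi> u0)) \<delta> \<noteq> 0"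
    and w: "\<And>j i. j \<in> J \<Longrightarrow> i \<in> ?R \<Longrightarrow> w j i \<in> hforms n m k"
    and dual: "\<And>j j'. j \<in> J \<Longrightarrow> j' \<in> J \<Longrightarrow>
      (\<Sum>i\<in>?R. w j i * pade_form i j') = (if j = j' then \<delta> else 0)"
    by blast
  let ?W = "Inl ` monoms n 1 d \<union> Inr ` J"
  have W: "finite ?W" using finJ by simp
  have card_W: "card ?W = ((d + n) choose n) - 1 + r"
    using finJ J(2) by (subst card_Un_disjoint) (auto simp: card_image card_monoms_1[simplified])
  have restrict: "\<exists>u'. (\<forall>v. v \<notin> ?W \<longrightarrow> u' v = 0) \<and> ?\<phi> u = ?\<phi> u'"
    if u: "poly_eval (lookup (?\<phi> u)) E \<noteq> 0" "poly_eval (lookup (?\<phi> u)) \<delta> \<noteq> 0" for u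
  proof (rule expansion_restricted_support[OF J(1)])
    fix \<beta> assume \<beta>: "\<beta> \<in> ?C"
    \<comment> \<open>Where \<delta> is nonzero, the dual functionals read off the coefficients of
      any relation, so the independence of \<open>J\<close> passes from \<open>u0\<close> to
      \<open>u\<close>.\<close>
    have "indep_columns ?R J (pade_entry (?\<phi> u))"
      unfolding indep_columns_def
    proof (intro allI impI ballI)
      fix c j assume c: "\<forall>i\<in>?R. (\<Sum>j\<in>J. c j * pade_entry (?\<phi> u) i j) = 0" and j: "j \<in> J"
      let ?ev = "poly_eval (lookup (?\<phi> u))"
      have "c j * ?ev \<delta> = (\<Sum>j'\<in>J. if j' = j then c j * ?ev \<delta> else 0)"
        using finJ j by simp
      also have "\<dots> = (\<Sum>j'\<in>J. c j' * ?ev (\<Sum>i\<in>?R. w j i * pade_form i j'))"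
        by (rule sum.cong) (use dual[OF j] in auto)
      also have "\<dots> = (\<Sum>j'\<in>J. \<Sum>i\<in>?R. ?ev (w j i) * (c j' * pade_entry (?\<phi> u) i j'))"
        by (simp add: poly_eval_sum poly_eval_mult sum_distrib_left mult.left_commute)
      also have "\<dots> = (\<Sum>i\<in>?R. ?ev (w j i) * (\<Sum>j'\<in>J. c j' * pade_entry (?\<phi> u) i j'))"
        by (subst sum.swap) (simp add: sum_distrib_left)
      also have "\<dots> = 0" using c by simp
      finally show "c j = 0" using u(2) by simp
    qed
    then show "\<exists>q. \<forall>\<alpha>\<in>?R. pade_entry (?\<phi> u) \<alpha> \<beta> = (\<Sum>j\<in>J. q j * pade_entry (?\<phi> u) \<alpha> j)"
      using mat_rank_column_span[of J ?cs ?rs "pade_entry (?\<phi> u)" \<beta>] J(1,2) \<beta> rank_eq[OF u(1)]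
      unfolding mat_rank_reduced_pade_matrix sets by simp
  qed
  show ?thesis
    unfolding taylor_top_def card_W[symmetric]
  proof -
    \<comment> \<open>\<open>u0\<close> itself may have coordinates outside \<open>?W\<close>;
      \<open>p\<close> has none and gives the same Taylor polynomial, so \<delta> stays
      nonzero.\<close>
    obtain p where p: "\<And>v. v \<notin> ?W \<Longrightarrow> p v = 0" "?\<phi> u0 = ?\<phi> p"
      using restrict[OF E(2) \<delta>(2)] by blast
    have "poly_eval (lookup (?\<phi> p)) \<delta> \<noteq> 0" using \<delta>(2) p(2) by simp
    note coord = coordinate_forms[OF d J(1) \<delta>(1) w dual _ this]
    have "\<exists>Y. (\<forall>i\<le>card ?W. closedin (zariski n m) (Y i) \<and> irreducible_in (zariski n m) (Y i)
        \<and> Y i \<subseteq> expansion.image_closure n m d e UNIV) \<and> (\<forall>i<card ?W. Y i \<subset> Y (Suc i))"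
      by (rule expansion.coordinate_chain[OF W p(1) coord])
    then obtain Y where Y: "(\<forall>i\<le>card ?W. closedin (zariski n m) (Y i) \<and> irreducible_in (zariski n m) (Y i)
        \<and> Y i \<subseteq> expansion.image_closure n m d e UNIV) \<and> (\<forall>i<card ?W. Y i \<subset> Y (Suc i))" ..
    show "krull_dim (subtopology (zariski n m) (taylor_variety n d e m)) = enat (card ?W)"
      unfolding X
    proof (rule krull_dim_subtopology_eqI[where Y = Y])
      show "closedin (zariski n m) (expansion.image_closure n m d e UNIV)"
        by (rule expansion.closedin_image_closure)
      show "closedin (zariski n m) (Y i) \<and> irreducible_in (zariski n m) (Y i)
        \<and> Y i \<subseteq> expansion.image_closure n m d e UNIV" if "i \<le> card ?W" for i
        using Y that by blast
      show "Y i \<subset> Y (Suc i)" if "i < card ?W" for i using Y that by blast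
      fix l Z
      assume Z: "\<And>i. i \<le> l \<Longrightarrow> closedin (zariski n m) (Z i) \<and> irreducible_in (zariski n m) (Z i)
          \<and> Z i \<subseteq> expansion.image_closure n m d e UNIV"
        "\<And>i. i < l \<Longrightarrow> Z i \<subset> Z (Suc i)"
      show "l \<le> card ?W"
      proof (rule expansion.chain_length_le[where Z = Z and l = l, OF W _ Z])
        fix G assume G: "G \<in> forms n m"
          and van: "\<And>u. (\<forall>v. v \<notin> ?W \<longrightarrow> u v = 0) \<Longrightarrow> poly_eval (lookup (?\<phi> u)) G = 0"
        \<comment> \<open>If \<open>G\<close> were nonzero at some \<open>u\<close>, the line from
          \<open>u\<close> to \<open>u0\<close> would contain a point where \<open>G\<close>,
          \<open>E\<close> and \<delta> are all nonzero, and that point could be replaced by a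
          parameter supported on \<open>?W\<close>.\<close>
        have E\<delta>: "E * \<delta> \<in> forms n m" "poly_eval (lookup (?\<phi> u0)) (E * \<delta>) \<noteq> 0"
          using forms_mult[OF E_form hforms_imp_forms[OF \<delta>(1)]] E(2) \<delta>(2)
          by (simp_all add: poly_eval_mult)
        show "expansion.image_closure n m d e UNIV \<subseteq> zero_locus n m {G}"
          unfolding expansion.image_closure_subset_zero_locus_iff[OF G]
        proof (rule ballI, rule ccontr)
          fix u assume "poly_eval (lookup (?\<phi> u)) G \<noteq> 0"
          from expansion.forms_nonvanishing_on_line[OF G E\<delta>(1) this E\<delta>(2)]
          obtain x where x: "poly_eval (lookup (?\<phi> x)) G \<noteq> 0" "poly_eval (lookup (?\<phi> x)) (E * \<delta>) \<noteq> 0"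
            by blast
          then obtain u' where "\<forall>v. v \<notin> ?W \<longrightarrow> u' v = 0" "?\<phi> x = ?\<phi> u'"
            using restrict[of x] by (auto simp: poly_eval_mult)
          then show False using van x(1) by simp
        qed
      qed
    qed
  qed
qed

end
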